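(* Let $\mathcal{C}$ be a class of topological semigroups such that $\mathsf{T}_{\mathsf z}\mathsf{S}\subseteq\mathcal{C}\subseteq\mathsf{T}_1\mathsf{S}$. A unipotent commutative semigroup $X$ is injectively $\mathcal{C}$-closed if and only if $X$ is bounded, nonsingular and group-finite.
   Context: A topological semigroup is a topological space $X$ endowed with a continuous associative binary operation $X\times X\to X$, $(x,y)\mapsto xy$. $\mathsf{T}_1\mathsf{S}$ denotes the class of topological semigroups satisfying the separation axiom $T_1$ (all finite subsets are closed). $\mathsf{T}_{\mathsf z}\mathsf{S}$ denotes the class of Hausdorff zero-dimensional topological semigroups, where a space is zero-dimensional if it has a base of the topology consisting of clopen sets. A topological semigroup $X$ is injectively $\mathcal{C}$-closed if for any injective continuous homomorphism $h:X\to Y$ to a topological semigroup $Y\in\mathcal{C}$ the image $h[X]$ is closed in $Y$. A semigroup $X$ (without topology) is injectively $\mathcal{C}$-closed if $X$ endowed with the discrete topology is injectively $\mathcal{C}$-closed. A semigroup $X$ is: unipotent if it contains a unique idempotent; bounded if there exists $n\in\mathbb{N}=\{1,2,3,\dots\}$ such that for every $x\in X$ the power $x^n$ is an idempotent; singular if there exists an infinite set $A\subseteq X$ such that $AA=\{ab:a,b\in A\}$ is a singleton; nonsingular if it is not singular; group-finite if every subgroup of $X$ (subsemigroup of $X$ that is a group) is finite. *)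

theory Defs
  imports "HOL-Analysis.Analysis" "HOL-Algebra.Group"
begin

definition semigroup_on :: "'a set \<Rightarrow> ('a \<Rightarrow> 'a \<Rightarrow> 'a) \<Rightarrow> bool" where
  "semigroup_on X m \<longleftrightarrow>
     (\<forall>x\<in>X. \<forall>y\<in>X. m x y \<in> X) \<and>
     (\<forall>x\<in>X. \<forall>y\<in>X. \<forall>z\<in>X. m (m x y) z = m x (m y z))"

definition commutative_on :: "'a set \<Rightarrow> ('a \<Rightarrow> 'a \<Rightarrow> 'a) \<Rightarrow> bool" where
  "commutative_on X m \<longleftrightarrow> (\<forall>x\<in>X. \<forall>y\<in>X. m x y = m y x)"

definition idempotent :: "('a \<Rightarrow> 'a \<Rightarrow> 'a) \<Rightarrow> 'a \<Rightarrow> bool" where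
  "idempotent m e \<longleftrightarrow> m e e = e"

definition unipotent :: "'a set \<Rightarrow> ('a \<Rightarrow> 'a \<Rightarrow> 'a) \<Rightarrow> bool" where
  "unipotent X m \<longleftrightarrow> (\<exists>!e. e \<in> X \<and> idempotent m e)"

text \<open>The power of \<open>x\<close> with exponent \<open>n \<ge> 1\<close>; the value at \<open>n = 0\<close> has no meaning.\<close>

definition semigroup_power :: "('a \<Rightarrow> 'a \<Rightarrow> 'a) \<Rightarrow> 'a \<Rightarrow> nat \<Rightarrow> 'a" where
  "semigroup_power m x n = (m x ^^ (n - 1)) x"

definition bounded_semigroup :: "'a set \<Rightarrow> ('a \<Rightarrow> 'a \<Rightarrow> 'a) \<Rightarrow> bool" where
  "bounded_semigroup X m \<longleftrightarrow>
     (\<exists>n\<ge>1. \<forall>x\<in>X. idempotent m (semigroup_power m x n))"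

definition singular_semigroup :: "'a set \<Rightarrow> ('a \<Rightarrow> 'a \<Rightarrow> 'a) \<Rightarrow> bool" where
  "singular_semigroup X m \<longleftrightarrow>
     (\<exists>A\<subseteq>X. infinite A \<and> is_singleton {m a b |a b. a \<in> A \<and> b \<in> A})"

definition nonsingular_semigroup :: "'a set \<Rightarrow> ('a \<Rightarrow> 'a \<Rightarrow> 'a) \<Rightarrow> bool" where
  "nonsingular_semigroup X m \<longleftrightarrow> \<not> singular_semigroup X m"

text \<open>A subgroup of \<open>X\<close> is a subset that forms a group under the operation of \<open>X\<close>.  Its unit \<open>e\<close> lies in
  \<open>G\<close> by the group laws and need not be a unit of \<open>X\<close>.\<close>

definition group_finite :: "'a set \<Rightarrow> ('a \<Rightarrow> 'a \<Rightarrow> 'a) \<Rightarrow> bool" where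
  "group_finite X m \<longleftrightarrow>
     (\<forall>G\<subseteq>X. (\<exists>e. group \<lparr>carrier = G, monoid.mult = m, one = e\<rparr>) \<longrightarrow> finite G)"

text \<open>A topological semigroup is a topology together with a binary operation; the carrier is the
  underlying set of the topology.  Values of the operation outside the carrier are irrelevant.\<close>

type_synonym 'a topsemigroup = "'a topology \<times> ('a \<Rightarrow> 'a \<Rightarrow> 'a)"

definition topological_semigroup :: "'a topsemigroup \<Rightarrow> bool" where
  "topological_semigroup = (\<lambda>(T, m).
     semigroup_on (topspace T) m \<and>
     continuous_map (prod_topology T T) T (\<lambda>(x, y). m x y))"

definition zero_dimensional_space :: "'a topology \<Rightarrow> bool" where
  "zero_dimensional_space T \<longleftrightarrow>
     (\<exists>B. (\<forall>U\<in>B. openin T U \<and> closedin T U) \<and>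
          openin T = arbitrary union_of (\<lambda>U. U \<in> B))"

definition T1S :: "'a topsemigroup set" where
  "T1S = {(T, m). topological_semigroup (T, m) \<and> t1_space T}"

definition TzS :: "'a topsemigroup set" where
  "TzS = {(T, m). topological_semigroup (T, m) \<and> Hausdorff_space T \<and> zero_dimensional_space T}"

definition semigroup_hom ::
    "'a set \<Rightarrow> ('a \<Rightarrow> 'a \<Rightarrow> 'a) \<Rightarrow> ('b \<Rightarrow> 'b \<Rightarrow> 'b) \<Rightarrow> ('a \<Rightarrow> 'b) \<Rightarrow> bool" where
  "semigroup_hom X m m' h \<longleftrightarrow> (\<forall>x\<in>X. \<forall>y\<in>X. h (m x y) = m' (h x) (h y))"

text \<open>A class of topological semigroups is a set \<open>C\<close> of topological semigroups carried by arbitrary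
  subsets of a type \<open>'b\<close>, which plays the role of the universe of sets.  Since \<open>'b\<close> need not be the
  type of the semigroup under study, targets may be of any cardinality; but the notion is only
  meaningful if \<open>'b\<close> has room for a copy of that semigroup.\<close>

definition injectively_closed_top :: "'b topsemigroup set \<Rightarrow> 'a topsemigroup \<Rightarrow> bool" where
  "injectively_closed_top C = (\<lambda>(T, m).
     \<forall>(T', m')\<in>C. \<forall>h.
       continuous_map T T' h \<and> inj_on h (topspace T) \<and> semigroup_hom (topspace T) m m' h
       \<longrightarrow> closedin T' (h ` topspace T))"

definition injectively_closed ::
    "'b topsemigroup set \<Rightarrow> 'a set \<Rightarrow> ('a \<Rightarrow> 'a \<Rightarrow> 'a) \<Rightarrow> bool" where
  "injectively_closed C X m \<longleftrightarrow> injectively_closed_top C (discrete_topology X, m)"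

end

(* Write e for the idempotent of X and H = eX, its maximal subgroup when X is periodic.

   Boundedness, nonsingularity and finiteness of H imply that every translate xX is finite. If an
   ultrafilter on X converges to y in a T1 topological semigroup, then x*z is therefore eventually
   constant in z for every x in X, and if y^2 lies in X but y does not, then the products x*y or the
   iterated squares of the points close to y form an infinite set A with AA a singleton. Applying
   this to y, y^2, y^4, ..., which ends in H, puts y into X.

   Conversely, each failure yields a zero-dimensional extension of X in which X is not closed. The
   points of the extension are filters on X, multiplied as such, and the sets of filters containing
   a given subset of X form a base. A singular set A contributes the images x*p of a free ultrafilter
   p on A. An x of infinite order contributes the translates of the filter generated by the sets of
   x^l with l >= n divisible by n!. If H is infinite, there are w_0, w_1, ... in H whose small powers avoid the
   subgroup generated by their predecessors; according to whether some set of n-th roots of e is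
   infinite, one takes H with a non-complete linear topology and adjoins the limit of w_0 ... w_k, or
   adjoins to each coset of the group generated by the w_k one point at infinity. Once X is known to be
   nonsingular, periodic and with H finite, its boundedness is a combinatorial argument along an
   ultrafilter on the natural numbers. *)

theory Submission
  imports Defs
begin

section \<open>Spaces of filters\<close>

text \<open>The type \<open>'b\<close> is only known to hold a copy of \<open>X\<close>, so an
  extension may have at most as many points as \<open>X\<close>. Limits in a T1 space need not be
  unique. The closedness argument therefore works with ultrafilters along which the relevant
  products take finitely many values; they are then eventually constant, and such limits are unique.
  An infinite \<open>H\<close> needs two constructions, since neither serves both cases. All proper
  subgroups of a quasicyclic group are finite, so it has no nondiscrete Hausdorff topology with a
  base of subgroups at the unit; there small powers of increasingly independent elements are used.
  In a group of exponent \<open>n\<close> this fails: if products along a filter tend to that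
  filter, so do the \<open>n\<close>-th powers, which are all \<open>e\<close>, and the filter
  cannot avoid \<open>e\<close>. There the subgroups generated by the tails of a sequence are
  used.\<close>

definition ultrafilter :: "'a filter \<Rightarrow> bool" where
  "ultrafilter F \<longleftrightarrow> F \<noteq> bot \<and> (\<forall>P. eventually P F \<or> eventually (\<lambda>x. \<not> P x) F)"

lemma ultrafilter_filtermap: "ultrafilter F \<Longrightarrow> ultrafilter (filtermap f F)"
  by (simp add: ultrafilter_def eventually_filtermap filtermap_bot_iff)

lemma ultrafilter_principal: "ultrafilter (principal {x})"
  by (auto simp: ultrafilter_def eventually_principal principal_eq_bot_iff)

text \<open>Zorn's lemma for the reversed order, since a finer filter is a smaller element of the
  lattice. A minimal nontrivial filter decides every \<open>P\<close>: unless it rejects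
  \<open>P\<close>, restricting it to \<open>P\<close> leaves it nontrivial, hence
  unchanged.\<close>

lemma ex_ultrafilter_le:
  assumes "F \<noteq> bot"
  obtains U where "U \<le> F" "ultrafilter U"
proof -
  define A where "A = {G. G \<noteq> bot \<and> G \<le> F}"
  have "\<exists>U\<in>A. \<forall>G\<in>A. U \<ge> G \<longrightarrow> G = U"
  proof (rule predicate_Zorn)
    show "partial_order_on A (relation_of (\<ge>) A)"
      by (rule partial_order_on_relation_ofI) auto
  next
    fix C assume C: "C \<in> Chains (relation_of (\<ge>) A)"
    then have CA: "C \<subseteq> A" and lin: "\<And>G H. G \<in> C \<Longrightarrow> H \<in> C \<Longrightarrow> G \<le> H \<or> H \<le> G"
      by (auto simp: Chains_def relation_of_def)
    show "\<exists>U\<in>A. \<forall>G\<in>C. U \<le> G"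
    proof (cases "C = {}")
      case True
      then show ?thesis using assms by (auto simp: A_def)
    next
      case False
      have "\<exists>K\<in>C. K \<le> inf G H" if "G \<in> C" "H \<in> C" for G H
        using lin[OF that] that by (elim disjE) (auto intro!: bexI)
      \<comment> \<open>What holds eventually in the infimum of a nonempty chain already holds
        eventually in one member, so the infimum stays nontrivial.\<close>
      then have "eventually P (Inf C) \<longleftrightarrow> (\<exists>G\<in>C. eventually P G)" for P
        by (rule eventually_Inf_base[OF False])
      then have "Inf C \<noteq> bot"
        using CA by (auto simp: trivial_limit_def A_def)
      moreover have "Inf C \<le> F"
        using False CA by (auto simp: A_def intro: Inf_lower2)
      ultimately show ?thesis
        by (auto simp: A_def Inf_lower)
    qed
  qed
  then obtain U where U: "U \<in> A" and max: "\<And>G. G \<in> A \<Longrightarrow> G \<le> U \<Longrightarrow> G = U"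
    by blast
  have "eventually P U \<or> eventually (\<lambda>x. \<not> P x) U" for P
  proof (rule disjCI)
    assume "\<not> eventually (\<lambda>x. \<not> P x) U"
    then have "inf U (principal {x. P x}) \<noteq> bot"
      by (auto simp: trivial_limit_def eventually_inf_principal)
    then have "inf U (principal {x. P x}) = U"
      using U by (intro max) (auto simp: A_def le_infI1)
    moreover have "eventually P (inf U (principal {x. P x}))"
      by (simp add: eventually_inf_principal)
    ultimately show "eventually P U"
      by simp
  qed
  then show thesis
    using that U by (auto simp: A_def ultrafilter_def)
qed

lemma ultrafilter_finite_range:
  assumes "ultrafilter F" "finite V" "eventually (\<lambda>i. g i \<in> V) F"
  shows "\<exists>v\<in>V. eventually (\<lambda>i. g i = v) F"
proof (rule ccontr)
  assume "\<not> ?thesis"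
  then have "\<forall>v\<in>V. eventually (\<lambda>i. g i \<noteq> v) F"
    using assms(1) by (auto simp: ultrafilter_def)
  then have "eventually (\<lambda>i. \<forall>v\<in>V. g i \<noteq> v) F"
    using assms(2) by (simp add: eventually_ball_finite)
  then have "eventually (\<lambda>i. False) F"
    using assms(3) by eventually_elim auto
  then show False
    using assms(1) by (simp add: ultrafilter_def trivial_limit_def)
qed

lemma free_filter_on_infinite:
  assumes "infinite A"
  obtains F where "ultrafilter F" "eventually (\<lambda>x. x \<in> A) F" "\<And>v. eventually (\<lambda>x. x \<noteq> v) F"
proof -
  define G where "G = inf cofinite (principal A)"
  have "G \<noteq> bot"
    using assms by (auto simp: G_def trivial_limit_def eventually_inf_principal eventually_cofinite)
  then obtain F where F: "F \<le> G" "ultrafilter F"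
    by (rule ex_ultrafilter_le)
  have "eventually (\<lambda>x. x \<in> A) G"
    by (auto simp: G_def eventually_inf_principal)
  moreover have "eventually (\<lambda>x. x \<noteq> v) G" for v
    by (auto simp: G_def eventually_inf_principal eventually_cofinite)
  ultimately show thesis
    using F that by (meson filter_leD)
qed

text \<open>The sets \<open>{b \<in> B. eventually P (\<phi> b)}\<close> form a base; when all \<open>\<phi> b\<close> are ultrafilters this is the
  topology inherited from the Stone space.\<close>

definition filter_topology :: "'b set \<Rightarrow> ('b \<Rightarrow> 'a filter) \<Rightarrow> 'b topology" where
  "filter_topology B \<phi> = topology (\<lambda>U. U \<subseteq> B \<and>
     (\<forall>b\<in>U. \<exists>P. eventually P (\<phi> b) \<and> {c \<in> B. eventually P (\<phi> c)} \<subseteq> U))"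

lemma openin_filter_topology:
  "openin (filter_topology B \<phi>) U \<longleftrightarrow> U \<subseteq> B \<and>
     (\<forall>b\<in>U. \<exists>P. eventually P (\<phi> b) \<and> {c \<in> B. eventually P (\<phi> c)} \<subseteq> U)"
proof -
  have "istopology (\<lambda>U. U \<subseteq> B \<and>
     (\<forall>b\<in>U. \<exists>P. eventually P (\<phi> b) \<and> {c \<in> B. eventually P (\<phi> c)} \<subseteq> U))" (is "istopology ?T")
    unfolding istopology_def
  proof (intro conjI[of "\<forall>U V. _ U V"] allI impI)
    fix U V assume U: "?T U" and V: "?T V"
    show "?T (U \<inter> V)"
    proof (intro conjI ballI)
      fix b assume "b \<in> U \<inter> V"
      then obtain P Q where "eventually P (\<phi> b)" "{c \<in> B. eventually P (\<phi> c)} \<subseteq> U"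
        "eventually Q (\<phi> b)" "{c \<in> B. eventually Q (\<phi> c)} \<subseteq> V"
        using U V by blast
      then show "\<exists>P. eventually P (\<phi> b) \<and> {c \<in> B. eventually P (\<phi> c)} \<subseteq> U \<inter> V"
        by (intro exI[of _ "\<lambda>x. P x \<and> Q x"]) (auto simp: eventually_conj_iff)
    qed (use U in auto)
  next
    fix \<K> assume K: "\<forall>U\<in>\<K>. ?T U"
    show "?T (\<Union>\<K>)"
    proof (intro conjI ballI)
      fix b assume "b \<in> \<Union>\<K>"
      then obtain U where "U \<in> \<K>" "b \<in> U" by blast
      then show "\<exists>P. eventually P (\<phi> b) \<and> {c \<in> B. eventually P (\<phi> c)} \<subseteq> \<Union>\<K>"
        using K by (meson Union_upper subset_trans)
    qed (use K in auto)
  qed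
  then show ?thesis
    by (simp add: filter_topology_def topology_inverse')
qed

lemma openin_filter_topology_basic: "openin (filter_topology B \<phi>) {c \<in> B. eventually P (\<phi> c)}"
  by (auto simp: openin_filter_topology)

lemma topspace_filter_topology [simp]: "topspace (filter_topology B \<phi>) = B"
proof
  have "openin (filter_topology B \<phi>) B"
    using openin_filter_topology_basic[of B \<phi> "\<lambda>_. True"] by simp
  then show "B \<subseteq> topspace (filter_topology B \<phi>)"
    by (rule openin_subset)
  show "topspace (filter_topology B \<phi>) \<subseteq> B"
    using openin_topspace[of "filter_topology B \<phi>"] by (simp only: openin_filter_topology)
qed

lemma Hausdorff_filter_topology:
  assumes "\<And>b c. b \<in> B \<Longrightarrow> c \<in> B \<Longrightarrow> b \<noteq> c \<Longrightarrow> inf (\<phi> b) (\<phi> c) = bot"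
    and "\<And>b. b \<in> B \<Longrightarrow> \<phi> b \<noteq> bot"
  shows "Hausdorff_space (filter_topology B \<phi>)"
  unfolding Hausdorff_space_def
proof (intro allI impI)
  fix b c assume "b \<in> topspace (filter_topology B \<phi>) \<and> c \<in> topspace (filter_topology B \<phi>) \<and> b \<noteq> c"
  then have "inf (\<phi> b) (\<phi> c) = bot" and b: "b \<in> B" and c: "c \<in> B"
    using assms(1) by auto
  then obtain P Q where PQ: "eventually P (\<phi> b)" "eventually Q (\<phi> c)" "\<And>x. \<not> (P x \<and> Q x)"
    unfolding trivial_limit_def eventually_inf by blast
  have "disjnt {d \<in> B. eventually P (\<phi> d)} {d \<in> B. eventually Q (\<phi> d)}"
    unfolding disjnt_iff
  proof (intro allI notI)
    fix d assume "d \<in> {d \<in> B. eventually P (\<phi> d)} \<and> d \<in> {d \<in> B. eventually Q (\<phi> d)}"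
    then have "d \<in> B" "eventually (\<lambda>x. P x \<and> Q x) (\<phi> d)"
      by (auto simp: eventually_conj_iff)
    then show False
      using PQ(3) assms(2) by (simp add: trivial_limit_def)
  qed
  then show "\<exists>U V. openin (filter_topology B \<phi>) U \<and> openin (filter_topology B \<phi>) V \<and> b \<in> U \<and> c \<in> V \<and> disjnt U V"
    using PQ b c by (intro exI[of _ "{d \<in> B. eventually P (\<phi> d)}"] exI[of _ "{d \<in> B. eventually Q (\<phi> d)}"])
      (simp add: openin_filter_topology_basic)
qed

text \<open>If every filter of the family decides \<open>Q\<close>, the basic open set of the
  negation of \<open>Q\<close> is the complement of that of \<open>Q\<close>. Such \<open>Q\<close>
  give clopen sets, and \<open>dec\<close> supplies enough of them for a base.\<close>

lemma zero_dimensional_filter_topology: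
  assumes nb: "\<And>b. b \<in> B \<Longrightarrow> \<phi> b \<noteq> bot"
    and dec: "\<And>b P. b \<in> B \<Longrightarrow> eventually P (\<phi> b) \<Longrightarrow>
      \<exists>Q. eventually Q (\<phi> b) \<and> (\<forall>x. Q x \<longrightarrow> P x) \<and>
          (\<forall>c\<in>B. eventually Q (\<phi> c) \<or> eventually (\<lambda>x. \<not> Q x) (\<phi> c))"
  shows "zero_dimensional_space (filter_topology B \<phi>)"
proof -
  define D where "D Q \<longleftrightarrow> (\<forall>c\<in>B. eventually Q (\<phi> c) \<or> eventually (\<lambda>x. \<not> Q x) (\<phi> c))" for Q
  define \<B> where "\<B> = {{c \<in> B. eventually Q (\<phi> c)} | Q. D Q}"
  have "closedin (filter_topology B \<phi>) {c \<in> B. eventually Q (\<phi> c)}" if "D Q" for Q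
  proof -
    have "B - {c \<in> B. eventually Q (\<phi> c)} = {c \<in> B. eventually (\<lambda>x. \<not> Q x) (\<phi> c)}"
    proof -
      have "\<not> (eventually Q (\<phi> c) \<and> eventually (\<lambda>x. \<not> Q x) (\<phi> c))" if "c \<in> B" for c
        using nb[OF that] by (auto simp: trivial_limit_def eventually_conj_iff[symmetric])
      then show ?thesis
        using that by (auto simp: D_def)
    qed
    then show ?thesis
      using openin_filter_topology_basic[of B \<phi>] by (auto simp: closedin_def)
  qed
  then have clopen: "\<forall>U\<in>\<B>. openin (filter_topology B \<phi>) U \<and> closedin (filter_topology B \<phi>) U"
    using openin_filter_topology_basic[of B \<phi>] by (auto simp: \<B>_def)
  have "openin (filter_topology B \<phi>) = arbitrary union_of (\<lambda>U. U \<in> \<B>)"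
    unfolding openin_topology_base_unique
  proof (intro conjI allI impI)
    show "openin (filter_topology B \<phi>) V" if "V \<in> \<B>" for V
      using clopen that by blast
  next
    fix U b assume "openin (filter_topology B \<phi>) U \<and> b \<in> U"
    then obtain P where P: "b \<in> B" "b \<in> U" "eventually P (\<phi> b)" "{c \<in> B. eventually P (\<phi> c)} \<subseteq> U"
      unfolding openin_filter_topology by blast
    then obtain Q where Q: "eventually Q (\<phi> b)" "\<And>x. Q x \<longrightarrow> P x" "D Q"
      using dec[of b P] by (auto simp: D_def)
    then have "{c \<in> B. eventually Q (\<phi> c)} \<subseteq> {c \<in> B. eventually P (\<phi> c)}"
      by (auto elim: eventually_mono)
    then show "\<exists>V. V \<in> \<B> \<and> b \<in> V \<and> V \<subseteq> U"
      using P Q by (intro exI[of _ "{c \<in> B. eventually Q (\<phi> c)}"]) (auto simp: \<B>_def)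
  qed
  then show ?thesis
    unfolding zero_dimensional_space_def using clopen by blast
qed

section \<open>Size and semigroup structure of the extensions\<close>

lemma lepoll_times_nat:
  includes cardinal_syntax
  assumes "infinite X"
  shows "X \<times> (UNIV :: nat set) \<lesssim> X"
proof -
  have "|X \<times> (UNIV :: nat set)| \<le>o |X \<times> X|"
    using assms infinite_iff_card_of_nat card_of_Times_mono2 by blast
  also have "|X \<times> X| =o |X|"
    using assms by (rule card_of_Times_same_infinite)
  finally show ?thesis
    by (simp add: lepoll_def card_of_ordLeq)
qed

text \<open>Bounds the size of the extensions. In the applications index 0 gives the points of
  \<open>X\<close>, positive indices the new points attached to them, and \<open>a\<close> is one
  exceptional filter.\<close>

lemma insert_image_times_nat_lepoll:
  assumes "infinite X"
  shows "insert a (f ` (X \<times> (UNIV :: nat set))) \<lesssim> X"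
proof (cases "finite (f ` (X \<times> (UNIV :: nat set)))")
  case True
  then show ?thesis
    using assms by (simp add: finite_lepoll_infinite)
next
  case False
  then have "insert a (f ` (X \<times> (UNIV :: nat set))) \<lesssim> f ` (X \<times> (UNIV :: nat set))"
    by (rule infinite_insert_lepoll)
  also have "\<dots> \<lesssim> X \<times> (UNIV :: nat set)"
    by (rule image_lepoll)
  also have "\<dots> \<lesssim> X"
    using assms by (rule lepoll_times_nat)
  finally show ?thesis .
qed

text \<open>Both semigroup laws and continuity come from convergence alone. For associativity, sets
  belonging to the filters of the two bracketings always meet, namely in the product of a triple of
  elements of \<open>X\<close>; so the two filters are not disjoint and the two points
  agree.\<close>

lemma filter_topology_in_TzS:
  fixes \<phi> :: "'b \<Rightarrow> 'a filter"
  assumes nb: "\<And>b. b \<in> B \<Longrightarrow> \<phi> b \<noteq> bot"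
    and sup: "\<And>b. b \<in> B \<Longrightarrow> eventually (\<lambda>x. x \<in> X) (\<phi> b)"
    and disj: "\<And>b c. b \<in> B \<Longrightarrow> c \<in> B \<Longrightarrow> b \<noteq> c \<Longrightarrow> inf (\<phi> b) (\<phi> c) = bot"
    and dec: "\<And>b P. b \<in> B \<Longrightarrow> eventually P (\<phi> b) \<Longrightarrow>
      \<exists>Q. eventually Q (\<phi> b) \<and> (\<forall>x. Q x \<longrightarrow> P x) \<and>
          (\<forall>c\<in>B. eventually Q (\<phi> c) \<or> eventually (\<lambda>x. \<not> Q x) (\<phi> c))"
    and X: "semigroup_on X m"
    and op: "\<And>b c. b \<in> B \<Longrightarrow> c \<in> B \<Longrightarrow>
      op b c \<in> B \<and> filterlim (\<lambda>(x, y). m x y) (\<phi> (op b c)) (\<phi> b \<times>\<^sub>F \<phi> c)"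
  shows "(filter_topology B \<phi>, op) \<in> TzS"
proof -
  let ?T = "filter_topology B \<phi>"
  have ev_op: "\<exists>R S. eventually R (\<phi> b) \<and> eventually S (\<phi> c) \<and> (\<forall>x y. R x \<longrightarrow> S y \<longrightarrow> P (m x y))"
    if "b \<in> B" "c \<in> B" "eventually P (\<phi> (op b c))" for b c P
    using op[OF that(1,2)] that(3) by (simp add: filterlim_iff eventually_prod_filter)
  have "op (op b c) d = op b (op c d)" if B: "b \<in> B" "c \<in> B" "d \<in> B" for b c d
  proof (rule ccontr)
    assume "op (op b c) d \<noteq> op b (op c d)"
    then have "inf (\<phi> (op (op b c) d)) (\<phi> (op b (op c d))) = bot"
      using B op by (intro disj) auto
    then obtain P Q where P: "eventually P (\<phi> (op (op b c) d))" and Q: "eventually Q (\<phi> (op b (op c d)))"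
      and PQ: "\<And>x. \<not> (P x \<and> Q x)"
      unfolding trivial_limit_def eventually_inf by blast
    obtain P12 P3 where P12: "eventually P12 (\<phi> (op b c))" and P3: "eventually P3 (\<phi> d)"
      and PP: "\<And>x y. P12 x \<Longrightarrow> P3 y \<Longrightarrow> P (m x y)"
      using ev_op[OF _ _ P] B op by blast
    obtain P1 P2 where P1: "eventually P1 (\<phi> b)" and P2: "eventually P2 (\<phi> c)"
      and PP12: "\<And>x y. P1 x \<Longrightarrow> P2 y \<Longrightarrow> P12 (m x y)"
      using ev_op[OF _ _ P12] B by blast
    obtain Q1 Q23 where Q1: "eventually Q1 (\<phi> b)" and Q23: "eventually Q23 (\<phi> (op c d))"
      and QQ: "\<And>x y. Q1 x \<Longrightarrow> Q23 y \<Longrightarrow> Q (m x y)"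
      using ev_op[OF _ _ Q] B op by blast
    obtain Q2 Q3 where Q2: "eventually Q2 (\<phi> c)" and Q3: "eventually Q3 (\<phi> d)"
      and QQ23: "\<And>x y. Q2 x \<Longrightarrow> Q3 y \<Longrightarrow> Q23 (m x y)"
      using ev_op[OF _ _ Q23] B by blast
    have "\<exists>x. P1 x \<and> Q1 x \<and> x \<in> X"
      using eventually_happens'[OF nb[OF B(1)] eventually_conj[OF P1 eventually_conj[OF Q1 sup[OF B(1)]]]] .
    moreover have "\<exists>x. P2 x \<and> Q2 x \<and> x \<in> X"
      using eventually_happens'[OF nb[OF B(2)] eventually_conj[OF P2 eventually_conj[OF Q2 sup[OF B(2)]]]] .
    moreover have "\<exists>x. P3 x \<and> Q3 x \<and> x \<in> X"
      using eventually_happens'[OF nb[OF B(3)] eventually_conj[OF P3 eventually_conj[OF Q3 sup[OF B(3)]]]] .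
    ultimately obtain x y z where xyz: "P1 x" "Q1 x" "x \<in> X" "P2 y" "Q2 y" "y \<in> X" "P3 z" "Q3 z" "z \<in> X"
      by blast
    then have "P (m (m x y) z)" "Q (m x (m y z))"
      using PP PP12 QQ QQ23 by blast+
    moreover have "m (m x y) z = m x (m y z)"
      using X xyz by (auto simp: semigroup_on_def)
    ultimately show False
      using PQ by metis
  qed
  then have "semigroup_on B op"
    using op by (auto simp: semigroup_on_def)
  moreover have "continuous_map (prod_topology ?T ?T) ?T (\<lambda>(b, c). op b c)"
    unfolding continuous_map_def
  proof (intro conjI allI impI)
    show "(\<lambda>(b, c). op b c) \<in> topspace (prod_topology ?T ?T) \<rightarrow> topspace ?T"
      using op by auto
    fix U assume U: "openin ?T U"
    show "openin (prod_topology ?T ?T)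
        {p \<in> topspace (prod_topology ?T ?T). (case p of (b, c) \<Rightarrow> op b c) \<in> U}"
      unfolding openin_prod_topology_alt
    proof (intro allI impI)
      fix b c
      assume "(b, c) \<in> {p \<in> topspace (prod_topology ?T ?T). (case p of (b, c) \<Rightarrow> op b c) \<in> U}"
      then have B: "b \<in> B" "c \<in> B" "op b c \<in> U" by auto
      then obtain P' where P': "eventually P' (\<phi> (op b c))" "{d \<in> B. eventually P' (\<phi> d)} \<subseteq> U"
        using U unfolding openin_filter_topology by blast
      obtain P where P: "eventually P (\<phi> (op b c))" and le: "\<And>x. P x \<Longrightarrow> P' x"
        and P_dec: "\<And>d. d \<in> B \<Longrightarrow> eventually P (\<phi> d) \<or> eventually (\<lambda>x. \<not> P x) (\<phi> d)"
        using dec[OF _ P'(1)] op[OF B(1,2)] by blast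
      have PU: "d \<in> U" if "d \<in> B" "eventually P (\<phi> d)" for d
        using that P'(2) le by (blast intro: eventually_mono)
      obtain R S where R: "eventually R (\<phi> b)" and S: "eventually S (\<phi> c)"
        and RS: "\<And>x y. R x \<Longrightarrow> S y \<Longrightarrow> P (m x y)"
        using ev_op[OF _ _ P] B by blast
      \<comment> \<open>Products of elements near \<open>b'\<close> and \<open>c'\<close> satisfy
        \<open>P\<close>, but the filter of \<open>op b' c'\<close> may be coarser than the filter
        of these products. As it decides \<open>P\<close>, it is enough to exclude that it rejects
        \<open>P\<close>.\<close>
      have "op b' c' \<in> U" if b': "b' \<in> B" "eventually R (\<phi> b')" and c': "c' \<in> B" "eventually S (\<phi> c')" for b' c'
      proof (rule ccontr)
        assume "op b' c' \<notin> U"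
        then have "eventually (\<lambda>x. \<not> P x) (\<phi> (op b' c'))"
          using P_dec PU op b' c' by blast
        then obtain R' S' where R': "eventually R' (\<phi> b')" and S': "eventually S' (\<phi> c')"
          and RS': "\<And>x y. R' x \<Longrightarrow> S' y \<Longrightarrow> \<not> P (m x y)"
          using ev_op[of b' c' "\<lambda>x. \<not> P x"] b' c' by blast
        have "\<exists>x. R x \<and> R' x" "\<exists>y. S y \<and> S' y"
          using nb b' c' R' S' by (blast intro: eventually_happens' eventually_conj)+
        then show False
          using RS RS' by blast
      qed
      then show "\<exists>V W. openin ?T V \<and> openin ?T W \<and> b \<in> V \<and> c \<in> W \<and>
          V \<times> W \<subseteq> {p \<in> topspace (prod_topology ?T ?T). (case p of (b, c) \<Rightarrow> op b c) \<in> U}"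
        using B R S
        by (intro exI[of _ "{d \<in> B. eventually R (\<phi> d)}"] exI[of _ "{d \<in> B. eventually S (\<phi> d)}"])
          (auto simp: openin_filter_topology_basic)
    qed
  qed
  ultimately show ?thesis
    using Hausdorff_filter_topology[of B \<phi>] zero_dimensional_filter_topology[of B \<phi>] nb disj dec
    by (auto simp: TzS_def topological_semigroup_def)
qed

text \<open>The filters in \<open>\<Y>\<close> are the points of the extension. Their product need only refine some member of
  \<open>\<Y>\<close>, which is unique because members are pairwise disjoint; \<open>dec\<close> provides a clopen base.\<close>

theorem filter_extension:
  fixes X :: "'a set" and C :: "'b topsemigroup set"
  assumes X: "semigroup_on X m" "X \<lesssim> (UNIV :: 'b set)"
    and C: "TzS \<subseteq> C" "injectively_closed C X m"
    and card: "\<Y> \<lesssim> X"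
    and nb: "\<And>F. F \<in> \<Y> \<Longrightarrow> F \<noteq> bot"
    and sup: "\<And>F. F \<in> \<Y> \<Longrightarrow> eventually (\<lambda>x. x \<in> X) F"
    and disj: "\<And>F G. F \<in> \<Y> \<Longrightarrow> G \<in> \<Y> \<Longrightarrow> F \<noteq> G \<Longrightarrow> inf F G = bot"
    and dec: "\<And>F P. F \<in> \<Y> \<Longrightarrow> eventually P F \<Longrightarrow>
      \<exists>Q. eventually Q F \<and> (\<forall>x. Q x \<longrightarrow> P x) \<and>
          (\<forall>G\<in>\<Y>. eventually Q G \<or> eventually (\<lambda>x. \<not> Q x) G)"
    and mult: "\<And>F G. F \<in> \<Y> \<Longrightarrow> G \<in> \<Y> \<Longrightarrow> \<exists>K\<in>\<Y>. filterlim (\<lambda>(x, y). m x y) K (F \<times>\<^sub>F G)"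
    and N: "\<And>x. x \<in> X \<Longrightarrow> N x \<in> \<Y>" "inj_on N X"
      "\<And>x y. x \<in> X \<Longrightarrow> y \<in> X \<Longrightarrow> filterlim (\<lambda>(x, y). m x y) (N (m x y)) (N x \<times>\<^sub>F N y)"
    and F: "F \<in> \<Y>" "\<And>P. eventually P F \<Longrightarrow> \<exists>x\<in>X. eventually P (N x)"
  shows "F \<in> N ` X"
proof (rule ccontr)
  assume notin: "F \<notin> N ` X"
  have "\<Y> \<lesssim> (UNIV :: 'b set)"
    using X(2) card lepoll_trans by blast
  then obtain \<iota> :: "'a filter \<Rightarrow> 'b" where \<iota>: "inj_on \<iota> \<Y>"
    by (auto simp: lepoll_def)
  define B where "B = \<iota> ` \<Y>"
  define \<phi> where "\<phi> = the_inv_into \<Y> \<iota>"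
  have \<phi>: "\<phi> (\<iota> F) = F" if "F \<in> \<Y>" for F
    using \<iota> that by (simp add: \<phi>_def the_inv_into_f_f)
  have \<phi>B: "\<phi> b \<in> \<Y>" if "b \<in> B" for b
    using that \<phi> by (auto simp: B_def)
  have inj: "\<phi> b \<noteq> \<phi> c" if "b \<in> B" "c \<in> B" "b \<noteq> c" for b c
    using that \<phi> by (auto simp: B_def)
  have ex: "\<exists>d. d \<in> B \<and> filterlim (\<lambda>(x, y). m x y) (\<phi> d) (\<phi> b \<times>\<^sub>F \<phi> c)" if "b \<in> B" "c \<in> B" for b c
    using mult[OF \<phi>B[OF that(1)] \<phi>B[OF that(2)]] \<phi> by (metis B_def imageI)
  define op where "op b c = (SOME d. d \<in> B \<and> filterlim (\<lambda>(x, y). m x y) (\<phi> d) (\<phi> b \<times>\<^sub>F \<phi> c))" for b c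
  have op: "op b c \<in> B \<and> filterlim (\<lambda>(x, y). m x y) (\<phi> (op b c)) (\<phi> b \<times>\<^sub>F \<phi> c)"
    if "b \<in> B" "c \<in> B" for b c
    unfolding op_def by (rule someI_ex[OF ex[OF that]])
  have "(filter_topology B \<phi>, op) \<in> TzS"
  proof (rule filter_topology_in_TzS[OF _ _ _ _ X(1) op])
    show "\<exists>Q. eventually Q (\<phi> b) \<and> (\<forall>x. Q x \<longrightarrow> P x) \<and>
          (\<forall>c\<in>B. eventually Q (\<phi> c) \<or> eventually (\<lambda>x. \<not> Q x) (\<phi> c))"
      if "b \<in> B" "eventually P (\<phi> b)" for b P
      using dec[OF \<phi>B that(2)] \<phi>B that(1) by blast
  qed (use nb sup disj \<phi>B inj in auto)
  then have "(filter_topology B \<phi>, op) \<in> C"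
    using C(1) by blast
  moreover define h where "h x = \<iota> (N x)" for x
  have hB: "h x \<in> B" if "x \<in> X" for x
    using N(1) that by (auto simp: h_def B_def)
  have "inj_on h X"
    using N(1,2) \<iota> by (auto simp: h_def inj_on_def)
  moreover have "continuous_map (discrete_topology X) (filter_topology B \<phi>) h"
    using hB by (auto simp: continuous_map_def)
  \<comment> \<open>The image of the product filter is nontrivial and refines the filters of both
    sides, so these cannot be disjoint.\<close>
  moreover have "h (m x y) = op (h x) (h y)" if xy: "x \<in> X" "y \<in> X" for x y
  proof (rule ccontr)
    assume ne: "h (m x y) \<noteq> op (h x) (h y)"
    have mxy: "m x y \<in> X"
      using X(1) xy by (auto simp: semigroup_on_def)
    let ?K = "N x \<times>\<^sub>F N y" and ?\<mu> = "\<lambda>(x, y). m x y"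
    have "filtermap ?\<mu> ?K \<le> N (m x y)"
      using N(3)[OF xy] by (simp add: filterlim_def)
    moreover have "filtermap ?\<mu> ?K \<le> \<phi> (op (h x) (h y))"
      using op[OF hB[OF xy(1)] hB[OF xy(2)]] N(1) xy by (simp add: filterlim_def h_def \<phi>)
    moreover have "inf (N (m x y)) (\<phi> (op (h x) (h y))) = bot"
    proof (rule disj)
      show "N (m x y) \<noteq> \<phi> (op (h x) (h y))"
        using inj[OF hB[OF mxy] conjunct1[OF op[OF hB[OF xy(1)] hB[OF xy(2)]]] ne] N(1) mxy
        by (simp add: h_def \<phi>)
    qed (use N(1) mxy \<phi>B op hB xy in auto)
    ultimately have "filtermap ?\<mu> ?K = bot"
      by (metis inf.bounded_iff bot_unique)
    then show False
      using nb N(1) xy by (auto simp: filtermap_bot_iff prod_filter_eq_bot)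
  qed
  ultimately have "closedin (filter_topology B \<phi>) (h ` X)"
    using C(2) by (auto simp: injectively_closed_def injectively_closed_top_def semigroup_hom_def)
  then have "openin (filter_topology B \<phi>) (B - h ` X)"
    by (simp add: closedin_def)
  moreover have "\<iota> F \<in> B - h ` X"
    using notin F(1) N(1) \<iota> by (auto simp: B_def h_def inj_on_def)
  ultimately obtain P where P: "eventually P F" "{c \<in> B. eventually P (\<phi> c)} \<subseteq> B - h ` X"
    unfolding openin_filter_topology using \<phi> F(1) by metis
  then obtain x where "x \<in> X" "eventually P (N x)"
    using F(2) by blast
  then have "h x \<in> {c \<in> B. eventually P (\<phi> c)}"
    using hB N(1) by (auto simp: h_def \<phi>)
  then show False
    using P(2) \<open>x \<in> X\<close> by blast
qed

section \<open>Limits of bounded nonsingular semigroups\<close>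

locale commutative_semigroup =
  fixes X :: "'a set" and mult :: "'a \<Rightarrow> 'a \<Rightarrow> 'a" (infixl "\<cdot>" 70)
  assumes closed [simp, intro]: "x \<in> X \<Longrightarrow> y \<in> X \<Longrightarrow> x \<cdot> y \<in> X"
    and assoc: "x \<in> X \<Longrightarrow> y \<in> X \<Longrightarrow> z \<in> X \<Longrightarrow> x \<cdot> y \<cdot> z = x \<cdot> (y \<cdot> z)"
    and comm: "x \<in> X \<Longrightarrow> y \<in> X \<Longrightarrow> x \<cdot> y = y \<cdot> x"
begin

lemma left_comm: "x \<in> X \<Longrightarrow> y \<in> X \<Longrightarrow> z \<in> X \<Longrightarrow> y \<cdot> (x \<cdot> z) = x \<cdot> (y \<cdot> z)"
  by (metis assoc comm)

lemmas ac = assoc comm left_comm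

text \<open>Truncated subtraction makes \<open>pow x 0 = x\<close>, hence the assumptions on positive exponents.\<close>

abbreviation pow :: "'a \<Rightarrow> nat \<Rightarrow> 'a" where
  "pow x n \<equiv> semigroup_power mult x n"

lemma pow_1 [simp]: "pow x (Suc 0) = x"
  by (simp add: semigroup_power_def)

lemma pow_Suc: "n > 0 \<Longrightarrow> pow x (Suc n) = x \<cdot> pow x n"
  by (cases n) (simp_all add: semigroup_power_def)

lemma pow_closed [simp, intro]: "x \<in> X \<Longrightarrow> pow x n \<in> X"
proof (induction n)
  case (Suc n)
  then show ?case by (cases "n = 0") (simp_all add: pow_Suc)
qed (simp add: semigroup_power_def)

lemma pow_add:
  assumes "x \<in> X" "b > 0"
  shows "a > 0 \<Longrightarrow> pow x (a + b) = pow x a \<cdot> pow x b"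
proof (induction a)
  case (Suc a)
  then show ?case using assms by (cases "a = 0") (simp_all add: pow_Suc assoc)
qed simp

lemma pow_mult:
  assumes "x \<in> X" "a > 0"
  shows "b > 0 \<Longrightarrow> pow x (a * b) = pow (pow x a) b"
proof (induction b)
  case (Suc b)
  then show ?case using assms by (cases "b = 0") (simp_all add: pow_Suc pow_add)
qed simp

lemma pow_mult_distrib:
  assumes "x \<in> X" "y \<in> X"
  shows "a > 0 \<Longrightarrow> pow (x \<cdot> y) a = pow x a \<cdot> pow y a"
proof (induction a)
  case (Suc a)
  then show ?case using assms by (cases "a = 0") (simp_all add: pow_Suc ac)
qed simp

lemma pow_idem:
  assumes "e \<cdot> e = e"
  shows "pow e n = e"
proof (induction n)
  case (Suc n)
  then show ?case using assms by (cases "n = 0") (simp_all add: pow_Suc)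
qed (simp add: semigroup_power_def)

text \<open>Finiteness of translates and membership of limits in \<open>X\<close> are both carried
  back from a square to its root, so only exponents that are powers of two occur.\<close>

definition sq :: "'a \<Rightarrow> 'a" where
  "sq x = x \<cdot> x"

lemma sq_iter_closed [simp, intro]: "x \<in> X \<Longrightarrow> (sq ^^ j) x \<in> X"
  by (induction j) (auto simp: sq_def)

lemma sq_iter_mult: "x \<in> X \<Longrightarrow> y \<in> X \<Longrightarrow> (sq ^^ j) (x \<cdot> y) = (sq ^^ j) x \<cdot> (sq ^^ j) y"
  by (induction j) (auto simp: sq_def ac)

lemma sq_iter_eq_pow: "x \<in> X \<Longrightarrow> (sq ^^ j) x = pow x (2 ^ j)"
  by (induction j) (auto simp: sq_def mult_2 pow_add)

text \<open>Dependent choice: a new index has to fit only the finitely many earlier ones, and each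
  of these conditions holds eventually. Commutativity supplies the products in the other
  order.\<close>

lemma singularI:
  assumes F: "F \<noteq> bot" and g: "eventually (\<lambda>i. g i \<in> X) F" "\<And>v. eventually (\<lambda>i. g i \<noteq> v) F"
    and diag: "eventually (\<lambda>i. g i \<cdot> g i = c) F"
    and off: "eventually (\<lambda>i. eventually (\<lambda>j. g i \<cdot> g j = c) F) F"
  shows "singular_semigroup X mult"
proof -
  define Q where "Q i \<longleftrightarrow> g i \<in> X \<and> g i \<cdot> g i = c \<and> eventually (\<lambda>j. g i \<cdot> g j = c) F" for i
  define R where "R i j \<longleftrightarrow> g j \<noteq> g i \<and> g i \<cdot> g j = c" for i j
  have Q: "eventually Q F"
    unfolding Q_def using g(1) diag off by eventually_elim simp
  have R: "eventually (R i) F" if "Q i" for i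
    unfolding R_def using that g(2)[of "g i"] by (auto simp: Q_def eventually_conj_iff)
  have "\<exists>s. \<forall>n::nat. Q (s n) \<and> (\<forall>k<n. R (s k) (s n))"
  proof (rule dependent_wellorder_choice)
    fix n :: nat and s assume IH: "\<And>k. k < n \<Longrightarrow> Q (s k) \<and> (\<forall>l<k. R (s l) (s k))"
    then have "eventually (\<lambda>i. \<forall>k\<in>{..<n}. R (s k) i) F"
      using R by (intro eventually_ball_finite) auto
    then have "eventually (\<lambda>i. Q i \<and> (\<forall>k\<in>{..<n}. R (s k) i)) F"
      using Q by eventually_elim simp
    then show "\<exists>i. Q i \<and> (\<forall>k<n. R (s k) i)"
      using eventually_happens'[OF F] by fastforce
  qed simp
  then obtain s where s: "\<And>n::nat. Q (s n)" "\<And>n k. k < n \<Longrightarrow> R (s k) (s n)"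
    by blast
  define A where "A = range (\<lambda>n. g (s n))"
  have ne: "g (s k) \<noteq> g (s n)" if "k \<noteq> n" for k n
    using that s(2)[of k n] s(2)[of n k] by (cases k n rule: linorder_cases) (auto simp: R_def)
  then have "inj (\<lambda>n. g (s n))"
    by (auto simp: inj_def)
  then have "infinite A"
    unfolding A_def by (rule range_inj_infinite)
  moreover have "A \<subseteq> X"
    using s(1) by (auto simp: A_def Q_def)
  moreover have "g (s k) \<cdot> g (s n) = c" for k n
  proof (cases k n rule: linorder_cases)
    case less
    then show ?thesis using s(2) by (auto simp: R_def)
  next
    case equal
    then show ?thesis using s(1) by (auto simp: Q_def)
  next
    case greater
    then have "g (s n) \<cdot> g (s k) = c"
      using s(2) by (auto simp: R_def)
    then show ?thesis
      using s(1) comm by (metis Q_def)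
  qed
  then have "{a \<cdot> b |a b. a \<in> A \<and> b \<in> A} = {c}"
    by (auto simp: A_def intro!: exI[of _ "g (s 0)"])
  ultimately show ?thesis
    unfolding singular_semigroup_def is_singleton_def by blast
qed

text \<open>Otherwise infinitely many \<open>b\<close> have distinct \<open>u \<cdot> b\<close> but
  the same \<open>u \<cdot> u \<cdot> b\<close>. Then
  \<open>(u \<cdot> b) \<cdot> (u \<cdot> b')\<close> equals
  \<open>u \<cdot> u \<cdot> b \<cdot> b'\<close>, in which first \<open>b\<close> and then
  \<open>b'\<close> can be replaced by a fixed \<open>b0\<close>, so the elements
  \<open>u \<cdot> b\<close> form a singular set.\<close>

lemma finite_translate_of_square:
  assumes ns: "nonsingular_semigroup X mult" and u: "u \<in> X"
    and fin: "finite ((\<cdot>) (u \<cdot> u) ` X)"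
  shows "finite ((\<cdot>) u ` X)"
proof (rule ccontr)
  assume "infinite ((\<cdot>) u ` X)"
  moreover obtain B where B: "B \<subseteq> X" "inj_on ((\<cdot>) u) B" "(\<cdot>) u ` X = (\<cdot>) u ` B"
    by (meson order_refl subset_image_inj)
  ultimately have "infinite B"
    using finite_imageI by auto
  moreover have "finite ((\<cdot>) (u \<cdot> u) ` B)"
    using fin B(1) by (meson finite_subset image_mono)
  ultimately obtain b0 where b0: "b0 \<in> B" "infinite {b \<in> B. u \<cdot> u \<cdot> b = u \<cdot> u \<cdot> b0}"
    using pigeonhole_infinite[of B "(\<cdot>) (u \<cdot> u)"] by blast
  define B' where "B' = {b \<in> B. u \<cdot> u \<cdot> b = u \<cdot> u \<cdot> b0}"
  define A where "A = (\<cdot>) u ` B'"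
  have B'X: "b \<in> X" if "b \<in> B'" for b
    using that B(1) by (auto simp: B'_def)
  have b0X: "b0 \<in> X" and b0B': "b0 \<in> B'"
    using b0 B(1) by (auto simp: B'_def)
  have "infinite A"
    using b0(2) B(2) unfolding A_def B'_def by (metis (no_types, lifting) finite_imageD inj_on_subset mem_Collect_eq subsetI)
  have const: "u \<cdot> b \<cdot> (u \<cdot> b') = u \<cdot> u \<cdot> b0 \<cdot> b0" if "b \<in> B'" "b' \<in> B'" for b b'
  proof -
    have "u \<cdot> b \<cdot> (u \<cdot> b') = u \<cdot> u \<cdot> b \<cdot> b'"
      using that B'X u by (simp add: ac)
    also have "\<dots> = u \<cdot> u \<cdot> b0 \<cdot> b'"
      using that by (simp add: B'_def)
    also have "\<dots> = u \<cdot> u \<cdot> b' \<cdot> b0"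
      using that B'X b0X u by (simp add: ac)
    also have "\<dots> = u \<cdot> u \<cdot> b0 \<cdot> b0"
      using that by (simp add: B'_def)
    finally show ?thesis .
  qed
  have "{a \<cdot> b |a b. a \<in> A \<and> b \<in> A} = {u \<cdot> u \<cdot> b0 \<cdot> b0}"
  proof
    show "{u \<cdot> u \<cdot> b0 \<cdot> b0} \<subseteq> {a \<cdot> b |a b. a \<in> A \<and> b \<in> A}"
      unfolding A_def using const[OF b0B' b0B', symmetric] b0B' by blast
  qed (use const in \<open>auto simp: A_def\<close>)
  moreover have "A \<subseteq> X"
    using B'X u by (auto simp: A_def)
  ultimately have "singular_semigroup X mult"
    using \<open>infinite A\<close> unfolding singular_semigroup_def is_singleton_def by blast
  then show False
    using ns by (simp add: nonsingular_semigroup_def)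
qed

lemma finite_translate_of_sq_iter:
  assumes "nonsingular_semigroup X mult" "u \<in> X"
  shows "finite ((\<cdot>) ((sq ^^ j) u) ` X) \<Longrightarrow> finite ((\<cdot>) u ` X)"
proof (induction j)
  case (Suc j)
  then show ?case
    using finite_translate_of_square[OF assms(1) sq_iter_closed[OF assms(2), of j]] by (simp add: sq_def[of "(sq ^^ j) u"])
qed simp

end

text \<open>The substitute for uniqueness of limits: in a T1 space an eventually constant family
  converges to nothing but its constant.\<close>

lemma limitin_t1_unique:
  assumes "limitin T f a F" "t1_space T" "F \<noteq> bot" "eventually (\<lambda>i. f i = v) F"
  shows "a = v"
proof (rule ccontr)
  assume "a \<noteq> v"
  then obtain U where "openin T U" "a \<in> U" "v \<notin> U"
    using assms(2) limitin_topspace[OF assms(1)] openin_topspace unfolding t1_space_def by metis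
  then have "eventually (\<lambda>i. f i \<in> U) F"
    using limitinD[OF assms(1)] by blast
  then have "eventually (\<lambda>i. False) F"
    using assms(4) by eventually_elim (use \<open>v \<notin> U\<close> in auto)
  then show False
    using assms(3) by (simp add: trivial_limit_def)
qed

lemma limitin_mult:
  assumes "continuous_map (prod_topology T T) T (\<lambda>(x, y). m x y)"
    and "limitin T f a F" "limitin T g b F"
  shows "limitin T (\<lambda>i. m (f i) (g i)) (m a b) F"
proof -
  have "limitin (prod_topology T T) (\<lambda>i. (f i, g i)) (a, b) F"
    using assms(2,3) by (simp add: limitin_pairwise o_def)
  from continuous_map_limit[OF assms(1) this] show ?thesis
    by (simp add: o_def)
qed

section \<open>Closedness in T1 topological semigroups\<close>

context commutative_semigroup
begin

text \<open>Here \<open>X\<close> lies inside the target and \<open>mult\<close> is the operation of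
  the target, which is known to be commutative only on \<open>X\<close>.\<close>

context
  fixes T :: "'a topology"
  assumes top: "topological_semigroup (T, mult)" and t1: "t1_space T" and XT: "X \<subseteq> topspace T"
    and ns: "nonsingular_semigroup X mult"
    and fin: "\<And>x. x \<in> X \<Longrightarrow> finite ((\<cdot>) x ` X)"
begin

lemma cont: "continuous_map (prod_topology T T) T (\<lambda>(x, y). x \<cdot> y)"
  using top by (simp add: topological_semigroup_def)

lemma limitin_sq_iter: "limitin T f a F \<Longrightarrow> limitin T (\<lambda>i. (sq ^^ j) (f i)) ((sq ^^ j) a) F"
  by (induction j) (auto simp: sq_def intro: limitin_mult[OF cont])

text \<open>Suppose \<open>y\<close> is not in \<open>X\<close>. If \<open>x \<cdot> y\<close> is
  not constant along \<open>F\<close>, these products form a singular set. If it is constant, the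
  constant is \<open>y \<cdot> y\<close>; then \<open>x \<cdot> x'\<close> is eventually
  \<open>y \<cdot> y\<close> as well, and a suitable iterated square of the points near
  \<open>y\<close> gives a singular set.\<close>

lemma limit_in_if_square_in:
  assumes F: "ultrafilter F" "eventually (\<lambda>z. z \<in> X) F" and lim: "limitin T (\<lambda>z. z) y F"
    and yy: "y \<cdot> y \<in> X" and V: "finite V" "\<And>x. x \<in> X \<Longrightarrow> (sq ^^ J) x \<in> V"
  shows "y \<in> X"
proof (rule ccontr)
  assume yX: "y \<notin> X"
  have nb: "F \<noteq> bot" and ultra: "eventually P F \<or> eventually (\<lambda>x. \<not> P x) F" for P
    using F(1) by (auto simp: ultrafilter_def)
  have yT: "y \<in> topspace T"
    using lim by (rule limitin_topspace)
  have lim_const: "limitin T (\<lambda>_. x) x F" if "x \<in> X" for x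
    using that XT by auto
  have free: "eventually (\<lambda>z. z \<noteq> v) F" for v
  proof (rule ccontr)
    assume "\<not> ?thesis"
    then have v: "eventually (\<lambda>z. z = v) F"
      using ultra[of "\<lambda>z. z = v"] by auto
    then have "y = v"
      by (rule limitin_t1_unique[OF lim t1 nb])
    moreover have "v \<in> X"
      using eventually_happens'[OF nb eventually_conj[OF v F(2)]] by auto
    ultimately show False
      using yX by simp
  qed
  \<comment> \<open>The finite translate of \<open>X\<close> by \<open>x\<close> makes
    \<open>x \<cdot> z\<close> eventually constant, and the constant must be
    \<open>x \<cdot> y\<close>. The same value is the limit of \<open>z \<cdot> x\<close>, so
    \<open>y\<close> commutes with \<open>X\<close>.\<close>
  have mult_y: "eventually (\<lambda>z. x \<cdot> z = x \<cdot> y) F \<and> x \<cdot> y \<in> X \<and> y \<cdot> x = x \<cdot> y" if x: "x \<in> X" for x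
  proof -
    have "eventually (\<lambda>z. x \<cdot> z \<in> (\<cdot>) x ` X) F"
      using F(2) by eventually_elim simp
    then obtain v where v: "v \<in> (\<cdot>) x ` X" "eventually (\<lambda>z. x \<cdot> z = v) F"
      using ultrafilter_finite_range[OF F(1) fin[OF x]] by blast
    have "x \<cdot> y = v"
      using limitin_t1_unique[OF limitin_mult[OF cont lim_const[OF x] lim] t1 nb v(2)] .
    moreover have "eventually (\<lambda>z. z \<cdot> x = v) F"
      using v(2) F(2) by eventually_elim (use x comm in auto)
    then have "y \<cdot> x = v"
      by (rule limitin_t1_unique[OF limitin_mult[OF cont lim lim_const[OF x]] t1 nb])
    ultimately show ?thesis
      using v x by auto
  qed
  have my: "x \<cdot> y \<in> X" "y \<cdot> x = x \<cdot> y" if "x \<in> X" for x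
    using mult_y[OF that] by auto
  \<comment> \<open>Supplies associativity for products that contain \<open>y\<close>.\<close>
  interpret Y: commutative_semigroup "insert y X" mult
  proof
    show "a \<cdot> b \<in> insert y X" if "a \<in> insert y X" "b \<in> insert y X" for a b
      using that yy my by (cases "a = y"; cases "b = y") simp_all
    have "insert y X \<subseteq> topspace T" "semigroup_on (topspace T) mult"
      using XT yT top by (auto simp: topological_semigroup_def)
    then show "a \<cdot> b \<cdot> c = a \<cdot> (b \<cdot> c)" if "a \<in> insert y X" "b \<in> insert y X" "c \<in> insert y X" for a b c
      using that unfolding semigroup_on_def by blast
    show "a \<cdot> b = b \<cdot> a" if "a \<in> insert y X" "b \<in> insert y X" for a b
      using that my comm by (cases "a = y"; cases "b = y") simp_all
  qed
  define c where "c = y \<cdot> y"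
  have "singular_semigroup X mult"
  proof (cases "\<forall>v. eventually (\<lambda>x. x \<cdot> y \<noteq> v) F")
    case True
    have cX: "c \<in> X" "c \<cdot> y \<in> X"
      using yy mult_y by (auto simp: c_def)
    have prod: "x \<cdot> y \<cdot> (x' \<cdot> y) = x \<cdot> (c \<cdot> x')" if "x \<in> X" "x' \<in> X" for x x'
    proof -
      have Y: "x \<in> insert y X" "y \<in> insert y X" "x' \<in> insert y X" "x' \<cdot> y \<in> insert y X"
        using that my by auto
      have "x \<cdot> y \<cdot> (x' \<cdot> y) = x \<cdot> (y \<cdot> (y \<cdot> x'))"
        using Y.assoc[OF Y(1,2,4)] my(2)[OF that(2)] by simp
      then show ?thesis
        using Y.assoc[OF Y(2,2,3)] by (simp add: c_def)
    qed
    \<comment> \<open>Two successive limits in \<open>x \<cdot> (c \<cdot> x')\<close>: for fixed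
      \<open>x\<close> the inner factor becomes \<open>c \<cdot> y\<close>, which is in
      \<open>X\<close>, and then \<open>x \<cdot> (c \<cdot> y)\<close> becomes
      \<open>c \<cdot> y \<cdot> y\<close>.\<close>
    have ev: "eventually (\<lambda>x. x \<cdot> (c \<cdot> y) = c \<cdot> y \<cdot> y) F"
      using conjunct1[OF mult_y[OF cX(2)]] F(2) by eventually_elim (use comm cX in auto)
    show ?thesis
    proof (rule singularI[OF nb, where g = "\<lambda>x. x \<cdot> y" and c = "c \<cdot> y \<cdot> y"])
      show "eventually (\<lambda>x. x \<cdot> y \<in> X) F"
        using F(2) by eventually_elim (use mult_y in auto)
      show "eventually (\<lambda>x. x \<cdot> y \<cdot> (x \<cdot> y) = c \<cdot> y \<cdot> y) F"
        using ev F(2) conjunct1[OF mult_y[OF cX(1)]] by eventually_elim (simp add: prod)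
      show "eventually (\<lambda>x. eventually (\<lambda>x'. x \<cdot> y \<cdot> (x' \<cdot> y) = c \<cdot> y \<cdot> y) F) F"
        using ev F(2)
      proof eventually_elim
        case (elim x)
        show ?case
          using F(2) conjunct1[OF mult_y[OF cX(1)]] by eventually_elim (use elim in \<open>simp add: prod\<close>)
      qed
    qed (use True in auto)
  next
    case False
    then obtain v where v: "eventually (\<lambda>x. x \<cdot> y = v) F"
      using ultra by blast
    have "limitin T (\<lambda>x. x \<cdot> y) c F"
      unfolding c_def using lim yT by (intro limitin_mult[OF cont]) auto
    then have "c = v"
      using limitin_t1_unique[OF _ t1 nb v] by blast
    with v have xy: "eventually (\<lambda>x. x \<cdot> y = c) F"
      by simp
    \<comment> \<open>Some level \<open>j\<close> is nonconstant while the next one is constant: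
      level 0 is nonconstant because \<open>F\<close> is free, level \<open>J\<close> is constant
      because \<open>V\<close> is finite. At such a \<open>j\<close> the squares of the
      \<open>(sq ^^ j) x\<close> agree, and so do their mixed products, since
      \<open>x \<cdot> x'\<close> is eventually \<open>c\<close>.\<close>
    define P where "P j \<longleftrightarrow> (\<forall>v. eventually (\<lambda>x. (sq ^^ j) x \<noteq> v) F)" for j
    have "P 0"
      using free by (simp add: P_def)
    moreover have "\<not> P J"
    proof -
      have "eventually (\<lambda>x. (sq ^^ J) x \<in> V) F"
        using F(2) by eventually_elim (use V in auto)
      then obtain v where v: "eventually (\<lambda>x. (sq ^^ J) x = v) F"
        using ultrafilter_finite_range[OF F(1) V(1)] by blast
      show ?thesis
      proof
        assume "P J"
        then show False
          using eventually_happens'[OF nb eventually_conj[OF v]] by (auto simp: P_def)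
      qed
    qed
    ultimately obtain j where j: "P j" "\<not> P (Suc j)"
      by (metis nat_induct)
    then obtain w where w: "eventually (\<lambda>x. (sq ^^ Suc j) x = w) F"
      using ultra[of "\<lambda>x. (sq ^^ Suc j) x = w" for w] unfolding P_def by metis
    then have "(sq ^^ Suc j) y = w"
      using limitin_t1_unique[OF limitin_sq_iter[OF lim] t1 nb] by blast
    then have w_eq: "w = (sq ^^ j) c"
      by (simp add: c_def sq_def funpow_swap1)
    show ?thesis
    proof (rule singularI[OF nb, where g = "sq ^^ j" and c = w])
      show "eventually (\<lambda>x. (sq ^^ j) x \<in> X) F"
        using F(2) by eventually_elim simp
      show "eventually (\<lambda>x. (sq ^^ j) x \<cdot> (sq ^^ j) x = w) F"
        using w by (simp add: sq_def)
      show "eventually (\<lambda>x. eventually (\<lambda>x'. (sq ^^ j) x \<cdot> (sq ^^ j) x' = w) F) F"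
        using F(2) xy
      proof eventually_elim
        case (elim x)
        show ?case
          using F(2) conjunct1[OF mult_y[OF elim(1)]]
          by eventually_elim (use elim in \<open>simp add: sq_iter_mult[symmetric] w_eq\<close>)
      qed
    qed (use j(1) in \<open>auto simp: P_def\<close>)
  qed
  then show False
    using ns by (simp add: nonsingular_semigroup_def)
qed

text \<open>The induction passes from \<open>y\<close> to its square and from \<open>F\<close> to
  its image under squaring, hence the generalization over \<open>F\<close>.\<close>

lemma limit_in_if_sq_iter_in:
  assumes V: "finite V" "\<And>x. x \<in> X \<Longrightarrow> (sq ^^ J) x \<in> V"
  shows "ultrafilter F \<Longrightarrow> eventually (\<lambda>z. z \<in> X) F \<Longrightarrow> limitin T (\<lambda>z. z) y F
    \<Longrightarrow> (sq ^^ j) y \<in> X \<Longrightarrow> y \<in> X"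
proof (induction j arbitrary: F y)
  case (Suc j)
  have "sq y \<in> X"
  proof (rule Suc.IH)
    show "ultrafilter (filtermap sq F)"
      using Suc.prems(1) by (rule ultrafilter_filtermap)
    show "eventually (\<lambda>z. z \<in> X) (filtermap sq F)"
      unfolding eventually_filtermap using Suc.prems(2) by eventually_elim (simp add: sq_def)
    show "limitin T (\<lambda>z. z) (sq y) (filtermap sq F)"
      using limitin_sq_iter[OF Suc.prems(3), of 1] by (simp add: limitin_def eventually_filtermap)
    show "(sq ^^ j) (sq y) \<in> X"
      using Suc.prems(4) by (simp add: funpow_swap1)
  qed
  then show ?case
    using limit_in_if_square_in[OF Suc.prems(1-3) _ V] by (simp add: sq_def)
qed simp

lemma closedin_T1:
  assumes V: "finite V" "V \<subseteq> X" "\<And>x. x \<in> X \<Longrightarrow> (sq ^^ J) x \<in> V"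
  shows "closedin T X"
proof -
  have "y \<in> X" if "y \<in> T closure_of X" for y
  proof -
    have "inf (nhdsin T y) (principal X) \<noteq> bot"
      using that by (auto simp: in_closure_of trivial_limit_def eventually_inf_principal eventually_nhdsin)
    then obtain F where F: "F \<le> inf (nhdsin T y) (principal X)" "ultrafilter F"
      by (rule ex_ultrafilter_le)
    have ev: "eventually (\<lambda>z. z \<in> X) F"
      using F(1) by (rule filter_leD) (simp add: eventually_inf_principal)
    have yT: "y \<in> topspace T"
      using that by (simp add: in_closure_of)
    have lim: "limitin T (\<lambda>z. z) y F"
      unfolding limitin_def
    proof (intro conjI yT allI impI)
      fix U assume "openin T U \<and> y \<in> U"
      then have "eventually (\<lambda>z. z \<in> U) (inf (nhdsin T y) (principal X))"
        by (auto simp: eventually_inf_principal eventually_nhdsin)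
      then show "eventually (\<lambda>z. z \<in> U) F"
        using F(1) by (rule filter_leD[rotated])
    qed
    have "eventually (\<lambda>z. (sq ^^ J) z \<in> V) F"
      using ev by eventually_elim (use V in auto)
    then obtain v where v: "v \<in> V" "eventually (\<lambda>z. (sq ^^ J) z = v) F"
      using ultrafilter_finite_range[OF F(2) V(1)] by blast
    have "(sq ^^ J) y = v"
      using limitin_t1_unique[OF limitin_sq_iter[OF lim] t1 _ v(2)] F(2) by (simp add: ultrafilter_def)
    then show ?thesis
      using limit_in_if_sq_iter_in[OF V(1,3) F(2) ev lim] v(1) V(2) by blast
  qed
  then show ?thesis
    using XT by (metis closure_of_subset closure_of_eq subsetI subset_antisym)
qed

end

end

section \<open>Periodic nonsingular semigroups\<close>

locale unipotent_semigroup = commutative_semigroup +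
  fixes e
  assumes e_closed [simp, intro]: "e \<in> X" and e_idem [simp]: "e \<cdot> e = e"
    and e_unique: "x \<in> X \<Longrightarrow> x \<cdot> x = x \<Longrightarrow> x = e"
begin

definition periodic :: bool where
  "periodic \<longleftrightarrow> (\<forall>x\<in>X. \<exists>n>0. pow x n = e)"

definition H :: "'a set" where
  "H = (\<cdot>) e ` X"

lemma H_iff: "h \<in> H \<longleftrightarrow> h \<in> X \<and> e \<cdot> h = h"
proof
  assume "h \<in> H"
  then show "h \<in> X \<and> e \<cdot> h = h"
    by (auto simp: H_def assoc[symmetric])
qed (metis H_def imageI)

lemma H_subset: "H \<subseteq> X"
  by (auto simp: H_iff)

lemma e_in_H [simp]: "e \<in> H"
  by (simp add: H_iff)

lemma e_mult_in_H: "x \<in> X \<Longrightarrow> e \<cdot> x \<in> H"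
  by (simp add: H_def)

lemma H_ideal: "x \<in> X \<Longrightarrow> h \<in> H \<Longrightarrow> x \<cdot> h \<in> H"
  using left_comm[of x e h] by (simp add: H_iff)

lemma H_ideal': "x \<in> X \<Longrightarrow> h \<in> H \<Longrightarrow> h \<cdot> x \<in> H"
  using H_ideal H_subset comm by (metis subsetD)

lemma pow_e [simp]: "pow e n = e"
  by (simp add: pow_idem)

lemma pow_in_H_mono:
  assumes "x \<in> X" "pow x a \<in> H" "0 < a" "a \<le> b"
  shows "pow x b \<in> H"
proof (cases "a = b")
  case False
  then have "pow x b = pow x (b - a) \<cdot> pow x a"
    using assms pow_add[of x a "b - a"] by simp
  then show ?thesis
    using assms H_ideal by simp
qed (use assms in simp)

lemma sq_iter_in_H:
  assumes "x \<in> X" "pow x n = e" "0 < n"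
  shows "(sq ^^ n) x \<in> H"
  using pow_in_H_mono[of x n "2 ^ n"] assms by (simp add: sq_iter_eq_pow less_imp_le)

text \<open>An iterated square of \<open>x\<close> lies in the ideal \<open>H\<close>, so its
  translate of \<open>X\<close> is contained in a finite set; finiteness then descends through the
  squarings.\<close>

lemma finite_translates:
  assumes "nonsingular_semigroup X mult" "finite H" "x \<in> X" "pow x n = e" "0 < n"
  shows "finite ((\<cdot>) x ` X)"
proof (rule finite_translate_of_sq_iter[OF assms(1,3)])
  show "finite ((\<cdot>) ((sq ^^ n) x) ` X)"
    by (rule finite_subset[OF _ assms(2)]) (use sq_iter_in_H[OF assms(3-5)] H_ideal' in auto)
qed

text \<open>Products need only fall into \<open>H\<close>: a product \<open>x \<cdot> y\<close> in
  \<open>H\<close> equals \<open>(e \<cdot> x) \<cdot> (e \<cdot> y)\<close>, and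
  \<open>e \<cdot> g i\<close> is eventually constant because \<open>H\<close> is finite.\<close>

lemma singularI_H:
  assumes F: "ultrafilter F" and H: "finite H"
    and g: "eventually (\<lambda>i. g i \<in> X) F" "\<And>v. eventually (\<lambda>i. g i \<noteq> v) F"
    and diag: "eventually (\<lambda>i. g i \<cdot> g i \<in> H) F"
    and off: "eventually (\<lambda>i. eventually (\<lambda>j. g i \<cdot> g j \<in> H) F) F"
  shows "singular_semigroup X mult"
proof -
  have "eventually (\<lambda>i. e \<cdot> g i \<in> H) F"
    using g(1) by eventually_elim (rule e_mult_in_H)
  then obtain \<gamma> where \<gamma>: "eventually (\<lambda>i. e \<cdot> g i = \<gamma>) F"
    using ultrafilter_finite_range[OF F H, of "\<lambda>i. e \<cdot> g i"] by blast
  have eq: "x \<cdot> y = (e \<cdot> x) \<cdot> (e \<cdot> y)" if "x \<in> X" "y \<in> X" "x \<cdot> y \<in> H" for x y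
  proof -
    have "(e \<cdot> x) \<cdot> (e \<cdot> y) = e \<cdot> (e \<cdot> (x \<cdot> y))"
      using that(1,2) by (simp add: ac)
    then show ?thesis
      using that(3) by (simp add: H_iff)
  qed
  show ?thesis
  proof (rule singularI[where F = F and g = g and c = "\<gamma> \<cdot> \<gamma>", OF _ g])
    show "eventually (\<lambda>i. g i \<cdot> g i = \<gamma> \<cdot> \<gamma>) F"
      using g(1) \<gamma> diag by eventually_elim (metis eq)
    show "eventually (\<lambda>i. eventually (\<lambda>j. g i \<cdot> g j = \<gamma> \<cdot> \<gamma>) F) F"
      using g(1) \<gamma> off
    proof eventually_elim
      case (elim i)
      show ?case
        using g(1) \<gamma> elim(3) by eventually_elim (metis eq elim(1,2))
    qed
  qed (use F in \<open>simp add: ultrafilter_def\<close>)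
qed

text \<open>The number \<open>t\<close> does not depend on \<open>x\<close>: it exceeds the number
  of values of \<open>c \<cdot> pow x i\<close>, so two of the first \<open>t\<close> exponents
  collide. Iterating the collision multiplies \<open>c \<cdot> pow x i\<close> by a power of
  \<open>x\<close> that equals \<open>e\<close>.\<close>

lemma periodic_translate_power:
  assumes per: "periodic" and c: "c \<in> X" and fin: "finite ((\<cdot>) c ` X)"
  obtains t where "t > 0" "\<And>x. x \<in> X \<Longrightarrow> c \<cdot> pow x t \<in> H"
proof
  define t where "t = Suc (card ((\<cdot>) c ` X))"
  show "t > 0" by (simp add: t_def)
  fix x assume x: "x \<in> X"
  let ?f = "\<lambda>i. c \<cdot> pow x i"
  have "?f ` {1..t} \<subseteq> (\<cdot>) c ` X"
    using x by auto
  then have "\<not> inj_on ?f {1..t}"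
    using card_inj_on_le[OF _ _ fin] by (fastforce simp: t_def)
  then obtain i j where ij: "i \<in> {1..t}" "j \<in> {1..t}" "i < j" "?f i = ?f j"
    unfolding inj_on_def by (metis linorder_neqE_nat)
  define k where "k = j - i"
  have k: "k > 0" "c \<cdot> pow x i = c \<cdot> pow x i \<cdot> pow x k"
  proof -
    show k: "k > 0"
      using ij by (simp add: k_def)
    have "c \<cdot> pow x i = c \<cdot> pow x (i + k)"
      using ij by (simp add: k_def)
    also have "\<dots> = c \<cdot> pow x i \<cdot> pow x k"
      using ij(1) k x c by (simp add: pow_add assoc)
    finally show "c \<cdot> pow x i = c \<cdot> pow x i \<cdot> pow x k" .
  qed
  have iter: "c \<cdot> pow x i = c \<cdot> pow x i \<cdot> pow x (k * Suc r)" for r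
  proof (induction r)
    case (Suc r)
    have "pow x (k * Suc (Suc r)) = pow x k \<cdot> pow x (k * Suc r)"
      using pow_add[of x "k * Suc r" k] x k(1) by (simp add: algebra_simps)
    then have "c \<cdot> pow x i \<cdot> pow x (k * Suc (Suc r)) = (c \<cdot> pow x i \<cdot> pow x k) \<cdot> pow x (k * Suc r)"
      using x c by (simp add: assoc)
    then show ?case
      using k(2) Suc.IH by simp
  qed (use k in simp)
  obtain n where n: "n > 0" "pow x n = e"
    using per x by (auto simp: periodic_def)
  have "pow x (k * n) = e"
    using pow_mult[of x n k] x n k(1) by (simp add: mult.commute)
  then have "c \<cdot> pow x i = c \<cdot> pow x i \<cdot> e"
    using iter[of "n - 1"] n(1) by simp
  then have "c \<cdot> pow x i \<in> H"
    using H_ideal[of "c \<cdot> pow x i" e] x c by simp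
  moreover have "c \<cdot> pow x t = c \<cdot> pow x i \<cdot> pow x (t - i)" if "i \<noteq> t"
    using pow_add[of x "t - i" i] ij(1-3) that x c by (simp add: assoc)
  ultimately show "c \<cdot> pow x t \<in> H"
    using H_ideal' x by (cases "i = t") auto
qed

lemma uniform_period:
  assumes per: "periodic"
  shows "finite S \<Longrightarrow> S \<subseteq> X \<Longrightarrow> \<exists>M>0. \<forall>h\<in>S. pow h M = e"
proof (induction S rule: finite_induct)
  case (insert s S)
  then obtain M n where "M > 0" "\<forall>h\<in>S. pow h M = e" "n > 0" "pow s n = e"
    using per by (auto simp: periodic_def)
  moreover from this have "pow s (M * n) = e"
    using pow_mult[of s n M] insert.prems by (simp add: mult.commute)
  moreover have "pow h (M * n) = e" if "h \<in> S" for h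
    using calculation pow_mult[of h M n] that insert.prems by auto
  ultimately show ?case
    by (intro exI[of _ "M * n"]) auto
qed auto

text \<open>Long chains of powers outside \<open>H\<close> are turned into a singular set. The
  candidates are the limits \<open>c n\<close> of \<open>a n \<cdot> a j\<close> in
  \<open>j\<close>; if these are constant along the ultrafilter, they are the elements
  \<open>a n\<close> themselves, multiplied by a fixed power of \<open>x n\<close>.\<close>

lemma bounded_if_periodic:
  assumes ns: "nonsingular_semigroup X mult" and per: "periodic" and H: "finite H"
  shows "bounded_semigroup X mult"
proof (rule ccontr)
  assume unb: "\<not> bounded_semigroup X mult"
  have fin: "finite ((\<cdot>) x ` X)" if "x \<in> X" for x
    using finite_translates[OF ns H that] per that by (auto simp: periodic_def)
  have notH: "\<exists>x\<in>X. pow x N \<notin> H" if N: "N > 0" for N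
  proof (rule ccontr)
    assume "\<not> ?thesis"
    then have NH: "pow x N \<in> H" if "x \<in> X" for x
      using that by blast
    obtain M where M: "M > 0" "\<forall>h\<in>H. pow h M = e"
      using uniform_period[OF per H H_subset] by blast
    have "pow x (N * M) = e" if "x \<in> X" for x
      using pow_mult[of x N M] that N M NH by simp
    then have "bounded_semigroup X mult"
      unfolding bounded_semigroup_def using N M(1)
      by (intro exI[of _ "N * M"]) (auto simp: idempotent_def)
    then show False
      using unb by simp
  qed
  \<comment> \<open>Powers from the middle of a long chain outside \<open>H\<close>: their squares are in \<open>H\<close>, and multiplying
    by a bounded power does not lead into \<open>H\<close>.\<close>
  have "\<exists>x i. x \<in> X \<and> i > 0 \<and> pow x (2 * i) \<in> H \<and> pow x (i + n) \<notin> H" for n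
  proof -
    obtain x where x: "x \<in> X" "pow x (2 * n + 2) \<notin> H"
      using notH[of "2 * n + 2"] by auto
    define d where "d = (LEAST d. d > 0 \<and> pow x d \<in> H)"
    have "\<exists>d. d > 0 \<and> pow x d \<in> H"
      using per x(1) by (metis e_in_H periodic_def)
    then have d: "d > 0" "pow x d \<in> H"
      unfolding d_def by (metis (mono_tags, lifting) LeastI_ex)+
    have d_min: "pow x k \<notin> H" if "0 < k" "k < d" for k
      using not_less_Least[of k "\<lambda>d. d > 0 \<and> pow x d \<in> H"] that by (simp add: d_def)
    \<comment> \<open>The exponent will be half of \<open>d\<close>, rounded up: doubling it reaches
      \<open>d\<close>, while adding \<open>n\<close> to it stays below \<open>d\<close> because
      \<open>d\<close> exceeds \<open>2 * n + 2\<close>.\<close>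
    have "2 * n + 2 < d"
      using pow_in_H_mono[OF x(1) d(2,1), of "2 * n + 2"] x(2) by linarith
    then have "pow x (2 * ((d + 1) div 2)) \<in> H" "pow x ((d + 1) div 2 + n) \<notin> H" "(d + 1) div 2 > 0"
      using pow_in_H_mono[OF x(1) d(2,1), of "2 * ((d + 1) div 2)"] d_min[of "(d + 1) div 2 + n"] by auto
    then show ?thesis
      using x(1) by blast
  qed
  then obtain x i where x: "\<And>n. x n \<in> X" and i: "\<And>n. i n > 0"
    and xi: "\<And>n. pow (x n) (2 * i n) \<in> H" "\<And>n. pow (x n) (i n + n) \<notin> H"
    by metis
  obtain F :: "nat filter" where F: "ultrafilter F" and free: "\<And>v. eventually (\<lambda>n. n \<noteq> v) F"
    using free_filter_on_infinite[of "UNIV :: nat set"] by auto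
  have nb: "F \<noteq> bot" and ultra: "eventually P F \<or> eventually (\<lambda>x. \<not> P x) F" for P
    using F by (auto simp: ultrafilter_def)
  have large: "eventually (\<lambda>n. s < n) F" for s
  proof -
    have "eventually (\<lambda>n. \<forall>k\<in>{..s}. n \<noteq> k) F"
      using free by (intro eventually_ball_finite) auto
    then show ?thesis
      by eventually_elim (use leI in auto)
  qed
  define a where "a n = pow (x n) (i n)" for n
  have aX: "a n \<in> X" for n
    using x by (simp add: a_def)
  have aa: "a n \<cdot> a n \<in> H" for n
    using xi(1)[of n] pow_add[OF x i i, of n n] by (simp add: a_def mult_2)
  have lim: "\<exists>c. eventually (\<lambda>j. a n \<cdot> a j = c) F" for n
    using ultrafilter_finite_range[OF F fin[OF aX[of n]], of "\<lambda>j. a n \<cdot> a j"] aX by auto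
  then obtain c where c: "\<And>n. eventually (\<lambda>j. a n \<cdot> a j = c n) F"
    by metis
  have cX: "c n \<in> X" for n
    using eventually_happens'[OF nb c[of n]] aX by (metis closed)
  have "singular_semigroup X mult"
  proof (cases "\<forall>v. eventually (\<lambda>n. c n \<noteq> v) F")
    case True
    \<comment> \<open>A common late index \<open>k\<close> gives
      \<open>a n \<cdot> a m \<cdot> (a k \<cdot> a k)\<close>, whose last factor lies in the ideal
      \<open>H\<close>.\<close>
    have "c n \<cdot> c m \<in> H" for n m
    proof -
      obtain k where "a n \<cdot> a k = c n" "a m \<cdot> a k = c m"
        using eventually_happens'[OF nb eventually_conj[OF c[of n] c[of m]]] by blast
      then have "c n \<cdot> c m = a n \<cdot> a m \<cdot> (a k \<cdot> a k)"
        using aX by (metis (no_types, lifting) assoc closed comm)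
      then show ?thesis
        using H_ideal aX aa by simp
    qed
    then show ?thesis
      using True cX by (intro singularI_H[OF F H, of c]) auto
  next
    case False
    then obtain d where d: "eventually (\<lambda>n. c n = d) F"
      using ultra by blast
    then have dX: "d \<in> X"
      using eventually_happens'[OF nb] cX by blast
    obtain t where t: "t > 0" "\<And>x. x \<in> X \<Longrightarrow> d \<cdot> pow x t \<in> H"
      using periodic_translate_power[OF per dX fin[OF dX]] by blast
    \<comment> \<open>The exponent \<open>t\<close> moves every \<open>d \<cdot> pow x t\<close>
      into \<open>H\<close>, so the mixed products of the \<open>g n\<close> land in
      \<open>H\<close>. Being fixed, it cannot move the late \<open>a n\<close> themselves there: a
      constant value \<open>v\<close> of \<open>g\<close> would give an exponent \<open>s\<close>
      with \<open>v \<cdot> pow (x n) s\<close> in \<open>H\<close>, against the choice of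
      \<open>x n\<close> as soon as \<open>n\<close> exceeds \<open>t + s\<close>.\<close>
    define g where "g n = a n \<cdot> pow (x n) t" for n
    have gX: "g n \<in> X" for n
      using aX x by (simp add: g_def)
    have g_eq: "g n \<cdot> g m = (a n \<cdot> a m) \<cdot> (pow (x n) t \<cdot> pow (x m) t)" for n m
      using aX x by (simp add: g_def ac)
    show ?thesis
    proof (rule singularI_H[OF F H, of g])
      show "eventually (\<lambda>n. g n \<noteq> v) F" for v
      proof (rule ccontr)
        assume "\<not> ?thesis"
        then have v: "eventually (\<lambda>n. g n = v) F"
          using ultra by blast
        then have vX: "v \<in> X"
          using eventually_happens'[OF nb] gX by blast
        obtain s where s: "s > 0" "\<And>x. x \<in> X \<Longrightarrow> v \<cdot> pow x s \<in> H"
          using periodic_translate_power[OF per vX fin[OF vX]] by blast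
        obtain n where n: "g n = v" "t + s < n"
          using eventually_happens'[OF nb eventually_conj[OF v large]] by blast
        have "g n \<cdot> pow (x n) s = pow (x n) (i n + (t + s))"
          using x i t(1) s(1) by (simp add: g_def a_def pow_add assoc)
        then have "pow (x n) (i n + (t + s)) \<in> H"
          using n s(2) x by metis
        then show False
          using pow_in_H_mono[OF x, of n "i n + (t + s)" "i n + n"] xi(2)[of n] n(2) i[of n] by auto
      qed
      show "eventually (\<lambda>n. g n \<cdot> g n \<in> H) F"
        using g_eq aa H_ideal' x by simp
      show "eventually (\<lambda>n. eventually (\<lambda>m. g n \<cdot> g m \<in> H) F) F"
        using d
      proof eventually_elim
        case (elim n)
        show ?case
          using c[of n]
        proof eventually_elim
          case (elim m)
          then have "g n \<cdot> g m = (d \<cdot> pow (x n) t) \<cdot> pow (x m) t"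
            using g_eq[of n m] \<open>c n = d\<close> dX x by (simp add: assoc)
          then show ?case
            using t(2) x H_ideal' by simp
        qed
      qed
    qed (use gX in simp)
  qed
  then show False
    using ns by (simp add: nonsingular_semigroup_def)
qed

end

section \<open>Non-closed extensions of singular and of non-periodic semigroups\<close>

lemma inf_filter_botI:
  assumes "eventually P F" "eventually Q G" "\<And>x. P x \<Longrightarrow> Q x \<Longrightarrow> False"
  shows "inf F G = bot"
  unfolding trivial_limit_def eventually_inf using assms by blast

lemma ultrafilter_inf_bot:
  assumes "ultrafilter F" "ultrafilter G" "F \<noteq> G"
  shows "inf F G = bot"
proof -
  obtain P where "eventually P F \<noteq> eventually P G"
    using assms(3) by (auto simp: filter_eq_iff)
  then have "(eventually P F \<and> eventually (\<lambda>x. \<not> P x) G) \<or> (eventually (\<lambda>x. \<not> P x) F \<and> eventually P G)"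
    using assms(1,2) by (auto simp: ultrafilter_def)
  then show ?thesis
    unfolding trivial_limit_def eventually_inf by blast
qed

lemma filterlim_prod_iff:
  "filterlim (\<lambda>(x, y). m x y) K (F \<times>\<^sub>F G) \<longleftrightarrow> (\<forall>P. eventually P K \<longrightarrow>
     (\<exists>R S. eventually R F \<and> eventually S G \<and> (\<forall>x y. R x \<longrightarrow> S y \<longrightarrow> P (m x y))))"
  by (simp add: filterlim_iff eventually_prod_filter)

lemma filterlim_prod_filtermap_iff:
  "filterlim (\<lambda>(x, y). m x y) K (filtermap f F \<times>\<^sub>F filtermap g G) \<longleftrightarrow>
   filterlim (\<lambda>(i, j). m (f i) (g j)) K (F \<times>\<^sub>F G)"
  unfolding filterlim_prod_iff eventually_filtermap
proof (intro iff_allI imp_cong refl iffI)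
  fix P assume "\<exists>R S. eventually (\<lambda>i. R (f i)) F \<and> eventually (\<lambda>j. S (g j)) G \<and> (\<forall>x y. R x \<longrightarrow> S y \<longrightarrow> P (m x y))"
  then obtain R S where "eventually (\<lambda>i. R (f i)) F" "eventually (\<lambda>j. S (g j)) G" "\<And>x y. R x \<Longrightarrow> S y \<Longrightarrow> P (m x y)"
    by blast
  then show "\<exists>R S. eventually R F \<and> eventually S G \<and> (\<forall>i j. R i \<longrightarrow> S j \<longrightarrow> P (m (f i) (g j)))"
    by (intro exI[of _ "\<lambda>i. R (f i)"] exI[of _ "\<lambda>j. S (g j)"]) auto
next
  fix P assume "\<exists>R S. eventually R F \<and> eventually S G \<and> (\<forall>i j. R i \<longrightarrow> S j \<longrightarrow> P (m (f i) (g j)))"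
  then obtain R S where "eventually R F" "eventually S G" "\<And>i j. R i \<Longrightarrow> S j \<Longrightarrow> P (m (f i) (g j))"
    by blast
  then show "\<exists>R S. eventually (\<lambda>i. R (f i)) F \<and> eventually (\<lambda>j. S (g j)) G \<and> (\<forall>x y. R x \<longrightarrow> S y \<longrightarrow> P (m x y))"
    by (intro exI[of _ "\<lambda>x. \<exists>i. R i \<and> x = f i"] exI[of _ "\<lambda>y. \<exists>j. S j \<and> y = g j"])
      (auto elim!: eventually_mono)
qed

lemma filterlim_prod_principal1:
  "filterlim (\<lambda>(x, y). m x y) K (principal {a} \<times>\<^sub>F G) \<longleftrightarrow> filterlim (m a) K G"
proof -
  have "(\<exists>R S. R a \<and> eventually S G \<and> (\<forall>x y. R x \<longrightarrow> S y \<longrightarrow> P (m x y))) \<longleftrightarrow> eventually (\<lambda>y. P (m a y)) G" for P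
  proof
    assume "eventually (\<lambda>y. P (m a y)) G"
    then show "\<exists>R S. R a \<and> eventually S G \<and> (\<forall>x y. R x \<longrightarrow> S y \<longrightarrow> P (m x y))"
      by (intro exI[of _ "\<lambda>x. x = a"] exI[of _ "\<lambda>y. P (m a y)"]) simp
  qed (blast intro: eventually_mono)
  then show ?thesis
    unfolding filterlim_prod_iff by (simp add: eventually_principal filterlim_iff)
qed

lemma filterlim_prod_principal2:
  "filterlim (\<lambda>(x, y). m x y) K (F \<times>\<^sub>F principal {b}) \<longleftrightarrow> filterlim (\<lambda>x. m x b) K F"
proof -
  have "(\<exists>R S. eventually R F \<and> S b \<and> (\<forall>x y. R x \<longrightarrow> S y \<longrightarrow> P (m x y))) \<longleftrightarrow> eventually (\<lambda>x. P (m x b)) F" for P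
  proof
    assume "eventually (\<lambda>x. P (m x b)) F"
    then show "\<exists>R S. eventually R F \<and> S b \<and> (\<forall>x y. R x \<longrightarrow> S y \<longrightarrow> P (m x y))"
      by (intro exI[of _ "\<lambda>x. P (m x b)"] exI[of _ "\<lambda>y. y = b"]) simp
  qed (blast intro: eventually_mono)
  then show ?thesis
    unfolding filterlim_prod_iff by (simp add: eventually_principal filterlim_iff)
qed

lemma filterlim_principal_singleton: "filterlim f (principal {v}) F \<longleftrightarrow> eventually (\<lambda>x. f x = v) F"
  by (simp add: filterlim_principal)

lemma filterlim_prod_principals:
  "filterlim (\<lambda>(x, y). m x y) (principal {m a b}) (principal {a} \<times>\<^sub>F principal {b})"
  unfolding filterlim_prod_principal1 unfolding filterlim_principal_singleton
  by (simp add: eventually_principal)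

lemma filterlim_filtermap_cong:
  assumes "eventually (\<lambda>x. f x = g x) F"
  shows "filterlim f (filtermap g F) F"
  using assms unfolding filterlim_iff eventually_filtermap
  by (auto elim: eventually_elim2)

section \<open>Singular semigroups, and extensions in which \<open>X\<close> stays discrete\<close>

context commutative_semigroup
begin

lemma semigroup_on: "semigroup_on X mult"
  by (auto simp: semigroup_on_def assoc)

text \<open>Two new points multiply back into \<open>X\<close>: for \<open>a\<close> and
  \<open>b\<close> in \<open>A\<close> the product
  \<open>(x \<cdot> a) \<cdot> (y \<cdot> b)\<close> is \<open>x \<cdot> (y \<cdot> c)\<close>. A
  translate of \<open>p\<close> may well be principal; as \<open>\<Y>\<close> is a set of filters,
  it then simply coincides with a point of \<open>X\<close>.\<close>

theorem nonsingular_if_injectively_closed: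
  fixes C :: "'b topsemigroup set"
  assumes "X \<lesssim> (UNIV :: 'b set)" "TzS \<subseteq> C" "injectively_closed C X mult"
  shows "nonsingular_semigroup X mult"
  unfolding nonsingular_semigroup_def
proof
  assume "singular_semigroup X mult"
  then obtain A c where A: "A \<subseteq> X" "infinite A" and "{a \<cdot> b |a b. a \<in> A \<and> b \<in> A} = {c}"
    unfolding singular_semigroup_def is_singleton_def by blast
  then have c: "a \<cdot> b = c" if "a \<in> A" "b \<in> A" for a b
    using that by blast
  have cX: "c \<in> X"
    using c A by (metis closed finite.emptyI ex_in_conv subsetD)
  obtain p where p: "ultrafilter p" "eventually (\<lambda>a. a \<in> A) p" "\<And>v. eventually (\<lambda>a. a \<noteq> v) p"
    using free_filter_on_infinite[OF A(2)] by blast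
  define f where "f z = (case z of (x, i) \<Rightarrow> if i = 0 then principal {x} else filtermap ((\<cdot>) x) p)" for z :: "'a \<times> nat"
  \<comment> \<open>The identity is listed separately because \<open>X\<close> may lack a unit, so
    \<open>p\<close> need not be among its own translates.\<close>
  define \<Phi> where "\<Phi> = insert (\<lambda>a. a) ((\<cdot>) ` X)"
  define \<Y> where "\<Y> = insert p (f ` (X \<times> UNIV))"
  have Y_cases: "(\<exists>x\<in>X. F = principal {x}) \<or> (\<exists>g\<in>\<Phi>. F = filtermap g p)" if "F \<in> \<Y>" for F
    using that by (auto simp: \<Y>_def \<Phi>_def f_def filtermap_ident split: if_splits)
  have Y1: "principal {x} \<in> \<Y>" if "x \<in> X" for x
  proof -
    have "f (x, 0) \<in> \<Y>"
      using that by (simp add: \<Y>_def)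
    then show ?thesis by (simp add: f_def)
  qed
  have Y2: "filtermap g p \<in> \<Y>" if g: "g \<in> \<Phi>" for g
  proof -
    have "f (x, 1) \<in> \<Y>" if "x \<in> X" for x
      using that by (simp add: \<Y>_def)
    then show ?thesis
      using g by (auto simp: \<Phi>_def f_def \<Y>_def filtermap_ident)
  qed
  have gX: "g a \<in> X" if "g \<in> \<Phi>" "a \<in> X" for g a
    using that by (auto simp: \<Phi>_def)
  have compose: "\<exists>g'\<in>\<Phi>. \<forall>a\<in>X. x \<cdot> g a = g' a" if "x \<in> X" "g \<in> \<Phi>" for x g
    using that by (auto simp: \<Phi>_def assoc[symmetric])
  have const: "\<exists>k\<in>X. \<forall>a\<in>A. \<forall>b\<in>A. g a \<cdot> g' b = k" if g: "g \<in> \<Phi>" "g' \<in> \<Phi>" for g g'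
  proof -
    have AX: "a \<in> X" if "a \<in> A" for a
      using that A(1) by blast
    have E0: "\<exists>k\<in>X. \<forall>a\<in>A. \<forall>b\<in>A. a \<cdot> b = k"
      using c cX by auto
    have E1: "\<exists>k\<in>X. \<forall>a\<in>A. \<forall>b\<in>A. x \<cdot> a \<cdot> b = k" if "x \<in> X" for x
      using that c cX AX by (intro bexI[of _ "x \<cdot> c"]) (simp_all add: assoc)
    have E2: "\<exists>k\<in>X. \<forall>a\<in>A. \<forall>b\<in>A. a \<cdot> (x \<cdot> b) = k" if "x \<in> X" for x
    proof (intro bexI ballI)
      show "a \<cdot> (x \<cdot> b) = x \<cdot> c" if "a \<in> A" "b \<in> A" for a b
        using left_comm[of x a b] \<open>x \<in> X\<close> that AX c by simp
    qed (use that cX in simp)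
    have E3: "\<exists>k\<in>X. \<forall>a\<in>A. \<forall>b\<in>A. x \<cdot> a \<cdot> (y \<cdot> b) = k" if "x \<in> X" "y \<in> X" for x y
    proof (intro bexI ballI)
      show "x \<cdot> a \<cdot> (y \<cdot> b) = x \<cdot> (y \<cdot> c)" if "a \<in> A" "b \<in> A" for a b
        using left_comm[of y a b] \<open>x \<in> X\<close> \<open>y \<in> X\<close> that AX c by (simp add: assoc)
    qed (use that cX in simp)
    show ?thesis
      using g unfolding \<Phi>_def by (elim insertE imageE) (simp_all add: E0 E1 E2 E3)
  qed
  have "p \<in> (\<lambda>x. principal {x}) ` X"
  proof (rule filter_extension[OF semigroup_on assms(1-3)])
    show "\<Y> \<lesssim> X"
      unfolding \<Y>_def using A by (intro insert_image_times_nat_lepoll) (auto dest: finite_subset)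
    have ultra: "ultrafilter F" if "F \<in> \<Y>" for F
      using Y_cases[OF that] p(1) by (auto intro: ultrafilter_filtermap ultrafilter_principal)
    show "F \<noteq> bot" if "F \<in> \<Y>" for F
      using ultra[OF that] by (simp add: ultrafilter_def)
    show "inf F G = bot" if "F \<in> \<Y>" "G \<in> \<Y>" "F \<noteq> G" for F G
      using ultra that ultrafilter_inf_bot by blast
    show "\<exists>Q. eventually Q F \<and> (\<forall>x. Q x \<longrightarrow> P x) \<and> (\<forall>G\<in>\<Y>. eventually Q G \<or> eventually (\<lambda>x. \<not> Q x) G)"
      if "F \<in> \<Y>" "eventually P F" for F P
      using that ultra by (auto simp: ultrafilter_def intro!: exI[of _ P])
    have "eventually (\<lambda>a. g a \<in> X) p" if "g \<in> \<Phi>" for g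
      using p(2) by eventually_elim (use A(1) gX that in blast)
    then show "eventually (\<lambda>x. x \<in> X) F" if "F \<in> \<Y>" for F
      using Y_cases[OF that] by (auto simp: eventually_principal eventually_filtermap)
    show "\<exists>K\<in>\<Y>. filterlim (\<lambda>(x, y). x \<cdot> y) K (F \<times>\<^sub>F G)" if FG: "F \<in> \<Y>" "G \<in> \<Y>" for F G
      using Y_cases[OF FG(1)] Y_cases[OF FG(2)]
    proof (elim disjE bexE)
      fix x y assume *: "x \<in> X" "y \<in> X" "F = principal {x}" "G = principal {y}"
      show ?thesis
        unfolding * using Y1[OF closed[OF *(1,2)]] filterlim_prod_principals by (rule bexI[rotated])
    next
      fix x g assume *: "x \<in> X" "g \<in> \<Phi>" "F = principal {x}" "G = filtermap g p"
      then obtain g' where g': "g' \<in> \<Phi>" "\<And>a. a \<in> X \<Longrightarrow> x \<cdot> g a = g' a"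
        using compose[OF *(1,2)] by blast
      have "eventually (\<lambda>a. x \<cdot> g a = g' a) p"
        using p(2) by eventually_elim (use g' A in auto)
      then have "filterlim (\<lambda>(x, y). x \<cdot> y) (filtermap g' p) (F \<times>\<^sub>F G)"
        unfolding * filterlim_prod_principal1 filterlim_filtermap by (rule filterlim_filtermap_cong)
      then show ?thesis
        using Y2[OF g'(1)] by blast
    next
      fix x g assume *: "g \<in> \<Phi>" "x \<in> X" "F = filtermap g p" "G = principal {x}"
      then obtain g' where g': "g' \<in> \<Phi>" "\<And>a. a \<in> X \<Longrightarrow> x \<cdot> g a = g' a"
        using compose[OF *(2,1)] by blast
      have "eventually (\<lambda>a. g a \<cdot> x = g' a) p"
        using p(2) by eventually_elim (metis g'(2) A(1) * comm gX subsetD)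
      then have "filterlim (\<lambda>(x, y). x \<cdot> y) (filtermap g' p) (F \<times>\<^sub>F G)"
        unfolding * filterlim_prod_principal2 filterlim_filtermap by (rule filterlim_filtermap_cong)
      then show ?thesis
        using Y2[OF g'(1)] by blast
    next
      fix g g' assume *: "g \<in> \<Phi>" "g' \<in> \<Phi>" "F = filtermap g p" "G = filtermap g' p"
      then obtain k where k: "k \<in> X" "\<forall>a\<in>A. \<forall>b\<in>A. g a \<cdot> g' b = k"
        using const by blast
      have "eventually (\<lambda>(a, b). g a \<cdot> g' b = k) (p \<times>\<^sub>F p)"
        unfolding eventually_prod_filter using p(2) k(2)
        by (intro exI[of _ "\<lambda>a. a \<in> A"]) auto
      then have "filterlim (\<lambda>(x, y). x \<cdot> y) (principal {k}) (F \<times>\<^sub>F G)"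
        unfolding * filterlim_prod_filtermap_iff unfolding filterlim_principal_singleton
        by (simp add: case_prod_unfold)
      then show ?thesis
        using Y1[OF k(1)] by blast
    qed
    show "principal {x} \<in> \<Y>" if "x \<in> X" for x
      by (rule Y1[OF that])
    show "inj_on (\<lambda>x. principal {x}) X"
      by (auto simp: inj_on_def)
    show "filterlim (\<lambda>(x, y). x \<cdot> y) (principal {x \<cdot> y}) (principal {x} \<times>\<^sub>F principal {y})" for x y
      by (rule filterlim_prod_principals)
    show "p \<in> \<Y>"
      by (simp add: \<Y>_def)
    show "\<exists>x\<in>X. eventually P (principal {x})" if P: "eventually P p" for P
    proof -
      have "\<exists>a. P a \<and> a \<in> A"
        using eventually_happens'[OF _ eventually_conj[OF P p(2)]] p(1) by (simp add: ultrafilter_def)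
      then show ?thesis
        using A(1) by (auto simp: eventually_principal)
    qed
  qed
  then obtain x where "p = principal {x}"
    by blast
  then show False
    using p(3)[of x] by (simp add: eventually_principal)
qed

text \<open>The special case of \<open>filter_extension\<close> in which every point of \<open>X\<close> stays isolated.\<close>

theorem discrete_filter_extension:
  fixes C :: "'b topsemigroup set"
  assumes X: "X \<lesssim> (UNIV :: 'b set)" "TzS \<subseteq> C" "injectively_closed C X mult"
    and card: "\<G> \<lesssim> X"
    and nb: "\<And>F. F \<in> \<G> \<Longrightarrow> F \<noteq> bot"
    and sup: "\<And>F. F \<in> \<G> \<Longrightarrow> eventually (\<lambda>x. x \<in> X) F"
    and free: "\<And>F u. F \<in> \<G> \<Longrightarrow> eventually (\<lambda>x. x \<noteq> u) F"
    and disj: "\<And>F G. F \<in> \<G> \<Longrightarrow> G \<in> \<G> \<Longrightarrow> F \<noteq> G \<Longrightarrow> inf F G = bot"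
    and dec: "\<And>F P. F \<in> \<G> \<Longrightarrow> eventually P F \<Longrightarrow>
      \<exists>Q. eventually Q F \<and> (\<forall>x. Q x \<longrightarrow> P x) \<and>
          (\<forall>G\<in>\<G>. eventually Q G \<or> eventually (\<lambda>x. \<not> Q x) G)"
    and mult1: "\<And>u F. u \<in> X \<Longrightarrow> F \<in> \<G> \<Longrightarrow> \<exists>K\<in>(\<lambda>x. principal {x}) ` X \<union> \<G>. filterlim ((\<cdot>) u) K F"
    and mult2: "\<And>F G. F \<in> \<G> \<Longrightarrow> G \<in> \<G> \<Longrightarrow>
      \<exists>K\<in>(\<lambda>x. principal {x}) ` X \<union> \<G>. filterlim (\<lambda>(x, y). x \<cdot> y) K (F \<times>\<^sub>F G)"
  shows "\<G> = {}"
proof (rule ccontr)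
  assume "\<G> \<noteq> {}"
  then obtain F where F: "F \<in> \<G>" by blast
  define \<Y> where "\<Y> = (\<lambda>x. principal {x}) ` X \<union> \<G>"
  have infX: "infinite X"
  proof
    assume "finite X"
    then have "eventually (\<lambda>x. \<forall>u\<in>X. x \<noteq> u) F"
      using free[OF F] by (simp add: eventually_ball_finite)
    then have "eventually (\<lambda>x. False) F"
      using sup[OF F] by eventually_elim auto
    then show False
      using nb[OF F] by (simp add: trivial_limit_def)
  qed
  have "F \<in> (\<lambda>x. principal {x}) ` X"
  proof (rule filter_extension[OF semigroup_on X])
    show "\<Y> \<lesssim> X"
    proof -
      obtain g :: "'a \<Rightarrow> 'a filter" where g: "\<G> \<subseteq> g ` X"
        using card by (auto simp: lepoll_iff)
      define f where "f = (\<lambda>(x, i). if i = (0::nat) then principal {x} else g x)"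
      have "principal {x} \<in> f ` (X \<times> UNIV)" "g x \<in> f ` (X \<times> UNIV)" if "x \<in> X" for x
        using that imageI[of "(x, 0)" "X \<times> UNIV" f] imageI[of "(x, 1)" "X \<times> UNIV" f] by (simp_all add: f_def)
      \<comment> \<open>Here \<open>bot\<close> is no point of the extension; it only fills the
        place of the exceptional filter in the cardinality bound.\<close>
      then have "\<Y> \<subseteq> insert bot (f ` (X \<times> UNIV))"
        using g by (auto simp: \<Y>_def)
      then show ?thesis
        by (rule lepoll_trans[OF subset_imp_lepoll insert_image_times_nat_lepoll[OF infX]])
    qed
    have pf: "inf (principal {u}) G = bot" if "G \<in> \<G>" for u G
      by (rule inf_filter_botI[of "\<lambda>v. v = u" _ "\<lambda>v. v \<noteq> u"])
        (use free[OF that, of u] in \<open>simp_all add: eventually_principal\<close>)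
    have pp: "inf (principal {u}) (principal {v}) = bot" if "u \<noteq> v" for u v :: 'a
      using that by (simp add: principal_eq_bot_iff)
    show "inf G K = bot" if GK: "G \<in> \<Y>" "K \<in> \<Y>" "G \<noteq> K" for G K
      using GK unfolding \<Y>_def
      by (elim UnE imageE) (metis pp, metis pf, metis pf inf_commute, metis disj)
    show "G \<noteq> bot" if "G \<in> \<Y>" for G
      using that nb unfolding \<Y>_def by (elim UnE imageE) (simp_all add: principal_eq_bot_iff)
    show "eventually (\<lambda>x. x \<in> X) G" if "G \<in> \<Y>" for G
      using that sup unfolding \<Y>_def by (elim UnE imageE) (simp_all add: eventually_principal)
    show "\<exists>Q. eventually Q G \<and> (\<forall>x. Q x \<longrightarrow> P x) \<and> (\<forall>K\<in>\<Y>. eventually Q K \<or> eventually (\<lambda>x. \<not> Q x) K)"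
      if G: "G \<in> \<Y>" "eventually P G" for G P
    proof -
      consider u where "G = principal {u}" | "G \<in> \<G>"
        using G(1) by (auto simp: \<Y>_def)
      then show ?thesis
      proof cases
        case 1
        then show ?thesis
          using G(2) free by (intro exI[of _ "\<lambda>v. v = u"]) (auto simp: eventually_principal \<Y>_def)
      next
        case 2
        from dec[OF this G(2)] show ?thesis
          by (auto simp: eventually_principal \<Y>_def)
      qed
    qed
    show "\<exists>L\<in>\<Y>. filterlim (\<lambda>(x, y). x \<cdot> y) L (G \<times>\<^sub>F K)" if GK: "G \<in> \<Y>" "K \<in> \<Y>" for G K
      using GK unfolding \<Y>_def
    proof (elim UnE imageE)
      fix u v assume *: "G = principal {u}" "u \<in> X" "K = principal {v}" "v \<in> X"
      have "principal {u \<cdot> v} \<in> (\<lambda>x. principal {x}) ` X \<union> \<G>"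
        using * by blast
      then show "\<exists>L\<in>(\<lambda>x. principal {x}) ` X \<union> \<G>. filterlim (\<lambda>(x, y). x \<cdot> y) L (G \<times>\<^sub>F K)"
        using filterlim_prod_principals unfolding *(1,3) by (rule bexI[rotated])
    next
      fix u assume *: "G = principal {u}" "u \<in> X" "K \<in> \<G>"
      then show "\<exists>L\<in>(\<lambda>x. principal {x}) ` X \<union> \<G>. filterlim (\<lambda>(x, y). x \<cdot> y) L (G \<times>\<^sub>F K)"
        using mult1 by (simp only: filterlim_prod_principal1)
    next
      fix u assume *: "G \<in> \<G>" "K = principal {u}" "u \<in> X"
      obtain L where L: "L \<in> (\<lambda>x. principal {x}) ` X \<union> \<G>" "filterlim ((\<cdot>) u) L G"
        using mult1[OF *(3,1)] by blast
      have "eventually (\<lambda>x. x \<cdot> u = u \<cdot> x) G"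
        using sup[OF *(1)] by eventually_elim (use *(3) comm in blast)
      then have "filterlim (\<lambda>x. x \<cdot> u) L G"
        using L(2) by (simp add: filterlim_cong[OF refl refl])
      then show "\<exists>L\<in>(\<lambda>x. principal {x}) ` X \<union> \<G>. filterlim (\<lambda>(x, y). x \<cdot> y) L (G \<times>\<^sub>F K)"
        using L(1) unfolding *(2) filterlim_prod_principal2 by (rule bexI)
    qed (rule mult2)
    show "principal {z} \<in> \<Y>" if "z \<in> X" for z
      using that by (simp add: \<Y>_def)
    show "inj_on (\<lambda>z. principal {z}) X"
      by (auto simp: inj_on_def)
    show "filterlim (\<lambda>(x, y). x \<cdot> y) (principal {u \<cdot> v}) (principal {u} \<times>\<^sub>F principal {v})" for u v
      by (rule filterlim_prod_principals)
    show "F \<in> \<Y>"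
      using F by (simp add: \<Y>_def)
    show "\<exists>z\<in>X. eventually P (principal {z})" if P: "eventually P F" for P
      using eventually_happens'[OF nb[OF F] eventually_conj[OF P sup[OF F]]] by (auto simp: eventually_principal)
  qed
  then obtain u where "F = principal {u}"
    by blast
  then show False
    using free[OF F, of u] by (simp add: eventually_principal)
qed

end

text \<open>Convergence to infinity and, at the same time, to 0 modulo every positive integer. The
  second condition makes periodic sequences converge; both survive addition.\<close>

definition factorial_filter :: "nat filter" where
  "factorial_filter = (INF n. principal {l. n \<le> l \<and> fact n dvd l})"

lemma eventually_factorial_filter:
  "eventually P factorial_filter \<longleftrightarrow> (\<exists>n. \<forall>l\<ge>n. fact n dvd l \<longrightarrow> P l)"
  unfolding factorial_filter_def
proof (subst eventually_INF_base)
  fix a b :: nat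
  have "{l. max a b \<le> l \<and> fact (max a b) dvd l} \<subseteq> {l. a \<le> l \<and> fact a dvd l} \<inter> {l. b \<le> l \<and> fact b dvd l}"
    using fact_dvd[of a "max a b"] fact_dvd[of b "max a b"] by (auto dest: dvd_trans)
  then show "\<exists>n\<in>UNIV. principal {l. n \<le> l \<and> (fact n :: nat) dvd l}
      \<le> inf (principal {l. a \<le> l \<and> fact a dvd l}) (principal {l. b \<le> l \<and> fact b dvd l})"
    by (intro bexI[of _ "max a b"]) auto
qed (auto simp: eventually_principal)

lemma factorial_filter_neq_bot: "factorial_filter \<noteq> bot"
proof -
  have "\<exists>l\<ge>n. (fact n :: nat) dvd l" for n
    by (intro exI[of _ "fact n"]) (simp add: fact_ge_self)
  then show ?thesis
    unfolding trivial_limit_def eventually_factorial_filter by blast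
qed

lemma eventually_ge_factorial_filter: "eventually (\<lambda>l. n \<le> l) factorial_filter"
  unfolding eventually_factorial_filter by blast

lemma filterlim_add_factorial_filter:
  "filterlim (\<lambda>(k, l). k + l) factorial_filter (factorial_filter \<times>\<^sub>F factorial_filter)"
  unfolding filterlim_prod_iff eventually_factorial_filter
proof (intro allI impI)
  fix P :: "nat \<Rightarrow> bool" assume "\<exists>n. \<forall>l\<ge>n. fact n dvd l \<longrightarrow> P l"
  then obtain n where "\<forall>l\<ge>n. fact n dvd l \<longrightarrow> P l" ..
  then show "\<exists>R S. (\<exists>n. \<forall>l\<ge>n. fact n dvd l \<longrightarrow> R l) \<and> (\<exists>n. \<forall>l\<ge>n. fact n dvd l \<longrightarrow> S l) \<and>
      (\<forall>x y. R x \<longrightarrow> S y \<longrightarrow> P (x + y))"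
    by (intro exI[of _ "\<lambda>l. n \<le> l \<and> fact n dvd l"] conjI) auto
qed

section \<open>Elements of infinite order\<close>

context commutative_semigroup
begin

text \<open>From \<open>i\<close> on the powers have period \<open>k = j - i\<close>. The exponent
  \<open>k * i\<close> is at least \<open>i\<close> and a multiple of \<open>k\<close>, so doubling
  it changes nothing.\<close>

lemma pow_eq_imp_idempotent:
  assumes x: "x \<in> X" and ij: "0 < i" "i < j" "pow x i = pow x j"
  shows "\<exists>n>0. pow x n \<cdot> pow x n = pow x n"
proof -
  define k where "k = j - i"
  have k: "k > 0" "pow x (i + k) = pow x i"
    using ij by (auto simp: k_def)
  have "pow x (i + k * r) = pow x i" for r
  proof (induction r)
    case (Suc r)
    show ?case
    proof (cases "r = 0")
      case False
      have "pow x (i + k * Suc r) = pow x (i + k) \<cdot> pow x (k * r)"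
        using pow_add[of x "k * r" "i + k"] x k(1) False by (simp add: algebra_simps)
      also have "\<dots> = pow x (i + k * r)"
        using pow_add[of x "k * r" i] x k ij(1) False by simp
      finally show ?thesis using Suc.IH by simp
    qed (use k in simp)
  qed simp
  note iter = this
  have "pow x (k * i) = pow x (k * i) \<cdot> pow x (k * i)"
  \<comment> \<open>For \<open>k = 1\<close> the exponent \<open>k * i - i\<close> would be 0, at
    which \<open>pow\<close> is not a unit.\<close>
  proof (cases "k = 1")
    case True
    then show ?thesis
      using iter[of i] pow_add[of x i i] x ij(1) by simp
  next
    case False
    then have ki: "k * i - i > 0" "k * i = (k * i - i) + i"
      using k(1) ij(1) by (auto simp: algebra_simps)
    have "pow x (k * i) = pow x (k * i - i) \<cdot> pow x i"
      using pow_add[of x i "k * i - i"] ki x ij(1) by simp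
    also have "\<dots> = pow x (k * i - i) \<cdot> pow x (i + k * i)"
      by (simp add: iter)
    also have "\<dots> = pow x ((k * i - i) + (i + k * i))"
      using pow_add[of x "i + k * i" "k * i - i"] ki x ij(1) by simp
    also have "\<dots> = pow x (k * i + k * i)"
      using ki by simp
    finally show ?thesis
      using pow_add[of x "k * i" "k * i"] x k(1) ij(1) by simp
  qed
  then show ?thesis
    using k(1) ij(1) by (intro exI[of _ "k * i"]) simp
qed

end

context unipotent_semigroup
begin

text \<open>New points come only from the \<open>z\<close> for which
  \<open>z \<cdot> pow x l\<close> is injective in \<open>l\<close>. Otherwise this sequence is
  eventually periodic, hence eventually constant along \<open>D\<close>, and its limit falls back
  into \<open>X\<close>. Sums along \<open>D\<close> tend to \<open>D\<close>, so the limits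
  multiply like their factors \<open>z\<close>.\<close>

theorem periodic_if_injectively_closed:
  fixes C :: "'b topsemigroup set"
  assumes "X \<lesssim> (UNIV :: 'b set)" "TzS \<subseteq> C" "injectively_closed C X mult"
  shows periodic
proof (rule ccontr)
  assume "\<not> periodic"
  then obtain x where x: "x \<in> X" and xe: "\<And>n. n > 0 \<Longrightarrow> pow x n \<noteq> e"
    unfolding periodic_def by blast
  have pow_inj: "pow x i \<noteq> pow x j" if "0 < i" "i < j" for i j
    using pow_eq_imp_idempotent[OF x that] e_unique xe x by blast
  define \<omega> where "\<omega> z l = z \<cdot> pow x l" for z l
  have \<omega>X: "\<omega> z l \<in> X" if "z \<in> X" for z l
    using that x by (simp add: \<omega>_def)
  have \<omega>_shift: "\<omega> z (i + t) = \<omega> z' (j + t)"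
    if "\<omega> z i = \<omega> z' j" "z \<in> X" "z' \<in> X" "0 < i" "0 < j" for z z' i j t
  proof (cases "t = 0")
    case False
    then have "\<omega> w (k + t) = \<omega> w k \<cdot> pow x t" if "w \<in> X" "k > 0" for w k
      using that x by (simp add: \<omega>_def pow_add assoc)
    then show ?thesis using that by simp
  qed (use that in simp)
  have \<omega>_mult: "z \<cdot> \<omega> z' l = \<omega> (z \<cdot> z') l" if "z \<in> X" "z' \<in> X" for z z' l
    using that x by (simp add: \<omega>_def assoc)
  have \<omega>_mult2: "\<omega> z k \<cdot> \<omega> z' l = \<omega> (z \<cdot> z') (k + l)" if "z \<in> X" "z' \<in> X" "k > 0" "l > 0" for z z' k l
    using that x left_comm[of z' "pow x k" "pow x l"] by (simp add: \<omega>_def assoc pow_add)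
  define free where "free z \<longleftrightarrow> inj_on (\<omega> z) {0<..}" for z
  have freeD: "\<omega> z i = \<omega> z j \<longleftrightarrow> i = j" if "free z" "0 < i" "0 < j" for z i j
    using that by (auto simp: free_def inj_on_def)
  define D where "D = factorial_filter"
  define \<G> where "\<G> = (\<lambda>z. filtermap (\<omega> z) D) ` {z \<in> X. free z}"
  define \<Y> where "\<Y> = (\<lambda>x. principal {x}) ` X \<union> \<G>"
  have Y1: "principal {z} \<in> \<Y>" if "z \<in> X" for z
    using that by (simp add: \<Y>_def)
  have Y2: "filtermap (\<omega> z) D \<in> \<Y>" if "z \<in> X" "free z" for z
    using that by (simp add: \<Y>_def \<G>_def)
  have ne: "eventually (\<lambda>l. \<omega> z l \<noteq> v) D" if "free z" for z v
  proof (cases "\<exists>i>0. \<omega> z i = v")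
    case True
    then obtain i where "i > 0" "\<omega> z i = v" by blast
    then have "\<omega> z l \<noteq> v" if "l \<ge> Suc i" for l
      using freeD[OF \<open>free z\<close>, of l i] that by auto
    then show ?thesis
      unfolding D_def by (rule eventually_mono[OF eventually_ge_factorial_filter])
  next
    case False
    then have "\<omega> z l \<noteq> v" if "l \<ge> 1" for l
      using that by (metis One_nat_def Suc_le_eq)
    then show ?thesis
      unfolding D_def by (rule eventually_mono[OF eventually_ge_factorial_filter])
  qed
  have limit: "\<exists>K\<in>\<Y>. filterlim (\<omega> z) K D" if z: "z \<in> X" for z
  proof (cases "free z")
    case True
    then show ?thesis
      using Y2[OF z] by (auto simp: filterlim_def)
  next
    case False
    then obtain i j where ij: "0 < i" "i < j" "\<omega> z i = \<omega> z j"
      unfolding free_def inj_on_def by (metis greaterThan_iff linorder_neqE_nat)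
    define k where "k = j - i"
    have step: "\<omega> z (l + k) = \<omega> z l" if "l \<ge> i" for l
      using \<omega>_shift[OF ij(3) z z, of "l - i"] ij that by (simp add: k_def algebra_simps)
    have "\<omega> z (l + k * r) = \<omega> z l" if "l \<ge> i" for l r
    proof (induction r)
      case (Suc r)
      then show ?case using step[of "l + k * r"] that by (simp add: algebra_simps)
    qed simp
    then have per: "\<omega> z l = \<omega> z l'" if "l \<ge> i" "l \<le> l'" "k dvd l' - l" for l l'
      using that by (metis dvdE le_add_diff_inverse)
    \<comment> \<open>Chosen to be a multiple of \<open>k\<close> beyond the preperiod
      \<open>i\<close>, and at least \<open>k\<close>, so that \<open>k\<close> divides
      \<open>fact N\<close> too.\<close>
    define N where "N = fact (i + k) * (i + k)"
    have "k > 0" using ij by (simp add: k_def)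
    then have "k dvd fact (i + k)"
      by (intro dvd_fact) auto
    have "\<omega> z l = \<omega> z N" if "l \<ge> N" "fact N dvd l" for l
    proof -
      have "k dvd N"
        using \<open>k dvd fact (i + k)\<close> by (simp add: N_def)
      moreover have "N \<ge> i + k"
        using fact_ge_1[of "i + k", where 'a = nat] by (simp add: N_def)
      moreover have "k dvd l"
        using \<open>k > 0\<close> \<open>N \<ge> i + k\<close> that(2) dvd_fact[of k N] dvd_trans by auto
      ultimately show ?thesis
        using per[of N l] that by (simp add: dvd_diff_nat)
    qed
    then have "eventually (\<lambda>l. \<omega> z l = \<omega> z N) D"
      unfolding D_def eventually_factorial_filter by blast
    then have "filterlim (\<omega> z) (principal {\<omega> z N}) D"
      unfolding filterlim_principal_singleton .
    then show ?thesis
      using Y1[OF \<omega>X[OF z]] by (rule bexI)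
  qed
  \<comment> \<open>Once two orbits meet they run in parallel; as \<open>z'\<close> is free, every
    later meeting has the same shift.\<close>
  have related: "l' + i = l + j" if "free z'" "z \<in> X" "z' \<in> X" "0 < i" "0 < j" "\<omega> z i = \<omega> z' j"
    "\<omega> z l = \<omega> z' l'" "i \<le> l" "0 < l'" for z z' i j l l'
  proof -
    have "\<omega> z' l' = \<omega> z' (j + (l - i))"
      using \<omega>_shift[OF that(6) that(2-5), of "l - i"] that(7,8) by simp
    then have "l' = j + (l - i)"
      using freeD[OF that(1,9)] that(5) by simp
    then show ?thesis
      using that(8) by simp
  qed
  have "\<omega> x l = pow x (Suc l)" if "l > 0" for l
    using that by (simp add: \<omega>_def pow_Suc)
  then have free_x: "free x"
    unfolding free_def inj_on_def using pow_inj by (metis Suc_less_eq greaterThan_iff linorder_neqE_nat zero_less_Suc)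
  have "\<G> = {}"
  proof (rule discrete_filter_extension[OF assms(1-3)])
    show "\<G> \<lesssim> X"
      unfolding \<G>_def by (rule lepoll_trans[OF image_lepoll subset_imp_lepoll]) auto
    show "F \<noteq> bot" if "F \<in> \<G>" for F
      using that unfolding \<G>_def by (elim imageE) (simp add: D_def filtermap_bot_iff factorial_filter_neq_bot)
    show "eventually (\<lambda>u. u \<in> X) F" if "F \<in> \<G>" for F
      using that \<omega>X by (auto simp: \<G>_def eventually_filtermap)
    show "eventually (\<lambda>v. v \<noteq> u) F" if "F \<in> \<G>" for F u
      using that ne by (auto simp: \<G>_def eventually_filtermap)
    have ff: "inf (filtermap (\<omega> z) D) (filtermap (\<omega> z') D) = bot"
      if z: "z \<in> X" "free z" "z' \<in> X" "free z'" "filtermap (\<omega> z) D \<noteq> filtermap (\<omega> z') D" for z z'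
    proof -
      \<comment> \<open>If the orbits meet with shift 0, the filters coincide. For any other shift
        \<open>j - i\<close>, two multiples of \<open>fact (i + j)\<close> cannot differ by it,
        since its absolute value is positive and less than \<open>i + j\<close>.\<close>
      have "\<exists>n>0. \<forall>l\<ge>n. \<forall>l'\<ge>n. fact n dvd l \<longrightarrow> fact n dvd l' \<longrightarrow> \<omega> z l \<noteq> \<omega> z' l'"
      proof (cases "\<exists>i>0. \<exists>j>0. \<omega> z i = \<omega> z' j")
        case True
        then obtain i j where ij: "0 < i" "0 < j" "\<omega> z i = \<omega> z' j" by blast
        have "i \<noteq> j"
        proof
          assume [simp]: "i = j"
          have "\<omega> z l = \<omega> z' l" if "l \<ge> i" for l
            using \<omega>_shift[OF ij(3) z(1,3) ij(1,2), of "l - i"] that by simp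
          then have "eventually (\<lambda>l. \<omega> z l = \<omega> z' l) D"
            unfolding D_def by (rule eventually_mono[OF eventually_ge_factorial_filter])
          then have "filtermap (\<omega> z) D = filtermap (\<omega> z') D"
            by (intro antisym) (auto simp: filterlim_def[symmetric] eq_commute intro!: filterlim_filtermap_cong)
          then show False using z(5) by simp
        qed
        have "\<omega> z l \<noteq> \<omega> z' l'" if "l \<ge> i + j" "l' \<ge> i + j" "fact (i + j) dvd l" "fact (i + j) dvd l'" for l l'
        proof
          assume "\<omega> z l = \<omega> z' l'"
          then have "l' + i = l + j"
            using related[OF z(4,1,3) ij(1,2,3)] that(1,2) ij(1) by simp
          then have "int j - int i = int l' - int l"
            by linarith
          moreover have "int (fact (i + j)) dvd int l' - int l"
            using that(3,4) by (intro dvd_diff) (simp_all only: int_dvd_int_iff)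
          ultimately have "int (fact (i + j)) dvd int j - int i"
            by simp
          then have "int (fact (i + j)) \<le> \<bar>int j - int i\<bar>"
            using dvd_imp_le_int[of "int j - int i" "int (fact (i + j))"] \<open>i \<noteq> j\<close> by simp
          moreover have "i + j \<le> fact (i + j)"
            by (rule fact_ge_self)
          ultimately show False
            using ij(1,2) by linarith
        qed
        then show ?thesis
          using ij(1) by (intro exI[of _ "i + j"]) simp
      next
        case False
        then have "\<omega> z l \<noteq> \<omega> z' l'" if "l \<ge> 1" "l' \<ge> 1" for l l'
          using that by (metis One_nat_def Suc_le_eq)
        then show ?thesis
          by (intro exI[of _ 1]) simp
      qed
      then obtain n where n: "\<And>l l'. l \<ge> n \<Longrightarrow> l' \<ge> n \<Longrightarrow> fact n dvd l \<Longrightarrow> fact n dvd l' \<Longrightarrow> \<omega> z l \<noteq> \<omega> z' l'"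
        by blast
      show ?thesis
      proof (rule inf_filter_botI)
        show "eventually (\<lambda>v. \<exists>l\<ge>n. fact n dvd l \<and> v = \<omega> z l) (filtermap (\<omega> z) D)"
          "eventually (\<lambda>v. \<exists>l\<ge>n. fact n dvd l \<and> v = \<omega> z' l) (filtermap (\<omega> z') D)"
          unfolding eventually_filtermap D_def eventually_factorial_filter by blast+
      qed (use n in blast)
    qed
    show "inf F G = bot" if FG: "F \<in> \<G>" "G \<in> \<G>" "F \<noteq> G" for F G
      using FG ff unfolding \<G>_def by blast
    show "\<exists>Q. eventually Q F \<and> (\<forall>u. Q u \<longrightarrow> P u) \<and> (\<forall>G\<in>\<G>. eventually Q G \<or> eventually (\<lambda>u. \<not> Q u) G)"
      if F: "F \<in> \<G>" "eventually P F" for F P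
    proof -
      obtain z where z: "z \<in> X" "free z" and [simp]: "F = filtermap (\<omega> z) D"
        using F(1) by (auto simp: \<G>_def)
      obtain n where n: "\<And>l. l \<ge> n \<Longrightarrow> fact n dvd l \<Longrightarrow> P (\<omega> z l)"
        using F(2) by (auto simp: D_def eventually_filtermap eventually_factorial_filter)
      \<comment> \<open>Every filter decides \<open>Q\<close>: on an orbit meeting that of
        \<open>z\<close> with shift \<open>i - j\<close>, membership of late points depends only on
        whether \<open>fact n\<close> divides \<open>i - j\<close>. The clause \<open>l > 0\<close>
        keeps the exponents where \<open>free\<close> applies.\<close>
      define Q where "Q v \<longleftrightarrow> (\<exists>l\<ge>n. l > 0 \<and> fact n dvd l \<and> v = \<omega> z l)" for v
      have "Q (\<omega> z l)" if l: "l \<ge> Suc n" "fact (Suc n) dvd l" for l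
      proof -
        have "fact n dvd l"
          by (rule dvd_trans[OF fact_dvd l(2)]) simp
        moreover have "n \<le> l" "0 < l"
          using l(1) by auto
        ultimately show ?thesis
          unfolding Q_def by blast
      qed
      then have "eventually Q F"
        unfolding \<open>F = _\<close> D_def eventually_filtermap eventually_factorial_filter by blast
      moreover have "\<forall>v. Q v \<longrightarrow> P v"
        using n by (auto simp: Q_def)
      moreover have "eventually Q G \<or> eventually (\<lambda>v. \<not> Q v) G" if G: "G \<in> \<G>" for G
      proof -
        obtain z' where z': "z' \<in> X" "free z'" and [simp]: "G = filtermap (\<omega> z') D"
          using G by (auto simp: \<G>_def)
        show ?thesis
        proof (cases "\<exists>i>0. \<exists>j>0. \<omega> z i = \<omega> z' j")
          case True
          then obtain i j where ij: "0 < i" "0 < j" "\<omega> z i = \<omega> z' j" by blast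
          have Q_iff: "Q (\<omega> z' l) \<longleftrightarrow> int (fact n) dvd int i - int j"
            if l: "l \<ge> Suc (n + i + j)" "fact (Suc (n + i + j)) dvd l" for l
          proof -
            define k where "k = i + (l - j)"
            have eq: "\<omega> z' l = \<omega> z k"
              using \<omega>_shift[OF ij(3) z(1) z'(1) ij(1,2), of "l - j"] l by (simp add: k_def)
            have k: "k \<ge> n" "k > 0"
              using l ij by (auto simp: k_def)
            have "Q (\<omega> z' l) \<longleftrightarrow> fact n dvd k"
              using eq k freeD[OF z(2)] by (auto simp: Q_def)
            also have "\<dots> \<longleftrightarrow> int (fact n) dvd int l + (int i - int j)"
              using l unfolding int_dvd_int_iff[symmetric] by (simp add: k_def algebra_simps)
            also have "\<dots> \<longleftrightarrow> int (fact n) dvd int i - int j"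
            proof (rule dvd_add_right_iff)
              have "fact n dvd l"
                using l(2) by (rule dvd_trans[OF fact_dvd, rotated]) simp
              then show "int (fact n) dvd int l"
                by (simp only: int_dvd_int_iff)
            qed
            finally show ?thesis .
          qed
          show ?thesis
            unfolding \<open>G = _\<close> D_def eventually_filtermap eventually_factorial_filter
            using Q_iff by blast
        next
          case False
          then have "\<not> Q (\<omega> z' l)" if "l \<ge> 1" for l
            using that unfolding Q_def by (metis One_nat_def Suc_le_eq)
          then show ?thesis
            unfolding \<open>G = _\<close> D_def eventually_filtermap eventually_factorial_filter by blast
        qed
      qed
      ultimately show ?thesis by blast
    qed
    show "\<exists>K\<in>(\<lambda>x. principal {x}) ` X \<union> \<G>. filterlim ((\<cdot>) u) K F" if u: "u \<in> X" and F: "F \<in> \<G>" for u F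
    proof -
      obtain z where "z \<in> X" "F = filtermap (\<omega> z) D"
        using F by (auto simp: \<G>_def)
      then show ?thesis
        using u limit[of "u \<cdot> z"] unfolding \<Y>_def by (simp add: filterlim_filtermap \<omega>_mult)
    qed
    show "\<exists>K\<in>(\<lambda>x. principal {x}) ` X \<union> \<G>. filterlim (\<lambda>(x, y). x \<cdot> y) K (F \<times>\<^sub>F G)"
      if FG: "F \<in> \<G>" "G \<in> \<G>" for F G
    proof -
      obtain z z' where *: "z \<in> X" "z' \<in> X" "F = filtermap (\<omega> z) D" "G = filtermap (\<omega> z') D"
        using FG by (auto simp: \<G>_def)
      obtain K where K: "K \<in> \<Y>" "filterlim (\<omega> (z \<cdot> z')) K D"
        using limit[of "z \<cdot> z'"] * by auto
      have "filterlim (\<lambda>p. \<omega> (z \<cdot> z') (case p of (k, l) \<Rightarrow> k + l)) K (D \<times>\<^sub>F D)"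
        by (rule filterlim_compose[OF K(2)]) (simp add: D_def filterlim_add_factorial_filter)
      moreover have "eventually (\<lambda>p. (case p of (k, l) \<Rightarrow> \<omega> z k \<cdot> \<omega> z' l) = \<omega> (z \<cdot> z') (case p of (k, l) \<Rightarrow> k + l)) (D \<times>\<^sub>F D)"
        unfolding eventually_prod_filter D_def using eventually_ge_factorial_filter[of 1] \<omega>_mult2 *(1,2)
        by (intro exI[of _ "\<lambda>l. 1 \<le> l"]) auto
      ultimately have "filterlim (\<lambda>(k, l). \<omega> z k \<cdot> \<omega> z' l) K (D \<times>\<^sub>F D)"
        by (simp add: filterlim_cong[OF refl refl])
      then show ?thesis
        using K(1) unfolding \<Y>_def * filterlim_prod_filtermap_iff by blast
    qed
  qed
  then show False
    using free_x x by (simp add: \<G>_def)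
qed

end

section \<open>Infinite maximal subgroups\<close>

context unipotent_semigroup
begin

lemma H_mult [simp, intro]: "a \<in> H \<Longrightarrow> b \<in> H \<Longrightarrow> a \<cdot> b \<in> H"
  using H_ideal H_subset by blast

lemma H_in_X [simp, intro]: "a \<in> H \<Longrightarrow> a \<in> X"
  using H_subset by blast

lemma e_mult_H [simp]: "a \<in> H \<Longrightarrow> e \<cdot> a = a"
  by (simp add: H_iff)

lemma H_mult_e [simp]: "a \<in> H \<Longrightarrow> a \<cdot> e = a"
  using comm[of a e] by simp

lemma pow_in_H [simp, intro]: "a \<in> H \<Longrightarrow> pow a n \<in> H"
proof (induction n)
  case (Suc n)
  then show ?case by (cases "n = 0") (simp_all add: pow_Suc)
qed (simp add: semigroup_power_def)

text \<open>In a periodic semigroup these are exactly the subgroups, inverses being powers.\<close>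

definition submonoid_H :: "'a set \<Rightarrow> bool" where
  "submonoid_H S \<longleftrightarrow> S \<subseteq> H \<and> e \<in> S \<and> (\<forall>a\<in>S. \<forall>b\<in>S. a \<cdot> b \<in> S)"

lemma submonoid_HD:
  assumes "submonoid_H S"
  shows "a \<in> S \<Longrightarrow> a \<in> H" "e \<in> S" "a \<in> S \<Longrightarrow> b \<in> S \<Longrightarrow> a \<cdot> b \<in> S"
  using assms by (auto simp: submonoid_H_def)

lemma submonoid_H_H: "submonoid_H H"
  by (auto simp: submonoid_H_def)

lemma submonoid_H_pow:
  assumes "submonoid_H S" "a \<in> S"
  shows "pow a n \<in> S"
proof (induction n)
  case (Suc n)
  then show ?case using assms by (cases "n = 0") (auto simp: pow_Suc submonoid_H_def)
qed (use assms in \<open>simp add: semigroup_power_def\<close>)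

text \<open>Exponents are positive because \<open>pow w 0\<close> is \<open>w\<close> rather than a
  unit. When \<open>X\<close> is periodic, a power equal to \<open>e\<close> takes the place of the
  trivial one.\<close>

definition adjoin :: "'a set \<Rightarrow> 'a \<Rightarrow> 'a set" where
  "adjoin S w = {f \<cdot> pow w c |f c. f \<in> S \<and> c > 0}"

context
  assumes per: periodic
begin

lemma submonoid_H_inverse:
  assumes "submonoid_H S" "a \<in> S"
  obtains b where "b \<in> S" "a \<cdot> b = e"
proof -
  have a: "a \<in> H"
    using assms by (auto simp: submonoid_H_def)
  obtain n where n: "n > 0" "pow a n = e"
    using per a by (auto simp: periodic_def)
  show thesis
  proof (cases "n = 1")
    case True
    then show thesis using that[of a] n assms a by simp
  next
    case False
    then have "a \<cdot> pow a (n - 1) = e"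
      using n pow_Suc[of "n - 1" a] by simp
    then show thesis
      using that submonoid_H_pow[OF assms] by blast
  qed
qed

lemma H_cancel:
  assumes "a \<in> H" "b \<in> H" "c \<in> H" "a \<cdot> b = a \<cdot> c"
  shows "b = c"
proof -
  obtain a' where a': "a' \<in> H" "a \<cdot> a' = e"
    using submonoid_H_inverse[OF submonoid_H_H assms(1)] by blast
  have "b = (a \<cdot> a') \<cdot> b" "c = (a \<cdot> a') \<cdot> c"
    using a' assms by simp_all
  moreover have "(a \<cdot> a') \<cdot> b = a' \<cdot> (a \<cdot> b)" "(a \<cdot> a') \<cdot> c = a' \<cdot> (a \<cdot> c)"
    using a'(1) assms(1-3) by (simp_all add: comm[of a a'] assoc)
  ultimately show ?thesis
    using assms(4) by simp
qed

lemma submonoid_H_divide: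
  assumes S: "submonoid_H S" "a \<in> S" and b: "b \<in> H" "a \<cdot> b \<in> S"
  shows "b \<in> S"
proof -
  obtain a' where a': "a' \<in> S" "a \<cdot> a' = e"
    using submonoid_H_inverse[OF S] by blast
  have H: "a \<in> H" "a' \<in> H"
    using S a' by (auto simp: submonoid_H_def)
  then have "a' \<cdot> (a \<cdot> b) = (a \<cdot> a') \<cdot> b"
    using b by (simp add: comm[of a a'] assoc)
  then have "b = a' \<cdot> (a \<cdot> b)"
    using a' b by simp
  then show ?thesis
    using S(1) a'(1) b(2) by (metis submonoid_HD(3))
qed

lemma submonoid_H_adjoin:
  assumes "submonoid_H S" "w \<in> H"
  shows "submonoid_H (adjoin S w)" "S \<subseteq> adjoin S w" "w \<in> adjoin S w"
proof -
  obtain n where n: "n > 0" "pow w n = e"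
    using per assms(2) by (auto simp: periodic_def)
  show sub: "S \<subseteq> adjoin S w"
  proof
    fix f assume f: "f \<in> S"
    then have "f = f \<cdot> pow w n"
      using n(2) submonoid_HD(1)[OF assms(1)] by simp
    then show "f \<in> adjoin S w"
      using f n(1) unfolding adjoin_def by blast
  qed
  show "w \<in> adjoin S w"
    unfolding adjoin_def using assms submonoid_HD(2) by (auto intro!: exI[of _ e] exI[of _ "Suc 0"])
  have "a \<cdot> b \<in> adjoin S w" if ab: "a \<in> adjoin S w" "b \<in> adjoin S w" for a b
  proof -
    obtain f c g d where *: "f \<in> S" "c > 0" "a = f \<cdot> pow w c" "g \<in> S" "d > 0" "b = g \<cdot> pow w d"
      using ab unfolding adjoin_def by blast
    have "f \<in> X" "g \<in> X" "w \<in> X"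
      using * assms by (auto dest: submonoid_HD(1))
    then have "a \<cdot> b = (f \<cdot> g) \<cdot> pow w (c + d)"
      using * left_comm[of g "pow w c" "pow w d"] by (simp add: pow_add assoc)
    then show ?thesis
      unfolding adjoin_def using * submonoid_HD(3)[OF assms(1)] by auto
  qed
  moreover have "adjoin S w \<subseteq> H"
    using assms by (auto simp: adjoin_def dest: submonoid_HD(1))
  ultimately show "submonoid_H (adjoin S w)"
    using sub assms(1) by (auto simp: submonoid_H_def)
qed

lemma finite_adjoin:
  assumes "finite S" "S \<subseteq> H" "w \<in> H"
  shows "finite (adjoin S w)"
proof -
  obtain n where n: "n > 0" "pow w n = e"
    using per assms(3) by (auto simp: periodic_def)
  have red: "pow w c \<in> pow w ` {0<..n}" if "c > 0" for c
    using that
  proof (induction c rule: less_induct)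
    case (less c)
    show ?case
    proof (cases "c \<le> n")
      case False
      then have "pow w c = pow w (c - n)"
        using pow_add[of w n "c - n"] n assms(3) by simp
      then show ?thesis
        using less.IH[of "c - n"] False n(1) by simp
    qed (use less.prems in auto)
  qed
  have "adjoin S w \<subseteq> (\<lambda>(f, h). f \<cdot> h) ` (S \<times> pow w ` {0<..n})"
    using red by (force simp: adjoin_def)
  then show ?thesis
    using assms(1) by (meson finite_SigmaI finite_greaterThanAtMost finite_imageI finite_subset)
qed

text \<open>The solutions of \<open>pow h m = f\<close> are empty or a coset of the roots of
  \<open>e\<close>: multiplying by the inverse of one solution maps them injectively into the finite
  set of roots.\<close>

lemma finite_roots:
  assumes fin: "finite {h \<in> H. pow h m = e}" and F: "finite F" "F \<subseteq> H" and m: "m > 0"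
  shows "finite {h \<in> H. pow h m \<in> F}"
proof -
  have "finite {h \<in> H. pow h m = f}" if f: "f \<in> F" for f
  proof (cases "\<exists>h0\<in>H. pow h0 m = f")
    case True
    then obtain h0 where h0: "h0 \<in> H" "pow h0 m = f" by blast
    obtain h1 where h1: "h1 \<in> H" "h0 \<cdot> h1 = e"
      using submonoid_H_inverse[OF submonoid_H_H h0(1)] by blast
    have "(\<cdot>) h1 ` {h \<in> H. pow h m = f} \<subseteq> {h \<in> H. pow h m = e}"
    proof
      fix k assume "k \<in> (\<cdot>) h1 ` {h \<in> H. pow h m = f}"
      then obtain h where h: "h \<in> H" "pow h m = f" "k = h1 \<cdot> h" by blast
      have "pow k m = pow h1 m \<cdot> pow h0 m"
        using h h0 h1(1) m by (simp add: pow_mult_distrib)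
      also have "\<dots> = pow (h0 \<cdot> h1) m"
        using h0 h1(1) m comm[of h0 h1] by (simp add: pow_mult_distrib)
      finally show "k \<in> {h \<in> H. pow h m = e}"
        using h h1 by simp
    qed
    moreover have "inj_on ((\<cdot>) h1) {h \<in> H. pow h m = f}"
      using H_cancel h1(1) by (auto simp: inj_on_def)
    ultimately show ?thesis
      using fin finite_imageD finite_subset by blast
  next
    case False
    then have empty: "{h \<in> H. pow h m = f} = {}" by blast
    show ?thesis unfolding empty by simp
  qed
  then have "finite (\<Union>f\<in>F. {h \<in> H. pow h m = f})"
    using F(1) by blast
  then show ?thesis
    by (rule rev_finite_subset) blast
qed

text \<open>Each \<open>w k\<close> is chosen with small powers outside the finite subgroup \<open>F k\<close> generated by the
  earlier ones; by \<open>finite_roots\<close> only finitely many candidates are excluded.\<close>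

lemma independent_sequence:
  assumes G: "infinite G" "G \<subseteq> H"
    and fin: "\<And>m k. 0 < m \<Longrightarrow> m \<le> M k \<Longrightarrow> finite {h \<in> H. pow h m = e}"
  obtains F :: "nat \<Rightarrow> 'a set" and w :: "nat \<Rightarrow> 'a" where
    "F 0 = {e}" "\<And>k. F (Suc k) = adjoin (F k) (w k)" "\<And>k. submonoid_H (F k)"
    "\<And>k. w k \<in> G" "\<And>k m. 0 < m \<Longrightarrow> m \<le> M k \<Longrightarrow> pow (w k) m \<notin> F k"
proof -
  have step: "\<exists>w\<in>G. \<forall>m\<in>{0<..M k}. pow w m \<notin> F" if F: "finite F" "submonoid_H F" for F k
  proof (rule ccontr)
    assume "\<not> ?thesis"
    then have "G \<subseteq> (\<Union>m\<in>{0<..M k}. {h \<in> H. pow h m \<in> F})"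
      using G(2) by blast
    moreover have "finite (\<Union>m\<in>{0<..M k}. {h \<in> H. pow h m \<in> F})"
    proof (intro finite_UN_I)
      fix m assume "m \<in> {0<..M k}"
      then show "finite {h \<in> H. pow h m \<in> F}"
        using F(1) submonoid_HD(1)[OF F(2)] by (intro finite_roots[OF fin]) auto
    qed simp
    ultimately show False
      using G(1) finite_subset by blast
  qed
  \<comment> \<open>The last clause is how the dependent choice remembers its starting
    value.\<close>
  define P where "P k p \<longleftrightarrow> finite (fst p) \<and> submonoid_H (fst p) \<and> snd p \<in> G \<and>
    (\<forall>m\<in>{0<..M k}. pow (snd p) m \<notin> fst p) \<and> (k = 0 \<longrightarrow> fst p = {e})" for k :: nat and p
  define Q where "Q p q \<longleftrightarrow> fst q = adjoin (fst p) (snd p)" for p q :: "'a set \<times> 'a"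
  have "\<exists>f. \<forall>k. P k (f k) \<and> Q (f k) (f (Suc k))"
  proof (rule dependent_nat_choice)
    have "submonoid_H {e}"
      by (simp add: submonoid_H_def)
    then obtain w where "w \<in> G" "\<forall>m\<in>{0<..M 0}. pow w m \<notin> {e}"
      using step[of "{e}" 0] by auto
    then show "\<exists>p. P 0 p"
      using \<open>submonoid_H {e}\<close> by (intro exI[of _ "({e}, w)"]) (auto simp: P_def)
  next
    fix p k assume p: "P k p"
    define F' where "F' = adjoin (fst p) (snd p)"
    have F': "finite F'" "submonoid_H F'"
      using p G(2) finite_adjoin[of "fst p" "snd p"] submonoid_H_adjoin(1)[of "fst p" "snd p"]
      by (auto simp: P_def F'_def dest: submonoid_HD(1))
    then obtain w where "w \<in> G" "\<forall>m\<in>{0<..M (Suc k)}. pow w m \<notin> F'"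
      using step[of F' "Suc k"] by auto
    then show "\<exists>q. P (Suc k) q \<and> Q p q"
      using F' by (intro exI[of _ "(F', w)"]) (auto simp: P_def Q_def F'_def)
  qed
  then obtain f where f: "\<And>k. P k (f k)" "\<And>k. Q (f k) (f (Suc k))"
    by blast
  show thesis
    by (rule that[of "\<lambda>k. fst (f k)" "\<lambda>k. snd (f k)"]) (use f in \<open>auto simp: P_def Q_def\<close>)
qed

end

end

section \<open>Points at infinity when all root sets are finite\<close>

context unipotent_semigroup
begin

context
  assumes per: periodic
begin

text \<open>The limit of \<open>\<V>\<close> behaves like a zero of the group \<open>K\<close>
  generated by the \<open>w k\<close>: it absorbs \<open>K\<close> and is idempotent. Its filter is
  free because \<open>V j\<close> misses \<open>F j\<close>; this needs the powers of
  \<open>w k\<close> up to \<open>2 ^ k\<close> to avoid \<open>F k\<close>, which finite root sets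
  make possible.\<close>

lemma ex_root_set_infinite:
  fixes C :: "'b topsemigroup set"
  assumes C: "X \<lesssim> (UNIV :: 'b set)" "TzS \<subseteq> C" "injectively_closed C X mult"
    and inf: "infinite H"
  shows "\<exists>n>0. infinite {h \<in> H. pow h n = e}"
proof (rule ccontr)
  assume "\<not> ?thesis"
  then have fin: "finite {h \<in> H. pow h m = e}" if "m > 0" for m
    using that by blast
  obtain F w where F0: "F 0 = {e}" and FS: "\<And>k. F (Suc k) = adjoin (F k) (w k)"
    and Fsub: "\<And>k. submonoid_H (F k)" and wH: "\<And>k. w k \<in> H"
    and wF: "\<And>k m. 0 < m \<Longrightarrow> m \<le> 2 ^ k \<Longrightarrow> pow (w k) m \<notin> F k"
    by (rule independent_sequence[OF per inf order_refl fin, of "\<lambda>k. 2 ^ k"], assumption) (rule that)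
  have F_mono: "F k \<subseteq> F l" if "k \<le> l" for k l
    using that
  proof (induction rule: dec_induct)
    case (step l)
    then show ?case using submonoid_H_adjoin(2)[OF per Fsub wH, of l l] by (auto simp: FS)
  qed simp
  have wFS: "w k \<in> F (Suc k)" for k
    using submonoid_H_adjoin(3)[OF per Fsub wH] by (simp add: FS)
  define K where "K = (\<Union>k. F k)"
  have K: "submonoid_H K"
    unfolding submonoid_H_def
  proof (intro conjI ballI)
    show "K \<subseteq> H" "e \<in> K"
      using Fsub submonoid_HD by (auto simp: K_def)
    fix a b assume "a \<in> K" "b \<in> K"
    then obtain k l where "a \<in> F k" "b \<in> F l"
      by (auto simp: K_def)
    then have "a \<in> F (max k l)" "b \<in> F (max k l)"
      using F_mono[of k "max k l"] F_mono[of l "max k l"] by auto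
    then have "a \<cdot> b \<in> F (max k l)"
      using submonoid_HD(3)[OF Fsub] by blast
    then show "a \<cdot> b \<in> K"
      by (auto simp: K_def)
  qed
  note KH = submonoid_HD(1)[OF K]
  \<comment> \<open>The bound on \<open>c\<close> halves from \<open>V j\<close> to \<open>V (Suc j)\<close>, so that \<open>V (Suc j)\<close> times itself lies in \<open>V j\<close>.\<close>
  define V where "V j = {f \<cdot> pow (w k) c |f k c. j \<le> k \<and> f \<in> F k \<and> 0 < c \<and> c * 2 ^ j \<le> 2 ^ k}" for j
  have VI: "f \<cdot> pow (w k) c \<in> V j" if "j \<le> k" "f \<in> F k" "0 < c" "c * 2 ^ j \<le> 2 ^ k" for f k c j
    using that unfolding V_def by blast
  have VE: thesis if "v \<in> V j" "\<And>f k c. \<lbrakk>v = f \<cdot> pow (w k) c; j \<le> k; f \<in> F k; 0 < c; c * 2 ^ j \<le> 2 ^ k\<rbrakk> \<Longrightarrow> thesis"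
    for v j thesis
    using that unfolding V_def by blast
  have V_mono: "V j \<subseteq> V i" if "i \<le> j" for i j
  proof
    fix v assume "v \<in> V j"
    then show "v \<in> V i"
    proof (rule VE)
      fix f k c assume *: "v = f \<cdot> pow (w k) c" "j \<le> k" "f \<in> F k" "0 < c" "c * 2 ^ j \<le> (2::nat) ^ k"
      have "c * 2 ^ i \<le> c * 2 ^ j"
        using that by (intro mult_left_mono power_increasing) auto
      then have "c * 2 ^ i \<le> 2 ^ k"
        using *(5) by (rule le_trans)
      then show "v \<in> V i"
        unfolding *(1) using * that by (intro VI) auto
    qed
  qed
  have V_K: "V j \<subseteq> K" for j
  proof
    fix v assume "v \<in> V j"
    then show "v \<in> K"
    proof (rule VE)
      fix f k c assume *: "v = f \<cdot> pow (w k) c" "f \<in> F k"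
      have "f \<in> F (Suc k)" "pow (w k) c \<in> F (Suc k)"
        using * F_mono[of k "Suc k"] submonoid_H_pow[OF Fsub wFS] by auto
      then show "v \<in> K"
        using submonoid_HD(3)[OF Fsub] * by (auto simp: K_def)
    qed
  qed
  have V_H: "v \<in> H" if "v \<in> V j" for v j
    using V_K that KH by blast
  have V_F: "v \<notin> F j" if "v \<in> V j" for v j
  proof
    assume v: "v \<in> F j"
    show False
    proof (rule VE[OF that])
      fix f k c assume *: "v = f \<cdot> pow (w k) c" "j \<le> k" "f \<in> F k" "0 < c" "c * 2 ^ j \<le> (2::nat) ^ k"
      have "f \<cdot> pow (w k) c \<in> F k"
        using v * F_mono by blast
      then have "pow (w k) c \<in> F k"
        using submonoid_H_divide[OF per Fsub *(3)] wH by blast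
      moreover have "c \<le> 2 ^ k"
        using *(5) by (metis le_trans mult.right_neutral mult_le_mono2 one_le_numeral one_le_power)
      ultimately show False
        using wF *(4) by blast
    qed
  qed
  have V_mult: "u \<cdot> v \<in> V j" if uv: "u \<in> V (Suc j)" "v \<in> V (Suc j)" for u v j
  proof -
    obtain f k c where u: "u = f \<cdot> pow (w k) c" "Suc j \<le> k" "f \<in> F k" "0 < c" "c * 2 ^ Suc j \<le> (2::nat) ^ k"
      by (rule VE[OF uv(1)])
    obtain g l d where v: "v = g \<cdot> pow (w l) d" "Suc j \<le> l" "g \<in> F l" "0 < d" "d * 2 ^ Suc j \<le> (2::nat) ^ l"
      by (rule VE[OF uv(2)])
    have fg: "f \<in> H" "g \<in> H"
      using u(3) v(3) submonoid_HD(1)[OF Fsub] by auto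
    \<comment> \<open>The factor with the smaller index is swallowed by \<open>F l\<close> and
      leaves the exponent of \<open>w l\<close> untouched. Only for equal indices do exponents add,
      and then each is at most half of what \<open>V j\<close> allows.\<close>
    have less: "f \<cdot> pow (w k) c \<cdot> (g \<cdot> pow (w l) d) \<in> V j"
      if "k < l" "f \<in> F k" "g \<in> F l" "0 < d" "d * 2 ^ Suc j \<le> (2::nat) ^ l" "Suc j \<le> l" for f g k l c d
    proof -
      have "f \<in> F l" "w k \<in> F l"
        using that(1,2) F_mono[of k l] F_mono[of "Suc k" l] wFS by auto
      then have "f \<cdot> pow (w k) c \<cdot> g \<in> F l"
        using that(3) submonoid_HD(3)[OF Fsub] submonoid_H_pow[OF Fsub] by blast
      then have "f \<cdot> pow (w k) c \<cdot> g \<cdot> pow (w l) d \<in> V j"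
        using that by (intro VI) auto
      moreover have "f \<in> H" "g \<in> H"
        using that submonoid_HD(1)[OF Fsub] by auto
      ultimately show ?thesis
        using wH by (simp add: assoc)
    qed
    consider "k < l" | "l < k" | "k = l" by linarith
    then show ?thesis
    proof cases
      case 1
      then show ?thesis
        using less[of k l f g d c] u v by simp
    next
      case 2
      then have "v \<cdot> u \<in> V j"
        using less[of l k g f c d] u v by simp
      then show ?thesis
        using comm[of u v] V_H uv by simp
    next
      case 3
      have "u \<cdot> v = (f \<cdot> g) \<cdot> pow (w k) (c + d)"
        using u(1,4) v(1,4) 3 fg wH left_comm[of g "pow (w k) c" "pow (w k) d"]
        by (simp add: assoc pow_add)
      moreover have "f \<cdot> g \<in> F k"
        using u(3) v(3) 3 submonoid_HD(3)[OF Fsub] by simp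
      ultimately show ?thesis
        using u v 3 by (auto intro!: VI simp: algebra_simps)
    qed
  qed
  \<comment> \<open>A fixed \<open>t\<close> in \<open>F j\<close> multiplies every later
    \<open>F k\<close> into itself, so it changes only the coefficient \<open>f\<close>.\<close>
  have V_absorb: "\<exists>j. \<forall>i\<ge>j. \<forall>v\<in>V i. t \<cdot> v \<in> V i" if "t \<in> K" for t
  proof -
    obtain j where j: "t \<in> F j"
      using \<open>t \<in> K\<close> by (auto simp: K_def)
    have "t \<cdot> v \<in> V i" if "i \<ge> j" "v \<in> V i" for i v
    proof (rule VE[OF that(2)])
      fix f k c assume *: "v = f \<cdot> pow (w k) c" "i \<le> k" "f \<in> F k" "0 < c" "c * 2 ^ i \<le> (2::nat) ^ k"
      have "t \<in> F k"
        using j that(1) *(2) F_mono[of j k] by auto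
      then have "t \<cdot> f \<in> F k"
        using *(3) submonoid_HD(3)[OF Fsub] by blast
      then have "t \<cdot> f \<cdot> pow (w k) c \<in> V i"
        using * by (intro VI) auto
      moreover have "t \<in> H" "f \<in> H"
        using \<open>t \<in> F k\<close> *(3) submonoid_HD(1)[OF Fsub] by auto
      ultimately show "t \<cdot> v \<in> V i"
        using * wH by (simp add: assoc)
    qed
    then show ?thesis by blast
  qed
  define \<V> where "\<V> = (INF j. principal (V j))"
  have ev: "eventually P \<V> \<longleftrightarrow> (\<exists>j. \<forall>v\<in>V j. P v)" for P
    unfolding \<V>_def
  proof (subst eventually_INF_base)
    show "\<exists>x\<in>UNIV. principal (V x) \<le> inf (principal (V a)) (principal (V b))" for a b
      using V_mono[of a "max a b"] V_mono[of b "max a b"] by (intro bexI[of _ "max a b"]) auto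
  qed (auto simp: eventually_principal)
  have evV: "eventually (\<lambda>v. v \<in> V j) \<V>" for j
    unfolding ev by blast
  have nb: "\<V> \<noteq> bot"
  proof -
    have "e \<cdot> pow (w j) 1 \<in> V j" for j
      using submonoid_HD(2)[OF Fsub] by (intro VI) auto
    then show ?thesis
      unfolding trivial_limit_def ev by blast
  qed
  have absorb: "filterlim (\<lambda>v. t \<cdot> v) \<V> \<V>" if t: "t \<in> K" for t
  proof -
    obtain j where j: "\<And>i v. i \<ge> j \<Longrightarrow> v \<in> V i \<Longrightarrow> t \<cdot> v \<in> V i"
      using V_absorb[OF t] by blast
    show ?thesis
      unfolding filterlim_iff
    proof (intro allI impI)
      fix P assume "eventually P \<V>"
      then obtain i where "\<And>v. v \<in> V i \<Longrightarrow> P v"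
        unfolding ev by blast
      then have "P (t \<cdot> v)" if "v \<in> V (max i j)" for v
        using j[of "max i j" v] V_mono[of i "max i j"] that by auto
      then show "eventually (\<lambda>v. P (t \<cdot> v)) \<V>"
        unfolding ev by blast
    qed
  qed
  define \<phi> where "\<phi> h = filtermap ((\<cdot>) h) \<V>" for h
  have \<phi>_le: "\<phi> (h \<cdot> t) \<le> \<phi> h" if "h \<in> H" "t \<in> K" for h t
  proof -
    have "filterlim (\<lambda>v. h \<cdot> (t \<cdot> v)) (\<phi> h) \<V>"
      unfolding \<phi>_def by (rule filterlim_compose[OF _ absorb[OF that(2)]]) (simp add: filterlim_def)
    moreover have "eventually (\<lambda>v. h \<cdot> (t \<cdot> v) = h \<cdot> t \<cdot> v) \<V>"
      using evV[of 0] by eventually_elim (use that KH V_H in \<open>simp add: assoc\<close>)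
    ultimately have "filterlim (\<lambda>v. h \<cdot> t \<cdot> v) (\<phi> h) \<V>"
      by (simp add: filterlim_cong[OF refl refl])
    then show ?thesis
      by (simp add: filterlim_def \<phi>_def)
  qed
  have \<phi>_eq: "\<phi> (h \<cdot> t) = \<phi> h" if h: "h \<in> H" and t: "t \<in> K" for h t
  proof (rule antisym[OF \<phi>_le[OF that]])
    obtain t' where t': "t' \<in> K" "t \<cdot> t' = e"
      using submonoid_H_inverse[OF per K t] by blast
    have "h \<cdot> t \<cdot> t' = h"
      using h t t' KH by (simp add: assoc)
    then show "\<phi> h \<le> \<phi> (h \<cdot> t)"
      using \<phi>_le[of "h \<cdot> t" t'] h t t' KH by simp
  qed
  have coset: "\<exists>t\<in>K. h' = h \<cdot> t" if h: "h \<in> H" "h' \<in> H" and v: "v \<in> K" "v' \<in> K" "h \<cdot> v = h' \<cdot> v'" for h h' v v'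
  proof -
    obtain u where u: "u \<in> K" "v' \<cdot> u = e"
      using submonoid_H_inverse[OF per K v(2)] by blast
    have "h' = h' \<cdot> v' \<cdot> u"
      using u h v KH by (simp add: assoc)
    also have "\<dots> = h \<cdot> (v \<cdot> u)"
      using u h v(1) KH by (simp add: v(3)[symmetric] assoc)
    finally show ?thesis
      using submonoid_HD(3)[OF K] u v by blast
  qed
  have "\<phi> ` H = {}"
  proof (rule discrete_filter_extension[OF C])
    show "\<phi> ` H \<lesssim> X"
      by (rule lepoll_trans[OF image_lepoll subset_imp_lepoll[OF H_subset]])
    show "G \<noteq> bot" if "G \<in> \<phi> ` H" for G
      using that nb by (elim imageE) (simp add: \<phi>_def filtermap_bot_iff)
    show "eventually (\<lambda>x. x \<in> X) G" if "G \<in> \<phi> ` H" for G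
      using that
    proof (elim imageE)
      fix h assume h: "G = \<phi> h" "h \<in> H"
      show ?thesis
        unfolding h(1) \<phi>_def eventually_filtermap using evV[of 0] by eventually_elim (use V_H h in auto)
    qed
    show "eventually (\<lambda>x. x \<noteq> u) G" if "G \<in> \<phi> ` H" for G u
      using that
    proof (elim imageE)
      fix h assume h: "G = \<phi> h" "h \<in> H"
      have "\<exists>j. \<forall>v\<in>V j. h \<cdot> v \<noteq> u"
      proof (cases "\<exists>t\<in>K. u = h \<cdot> t")
        case True
        then obtain t j where t: "t \<in> F j" "u = h \<cdot> t" "t \<in> K"
          by (auto simp: K_def)
        then have "h \<cdot> v \<noteq> u" if "v \<in> V j" for v
          using H_cancel[OF per h(2), of v t] V_H V_F that KH by metis
        then show ?thesis by blast
      next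
        case False
        then show ?thesis using V_K by (metis subsetD)
      qed
      then show ?thesis
        unfolding h(1) \<phi>_def eventually_filtermap ev .
    qed
    have sep: "h \<cdot> v \<noteq> h' \<cdot> v'" if "h \<in> H" "h' \<in> H" "\<phi> h \<noteq> \<phi> h'" "v \<in> V i" "v' \<in> V j" for h h' v v' i j
      using coset[OF that(1,2), of v v'] \<phi>_eq that V_K by (metis subsetD)
    show "inf G G' = bot" if G: "G \<in> \<phi> ` H" "G' \<in> \<phi> ` H" "G \<noteq> G'" for G G'
    proof -
      obtain h h' where h: "h \<in> H" "G = \<phi> h" "h' \<in> H" "G' = \<phi> h'"
        using G by blast
      show ?thesis
      proof (rule inf_filter_botI)
        show "eventually (\<lambda>x. x \<in> (\<cdot>) h ` V 0) G" "eventually (\<lambda>x. x \<in> (\<cdot>) h' ` V 0) G'"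
          unfolding h \<phi>_def eventually_filtermap ev by blast+
      qed (use sep[OF h(1,3)] G(3) h in blast)
    qed
    show "\<exists>Q. eventually Q G \<and> (\<forall>x. Q x \<longrightarrow> P x) \<and> (\<forall>G'\<in>\<phi> ` H. eventually Q G' \<or> eventually (\<lambda>x. \<not> Q x) G')"
      if G: "G \<in> \<phi> ` H" "eventually P G" for G P
    proof -
      obtain h where h: "h \<in> H" "G = \<phi> h"
        using G(1) by blast
      obtain j where j: "\<And>v. v \<in> V j \<Longrightarrow> P (h \<cdot> v)"
        using G(2) unfolding h(2) \<phi>_def eventually_filtermap ev by blast
      define Q where "Q x \<longleftrightarrow> x \<in> (\<cdot>) h ` V j" for x
      have Q: "eventually Q (\<phi> h)"
        unfolding \<phi>_def eventually_filtermap ev Q_def by blast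
      have "eventually Q (\<phi> h') \<or> eventually (\<lambda>x. \<not> Q x) (\<phi> h')" if h': "h' \<in> H" for h'
      proof (cases "\<phi> h = \<phi> h'")
        case False
        have "eventually (\<lambda>x. \<not> Q x) (\<phi> h')"
          unfolding \<phi>_def eventually_filtermap ev Q_def using sep[OF h(1) h' False, symmetric]
          by (intro exI[of _ 0]) auto
        then show ?thesis ..
      qed (use Q in simp)
      then show ?thesis
        using Q j h(2) by (intro exI[of _ Q]) (auto simp: Q_def)
    qed
    show "\<exists>K\<in>(\<lambda>x. principal {x}) ` X \<union> \<phi> ` H. filterlim ((\<cdot>) u) K G" if u: "u \<in> X" and G: "G \<in> \<phi> ` H" for u G
    proof -
      obtain h where h: "h \<in> H" "G = \<phi> h"
        using G by blast
      have "eventually (\<lambda>v. u \<cdot> (h \<cdot> v) = u \<cdot> h \<cdot> v) \<V>"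
        using evV[of 0] by eventually_elim (use u h V_H in \<open>simp add: assoc\<close>)
      then have "filterlim ((\<cdot>) u) (\<phi> (u \<cdot> h)) G"
        unfolding h(2) \<phi>_def filterlim_filtermap by (rule filterlim_filtermap_cong)
      then show ?thesis
        using H_ideal[OF u h(1)] by blast
    qed
    show "\<exists>K\<in>(\<lambda>x. principal {x}) ` X \<union> \<phi> ` H. filterlim (\<lambda>(x, y). x \<cdot> y) K (G \<times>\<^sub>F G')"
      if G: "G \<in> \<phi> ` H" "G' \<in> \<phi> ` H" for G G'
    proof -
      obtain h h' where h: "h \<in> H" "G = \<phi> h" "h' \<in> H" "G' = \<phi> h'"
        using G by blast
      have "filterlim (\<lambda>(x, y). x \<cdot> y) (\<phi> (h \<cdot> h')) (G \<times>\<^sub>F G')"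
        unfolding h(2,4) \<phi>_def filterlim_prod_filtermap_iff
        unfolding filterlim_prod_iff eventually_filtermap
      proof (intro allI impI)
        fix P assume "eventually (\<lambda>v. P (h \<cdot> h' \<cdot> v)) \<V>"
        then obtain j where j: "\<And>v. v \<in> V j \<Longrightarrow> P (h \<cdot> h' \<cdot> v)"
          unfolding ev by blast
        have "P (h \<cdot> u \<cdot> (h' \<cdot> v))" if uv: "u \<in> V (Suc j)" "v \<in> V (Suc j)" for u v
        proof -
          have "h \<cdot> u \<cdot> (h' \<cdot> v) = h \<cdot> h' \<cdot> (u \<cdot> v)"
            using h V_H[OF uv(1)] V_H[OF uv(2)] left_comm[of h' u v] by (simp add: assoc)
          then show ?thesis
            using j[OF V_mult[OF uv]] by simp
        qed
        then show "\<exists>R S. eventually R \<V> \<and> eventually S \<V> \<and> (\<forall>u v. R u \<longrightarrow> S v \<longrightarrow> P (h \<cdot> u \<cdot> (h' \<cdot> v)))"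
          using evV[of "Suc j"] by (intro exI[of _ "\<lambda>v. v \<in> V (Suc j)"]) auto
      qed
      then show ?thesis
        using h by blast
    qed
  qed
  then show False
    using e_in_H by blast
qed

end

end

section \<open>A non-complete linear topology when some root set is infinite\<close>

context unipotent_semigroup
begin

context
  assumes per: periodic
begin

text \<open>For the least \<open>n\<close> with infinitely many roots, the exponents below
  \<open>n\<close> can be kept out of \<open>F k\<close>. So \<open>w k\<close> has order
  \<open>n\<close>, and its powers other than \<open>e\<close> avoid \<open>F k\<close>: the
  \<open>w k\<close> generate a direct sum of cyclic groups, whose tails serve as neighbourhoods of
  \<open>e\<close>.\<close>

lemma root_set_finite:
  fixes C :: "'b topsemigroup set"
  assumes C: "X \<lesssim> (UNIV :: 'b set)" "TzS \<subseteq> C" "injectively_closed C X mult"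
    and n: "n > 0"
  shows "finite {h \<in> H. pow h n = e}"
  using n
proof (induction n rule: less_induct)
  case (less n)
  show ?case
  proof (rule ccontr)
    assume inf: "infinite {h \<in> H. pow h n = e}"
    have "n \<noteq> 1"
    proof
      assume "n = 1"
      then have "{h \<in> H. pow h n = e} \<subseteq> {e}"
        by auto
      then show False
        using inf finite_subset by blast
    qed
    then have n: "n > 1"
      using less.prems by simp
    have fin: "finite {h \<in> H. pow h m = e}" if "0 < m" "m \<le> n - 1" for m
      using less.IH[of m] that n by simp
    obtain F w where F0: "F 0 = {e}" and FS: "\<And>k. F (Suc k) = adjoin (F k) (w k)"
      and Fsub: "\<And>k. submonoid_H (F k)" and wn: "\<And>k. w k \<in> {h \<in> H. pow h n = e}"
      and wF: "\<And>k m. 0 < m \<Longrightarrow> m \<le> n - 1 \<Longrightarrow> pow (w k) m \<notin> F k"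
      by (rule independent_sequence[OF per inf _ fin, of "\<lambda>k. n - 1"], blast, assumption, assumption) (rule that)
    have wH: "w k \<in> H" "pow (w k) n = e" for k
      using wn[of k] by auto
    \<comment> \<open>Reduction of the exponent modulo \<open>n\<close>: a remainder strictly
      between 0 and \<open>n\<close> is excluded by \<open>wF\<close>.\<close>
    have w_pow: "pow (w k) c = e" if c: "c > 0" "pow (w k) c \<in> F k" for k c
      using c
    proof (induction c rule: less_induct)
      case (less c)
      consider "c < n" | "c = n" | "c > n" by linarith
      then show ?case
      proof cases
        case 1
        then have "c \<le> n - 1" by simp
        then show ?thesis using wF[of c k] less.prems by blast
      next
        case 3
        then have "pow (w k) c = pow (w k) (c - n)"
          using pow_add[of "w k" n "c - n"] n wH by simp
        then show ?thesis
          using less.IH[of "c - n"] less.prems 3 n by simp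
      qed (use wH in simp)
    qed
    \<comment> \<open>\<open>L k\<close> is the subgroup generated by all \<open>w l\<close> with \<open>l \<ge> k\<close>; these subgroups intersect in \<open>e\<close>.\<close>
    define L0 where "L0 k d = rec_nat {e} (\<lambda>d S. adjoin S (w (k + d))) d" for k d
    have L0_0: "L0 k 0 = {e}" and L0_Suc: "L0 k (Suc d) = adjoin (L0 k d) (w (k + d))" for k d
      by (simp_all add: L0_def)
    have L0_sub: "submonoid_H (L0 k d)" for k d
      by (induction d) (use submonoid_H_adjoin(1)[OF per] wH in \<open>auto simp: L0_0 L0_Suc submonoid_H_def\<close>)
    have L0_mono: "L0 k d \<subseteq> L0 k d'" if "d \<le> d'" for k d d'
      using that
    proof (induction rule: dec_induct)
      case (step d')
      show ?case
        using subset_trans[OF step.IH submonoid_H_adjoin(2)[OF per L0_sub wH(1)]] unfolding L0_Suc .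
    qed simp
    have adjoin_mono: "adjoin S u \<subseteq> adjoin S' u" if "S \<subseteq> S'" for S S' u
      using that by (auto simp: adjoin_def)
    have F_eq: "F d = L0 0 d" for d
      by (induction d) (simp_all add: F0 FS L0_0 L0_Suc)
    have L0_F: "L0 k d \<subseteq> F (k + d)" for k d
    proof (induction d)
      case 0
      then show ?case using submonoid_HD(2)[OF Fsub] by (simp add: L0_0)
    next
      case (Suc d)
      then show ?case using adjoin_mono[OF Suc.IH] by (simp add: L0_Suc FS)
    qed
    have F_mono: "F k \<subseteq> F l" if "k \<le> l" for k l
      using L0_mono[OF that] by (simp add: F_eq)
    \<comment> \<open>Strip the last generator: its power is a quotient of two elements of
      \<open>F (k + d)\<close>, hence \<open>e\<close> by \<open>w_pow\<close>.\<close>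
    have disjoint: "x = e" if "x \<in> F k" "x \<in> L0 k d" for x k d
      using that
    proof (induction d arbitrary: x)
      case (Suc d)
      then obtain p c where p: "p \<in> L0 k d" "c > 0" "x = p \<cdot> pow (w (k + d)) c"
        by (auto simp: L0_Suc adjoin_def)
      have "p \<in> F (k + d)" "x \<in> F (k + d)"
        using p(1) L0_F Suc.prems(1) F_mono[of k "k + d"] by auto
      then have "pow (w (k + d)) c \<in> F (k + d)"
        using submonoid_H_divide[OF per Fsub] p(3) wH by blast
      then have "pow (w (k + d)) c = e"
        using w_pow p(2) by blast
      then have "x = p"
        using p submonoid_HD(1)[OF L0_sub] by simp
      then show ?case
        using Suc p(1) by simp
    qed (simp add: L0_0)
    have L0_shift: "L0 (Suc k) d \<subseteq> L0 k (Suc d)" for k d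
    proof (induction d)
      case 0
      then show ?case using submonoid_HD(2)[OF L0_sub] by (auto simp: L0_0)
    next
      case (Suc d)
      then show ?case using adjoin_mono[OF Suc.IH] by (simp add: L0_Suc)
    qed
    define L where "L k = (\<Union>d. L0 k d)" for k
    have L: "submonoid_H (L k)" for k
      unfolding submonoid_H_def
    proof (intro conjI ballI)
      show "L k \<subseteq> H" "e \<in> L k"
        using L0_sub submonoid_HD by (auto simp: L_def)
      fix a b assume "a \<in> L k" "b \<in> L k"
      then obtain i j where "a \<in> L0 k i" "b \<in> L0 k j"
        by (auto simp: L_def)
      then have "a \<in> L0 k (max i j)" "b \<in> L0 k (max i j)"
        using L0_mono[of i "max i j"] L0_mono[of j "max i j"] by auto
      then have "a \<cdot> b \<in> L0 k (max i j)"
        using submonoid_HD(3)[OF L0_sub] by blast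
      then show "a \<cdot> b \<in> L k"
        by (auto simp: L_def)
    qed
    note LH = submonoid_HD(1)[OF L] and eL = submonoid_HD(2)[OF L] and L_mult = submonoid_HD(3)[OF L]
    have L_Suc: "L (Suc k) \<subseteq> L k" for k
      using L0_shift by (fastforce simp: L_def)
    then have L_mono: "L l \<subseteq> L k" if "k \<le> l" for k l
      using that by (rule lift_Suc_antimono_le)
    have L_disjoint: "x = e" if "x \<in> F k" "x \<in> L k" for x k
      using that disjoint by (auto simp: L_def)
    have wL: "w k \<in> L k" for k
    proof -
      have "w k \<in> L0 k (Suc 0)"
        using submonoid_H_adjoin(3)[OF per L0_sub[of k 0] wH(1)[of k]] by (simp add: L0_Suc)
      then show ?thesis
        unfolding L_def by blast
    qed
    have L_ex_F: "\<exists>k. x \<in> F k" if "x \<in> L 0" for x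
      using that by (auto simp: L_def F_eq)
    \<comment> \<open>A coherent sequence \<open>a\<close> represents the limit of the nested cosets \<open>a k L k\<close>.\<close>
    define cs where "cs a k = (\<cdot>) (a k) ` L k" for a :: "nat \<Rightarrow> 'a" and k
    define coh where "coh a \<longleftrightarrow> (\<forall>k. a k \<in> H) \<and> (\<forall>k. a (Suc k) \<in> cs a k)" for a
    have cs_eq: "(\<cdot>) a ` L k = (\<cdot>) b ` L k"
      if ab: "a \<in> H" "b \<in> H" and x: "x \<in> (\<cdot>) a ` L k" "x \<in> (\<cdot>) b ` L k" for a b x k
    proof -
      have sub: "(\<cdot>) a ` L k \<subseteq> (\<cdot>) b ` L k"
        if ab: "a \<in> H" "b \<in> H" and l: "l \<in> L k" "l' \<in> L k" "a \<cdot> l = b \<cdot> l'" for a b l l'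
      proof
        fix y assume "y \<in> (\<cdot>) a ` L k"
        then obtain l1 where l1: "l1 \<in> L k" "y = a \<cdot> l1" by blast
        obtain u where u: "u \<in> L k" "l \<cdot> u = e"
          using submonoid_H_inverse[OF per L l(1)] by blast
        have "a \<cdot> l \<cdot> u = a"
          using u ab(1) l(1) LH by (simp add: assoc)
        then have "y = a \<cdot> l \<cdot> u \<cdot> l1"
          using l1 by simp
        also have "\<dots> = b \<cdot> (l' \<cdot> u \<cdot> l1)"
          using u(1) ab l(1,2) l1(1) LH by (simp add: l(3) assoc)
        finally show "y \<in> (\<cdot>) b ` L k"
          using L_mult u(1) l(2) l1(1) by blast
      qed
      obtain l l' where l: "l \<in> L k" "l' \<in> L k" "x = a \<cdot> l" "x = b \<cdot> l'"
        using x by blast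
      show ?thesis
        using sub[of a b l l'] sub[of b a l' l] ab l by auto
    qed
    have cohD: "a k \<in> H" "a (Suc k) \<in> cs a k" if "coh a" for a k
      using that by (auto simp: coh_def)
    have cs_H: "cs a k \<subseteq> H" if "coh a" for a k
      using cohD[OF that] LH by (auto simp: cs_def)
    have cs_self: "a k \<in> cs a k" if "coh a" for a k
      using imageI[OF eL, of "(\<cdot>) (a k)" k] cohD(1)[OF that] by (simp add: cs_def)
    have cs_Suc: "cs a (Suc k) \<subseteq> cs a k" if a: "coh a" for a k
    proof -
      have "cs a (Suc k) \<subseteq> (\<cdot>) (a (Suc k)) ` L k"
        using L_Suc by (auto simp: cs_def)
      also have "\<dots> = cs a k"
      proof -
        have "a (Suc k) \<in> (\<cdot>) (a (Suc k)) ` L k"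
          using imageI[OF eL, of "(\<cdot>) (a (Suc k))" k] cohD(1)[OF a] by simp
        then show ?thesis
          using cs_eq[OF cohD(1)[OF a] cohD(1)[OF a]] cohD(2)[OF a, of k] unfolding cs_def by blast
      qed
      finally show ?thesis .
    qed
    have cs_mono: "cs a l \<subseteq> cs a k" if "coh a" "k \<le> l" for a k l
      using cs_Suc[OF that(1)] that(2) by (rule lift_Suc_antimono_le)
    have coh_const: "coh (\<lambda>_. h)" if "h \<in> H" for h
      using that imageI[OF eL, of "(\<cdot>) h"] by (simp add: coh_def cs_def)
    have cs_mult: "x \<cdot> y \<in> cs (\<lambda>k. a k \<cdot> b k) k"
      if ab: "coh a" "coh b" and xy: "x \<in> cs a k" "y \<in> cs b k" for a b x y k
    proof -
      obtain l l' where l: "l \<in> L k" "x = a k \<cdot> l" "l' \<in> L k" "y = b k \<cdot> l'"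
        using xy by (auto simp: cs_def)
      have "x \<cdot> y = (a k \<cdot> b k) \<cdot> (l \<cdot> l')"
        using l(2,4) LH[OF l(1)] LH[OF l(3)] cohD(1)[OF ab(1), of k] cohD(1)[OF ab(2), of k]
          left_comm[of "b k" l l'] by (simp add: assoc)
      then show ?thesis
        using L_mult l(1,3) by (auto simp: cs_def)
    qed
    have coh_mult: "coh (\<lambda>k. a k \<cdot> b k)" if "coh a" "coh b" for a b
      using cohD[OF that(1)] cohD[OF that(2)] cs_mult[OF that] by (simp add: coh_def)
    define \<phi> where "\<phi> a = (INF k. principal (cs a k))" for a
    have ev: "eventually P (\<phi> a) \<longleftrightarrow> (\<exists>k. \<forall>x\<in>cs a k. P x)" if a: "coh a" for P a
      unfolding \<phi>_def
    proof (subst eventually_INF_base)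
      show "\<exists>x\<in>UNIV. principal (cs a x) \<le> inf (principal (cs a i)) (principal (cs a j))" for i j
        using cs_mono[OF a, of i "max i j"] cs_mono[OF a, of j "max i j"] by (intro bexI[of _ "max i j"]) auto
    qed (auto simp: eventually_principal)
    have nb: "\<phi> a \<noteq> bot" if "coh a" for a
      using cs_self[OF that] unfolding trivial_limit_def ev[OF that] by blast
    have evH: "eventually (\<lambda>x. x \<in> H) (\<phi> a)" if "coh a" for a
      unfolding ev[OF that] using cs_H[OF that] by blast
    have cs_cases: "cs a k = cs b k \<or> cs a k \<inter> cs b k = {}" if "coh a" "coh b" for a b k
      using cs_eq[OF cohD(1)[OF that(1)] cohD(1)[OF that(2)]] unfolding cs_def by blast
    have \<phi>_eqD: "cs a k = cs b k" if ab: "coh a" "coh b" "\<phi> a = \<phi> b" for a b k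
    proof (rule ccontr)
      assume "cs a k \<noteq> cs b k"
      then have dis: "cs a k \<inter> cs b k = {}"
        using cs_cases[OF ab(1,2)] by blast
      have "eventually (\<lambda>x. x \<in> cs a k) (\<phi> a)"
        unfolding ev[OF ab(1)] by blast
      moreover have "eventually (\<lambda>x. x \<in> cs b k) (\<phi> a)"
        unfolding ab(3) ev[OF ab(2)] by blast
      ultimately have "\<exists>x. x \<in> cs a k \<and> x \<in> cs b k"
        by (intro eventually_happens'[OF nb[OF ab(1)]] eventually_conj)
      then show False
        using dis by blast
    qed
    have \<phi>_mult: "filterlim (\<lambda>(x, y). x \<cdot> y) (\<phi> (\<lambda>k. a k \<cdot> b k)) (\<phi> a \<times>\<^sub>F \<phi> b)" if ab: "coh a" "coh b" for a b
      unfolding filterlim_prod_iff ev[OF ab(1)] ev[OF ab(2)] ev[OF coh_mult[OF ab]]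
    proof (intro allI impI)
      fix P assume "\<exists>k. \<forall>x\<in>cs (\<lambda>k. a k \<cdot> b k) k. P x"
      then obtain k where "\<forall>x\<in>cs (\<lambda>k. a k \<cdot> b k) k. P x" ..
      then show "\<exists>R S. (\<exists>k. \<forall>x\<in>cs a k. R x) \<and> (\<exists>k. \<forall>x\<in>cs b k. S x) \<and> (\<forall>x y. R x \<longrightarrow> S y \<longrightarrow> P (x \<cdot> y))"
        using cs_mult[OF ab] by (intro exI[of _ "\<lambda>x. x \<in> cs a k"] exI[of _ "\<lambda>x. x \<in> cs b k"]) blast
    qed
    \<comment> \<open>On \<open>H\<close>, multiplication by \<open>x\<close> agrees with
      multiplication by \<open>e \<cdot> x\<close>, so every element of \<open>X\<close> acts on the
      limits like a constant sequence in \<open>H\<close>.\<close>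
    have \<phi>_mult1: "filterlim ((\<cdot>) x) (\<phi> (\<lambda>k. (e \<cdot> x) \<cdot> a k)) (\<phi> a)" if x: "x \<in> X" and a: "coh a" for x a
    proof -
      have ca: "coh (\<lambda>_. e \<cdot> x)"
        using coh_const x e_mult_in_H by blast
      have eq: "x \<cdot> y = (e \<cdot> x) \<cdot> y" if "y \<in> H" for y
      proof -
        have "x \<cdot> y = x \<cdot> (e \<cdot> y)"
          using that by simp
        then show ?thesis
          using x that comm[of e x] by (simp add: assoc)
      qed
      have "filterlim ((\<cdot>) (e \<cdot> x)) (\<phi> (\<lambda>k. (e \<cdot> x) \<cdot> a k)) (\<phi> a)"
        unfolding filterlim_iff ev[OF coh_mult[OF ca a]] ev[OF a]
        using cs_mult[OF ca a cs_self[OF ca]] by blast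
      moreover have "eventually (\<lambda>y. x \<cdot> y = (e \<cdot> x) \<cdot> y) (\<phi> a)"
        using evH[OF a] by eventually_elim (rule eq)
      ultimately show ?thesis
        by (simp add: filterlim_cong[OF refl refl])
    qed
    \<comment> \<open>The limit of \<open>s\<close> is new; only the points \<open>h s\<^sup>i\<close> are adjoined, the whole completion may be too large.\<close>
    define s where "s k = rec_nat e (\<lambda>k x. x \<cdot> w k) k" for k
    have s: "s 0 = e" "s (Suc k) = s k \<cdot> w k" for k
      by (simp_all add: s_def)
    have sF: "s k \<in> F k" for k
    proof (induction k)
      case (Suc k)
      then show ?case
        using submonoid_H_adjoin(2,3)[OF per Fsub wH(1)] submonoid_HD(3)[OF Fsub]
        unfolding s FS[symmetric] by (metis FS subsetD)
    qed (simp add: s F0)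
    have sH: "s k \<in> H" for k
      using submonoid_HD(1)[OF Fsub sF] .
    have coh_s: "coh s"
      using sH wL by (auto simp: coh_def cs_def s)
    \<comment> \<open>A limit \<open>h\<close> in \<open>H\<close> would lie in \<open>L 0\<close>,
      hence in some \<open>F k\<close>. From there on \<open>F l\<close> and \<open>L l\<close> meet
      only in \<open>e\<close>, which forces \<open>h = s l\<close>; so \<open>s\<close> would
      become constant and \<open>w k\<close> would be \<open>e\<close>.\<close>
    have s_new: "\<phi> s \<noteq> \<phi> (\<lambda>_. h)" if h: "h \<in> H" for h
    proof
      assume "\<phi> s = \<phi> (\<lambda>_. h)"
      then have eq: "cs s k = cs (\<lambda>_. h) k" for k
        using \<phi>_eqD[OF coh_s coh_const[OF h]] by blast
      have hs: "h \<in> cs s k" for k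
        using cs_self[OF coh_const[OF h], of k] eq by simp
      have "h \<in> L 0"
        using hs[of 0] LH by (auto simp: cs_def s)
      then obtain k where k: "h \<in> F k"
        using L_ex_F by blast
      have h_s: "h = s l" if l: "h \<in> F l" for l
      proof -
        obtain t where t: "t \<in> L l" "h = s l \<cdot> t"
          using hs[of l] by (auto simp: cs_def)
        have "t \<in> F l"
          using submonoid_H_divide[OF per Fsub sF] t l LH by blast
        then have "t = e"
          using L_disjoint t(1) by blast
        then show ?thesis
          using t(2) sH by simp
      qed
      have "s k = s (Suc k)"
        using h_s[OF k] h_s[of "Suc k"] k F_mono[of k "Suc k"] by auto
      then have "s k \<cdot> e = s k \<cdot> w k"
        using sH by (simp add: s)
      then have "w k = e"
        using H_cancel[OF per sH e_in_H wH(1)] by metis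
      then have "pow (w k) 1 \<in> F k"
        using submonoid_HD(2)[OF Fsub] by simp
      moreover have "1 \<le> n - 1"
        using n by simp
      ultimately show False
        using wF[OF zero_less_one] by blast
    qed
    \<comment> \<open>The sequence representing \<open>h\<close> times the \<open>i\<close>-th power
      of the limit of \<open>s\<close>. Iterating the translation, unlike \<open>pow\<close>, gives
      the exponent 0 its usual meaning.\<close>
    define b where "b h i = (\<lambda>k. ((\<cdot>) (s k) ^^ i) h)" for h i
    have b_coh: "coh (b h i)" if "h \<in> H" for h i
    proof (induction i)
      case 0
      then show ?case using coh_const[OF that] by (simp add: b_def)
    next
      case (Suc i)
      then show ?case using coh_mult[OF coh_s Suc.IH] by (simp add: b_def)
    qed
    have b_H: "b h i k \<in> H" if "h \<in> H" for h i k
      using cohD(1)[OF b_coh[OF that]] .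
    have b_mult: "b h i k \<cdot> b h' j k = b (h \<cdot> h') (i + j) k" if "h \<in> H" "h' \<in> H" for h h' i j k
    proof (induction i)
      case 0
      show ?case
      proof (induction j)
        case (Suc j)
        have "h \<cdot> (s k \<cdot> b h' j k) = s k \<cdot> (h \<cdot> b h' j k)"
          using that sH[of k] b_H[OF that(2)] by (intro left_comm) auto
        then show ?case using Suc.IH by (simp add: b_def)
      qed (simp add: b_def)
    next
      case (Suc i)
      have "s k \<cdot> b h i k \<cdot> b h' j k = s k \<cdot> (b h i k \<cdot> b h' j k)"
        using that sH[of k] b_H by (intro assoc) auto
      then show ?case using Suc.IH by (simp add: b_def)
    qed
    have \<phi>b_mult: "(\<lambda>k. b h i k \<cdot> b h' j k) = b (h \<cdot> h') (i + j)" if "h \<in> H" "h' \<in> H" for h h' i j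
      using b_mult[OF that] by blast
    have b_0: "b h 0 = (\<lambda>_. h)" for h
      by (simp add: b_def)
    have b_s: "b e 1 = s"
      using sH by (simp add: b_def fun_eq_iff)
    \<comment> \<open>Points outside \<open>H\<close> stay isolated, while \<open>H\<close> carries
      the linear topology: an element of \<open>H\<close> is represented by the filter of its
      shrinking cosets.\<close>
    define \<Y> where "\<Y> = (\<lambda>x. principal {x}) ` (X - H) \<union> (\<lambda>(h, i). \<phi> (b h i)) ` (H \<times> UNIV)"
    define N where "N x = (if x \<in> H then \<phi> (\<lambda>_. x) else principal {x})" for x
    have Y_cases: thesis if "G \<in> \<Y>" "\<And>x. x \<in> X \<Longrightarrow> x \<notin> H \<Longrightarrow> G = principal {x} \<Longrightarrow> thesis"
      "\<And>h i. h \<in> H \<Longrightarrow> G = \<phi> (b h i) \<Longrightarrow> thesis" for G thesis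
    proof -
      have "(\<exists>x\<in>X - H. G = principal {x}) \<or> (\<exists>h\<in>H. \<exists>i. G = \<phi> (b h i))"
        using that(1) by (auto simp: \<Y>_def)
      then show thesis
        using that(2,3) by blast
    qed
    have Y1: "principal {x} \<in> \<Y>" if "x \<in> X" "x \<notin> H" for x
      using that by (simp add: \<Y>_def)
    have Y2: "\<phi> (b h i) \<in> \<Y>" if "h \<in> H" for h i
      unfolding \<Y>_def using that by (intro UnI2 image_eqI[of _ _ "(h, i)"]) simp_all
    have NY: "N x \<in> \<Y>" if "x \<in> X" for x
      using Y1[of x] Y2[of x 0] that by (simp add: N_def b_0)
    have N_limit: "filterlim (\<lambda>(x, y). x \<cdot> y) (N (x \<cdot> y)) (principal {x} \<times>\<^sub>F principal {y})"
      if xy: "x \<in> X" "y \<in> X" for x y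
    proof (cases "x \<cdot> y \<in> H")
      case True
      then show ?thesis
        unfolding filterlim_prod_principal1 unfolding N_def filterlim_iff
        using cs_self[OF coh_const[OF True]] by (auto simp: eventually_principal ev[OF coh_const])
    next
      case False
      then show ?thesis
        using filterlim_prod_principals by (simp add: N_def)
    qed
    have comm_limit: "filterlim (\<lambda>y. y \<cdot> x) K G" if "filterlim ((\<cdot>) x) K G" "x \<in> X" "eventually (\<lambda>y. y \<in> X) G" for x K G
    proof -
      have "eventually (\<lambda>y. y \<cdot> x = x \<cdot> y) G"
        using that(3) by eventually_elim (use that(2) comm in blast)
      then show ?thesis
        using that(1) by (simp add: filterlim_cong[OF refl refl])
    qed
    have evX: "eventually (\<lambda>y. y \<in> X) (\<phi> a)" if "coh a" for a
      using evH[OF that] by eventually_elim auto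
    have supX: "eventually (\<lambda>y. y \<in> X) G" if "G \<in> \<Y>" for G
      by (rule Y_cases[OF that]) (use evX b_coh in \<open>auto simp: eventually_principal\<close>)
    have not_H: "eventually (\<lambda>y. y \<noteq> x) (\<phi> a)" if "x \<notin> H" "coh a" for x a
      using evH[OF that(2)] by eventually_elim (use that in auto)
    have "\<phi> s \<in> N ` X"
    proof (rule filter_extension[OF semigroup_on C])
      show "\<Y> \<lesssim> X"
      proof -
        define f where "f = (\<lambda>(x, i). case i of 0 \<Rightarrow> principal {x} | Suc i \<Rightarrow> \<phi> (b x i))"
        have "principal {x} \<in> f ` (X \<times> UNIV)" "\<phi> (b x i) \<in> f ` (X \<times> UNIV)" if "x \<in> X" for x i
          using that imageI[of "(x, 0)" "X \<times> UNIV" f] imageI[of "(x, Suc i)" "X \<times> UNIV" f] by (simp_all add: f_def)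
        then have sub: "\<Y> \<subseteq> insert bot (f ` (X \<times> UNIV))"
          by (auto simp: \<Y>_def)
        have "infinite X"
          using inf H_subset by (auto dest: finite_subset)
        then show ?thesis
          by (rule lepoll_trans[OF subset_imp_lepoll[OF sub] insert_image_times_nat_lepoll])
      qed
      show "G \<noteq> bot" if "G \<in> \<Y>" for G
        by (rule Y_cases[OF that]) (use nb b_coh in \<open>auto simp: principal_eq_bot_iff\<close>)
      show "eventually (\<lambda>x. x \<in> X) G" if "G \<in> \<Y>" for G
        using supX[OF that] .
      have pf: "inf (principal {x}) (\<phi> a) = bot" if "x \<notin> H" "coh a" for x a
        by (rule inf_filter_botI[of "\<lambda>v. v = x" _ "\<lambda>v. v \<noteq> x"])
          (use not_H[OF that] in \<open>simp_all add: eventually_principal\<close>)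
      have pp: "inf (principal {u}) (principal {v}) = bot" if "u \<noteq> v" for u v :: 'a
        using that by (simp add: principal_eq_bot_iff)
      have ff: "inf (\<phi> a) (\<phi> b) = bot" if ab: "coh a" "coh b" "\<phi> a \<noteq> \<phi> b" for a b
      proof -
        have "\<exists>k. cs a k \<noteq> cs b k"
          using ab(3) unfolding \<phi>_def by metis
        then obtain k where k: "cs a k \<inter> cs b k = {}"
          using cs_cases[OF ab(1,2)] by blast
        show ?thesis
        proof (rule inf_filter_botI)
          show "eventually (\<lambda>x. x \<in> cs a k) (\<phi> a)" "eventually (\<lambda>x. x \<in> cs b k) (\<phi> b)"
            unfolding ev[OF ab(1)] ev[OF ab(2)] by blast+
        qed (use k in blast)
      qed
      show "inf G K = bot" if GK: "G \<in> \<Y>" "K \<in> \<Y>" "G \<noteq> K" for G K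
      proof (rule Y_cases[OF GK(1)]; rule Y_cases[OF GK(2)])
        fix x h i assume "x \<in> X" "x \<notin> H" "K = principal {x}" "h \<in> H" "G = \<phi> (b h i)"
        then show ?thesis using pf b_coh by (metis inf_commute)
      next
        fix h i h' j assume *: "h \<in> H" "G = \<phi> (b h i)" "h' \<in> H" "K = \<phi> (b h' j)"
        then show ?thesis using ff[OF b_coh b_coh] GK(3) by simp
      qed (use GK(3) pp pf b_coh in auto)
      show "\<exists>Q. eventually Q G \<and> (\<forall>x. Q x \<longrightarrow> P x) \<and> (\<forall>K\<in>\<Y>. eventually Q K \<or> eventually (\<lambda>x. \<not> Q x) K)"
        if G: "G \<in> \<Y>" "eventually P G" for G P
      proof (rule Y_cases[OF G(1)])
        fix x assume x: "x \<in> X" "x \<notin> H" "G = principal {x}"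
        have "eventually (\<lambda>v. v = x) K \<or> eventually (\<lambda>v. v \<noteq> x) K" if "K \<in> \<Y>" for K
          by (rule Y_cases[OF that]) (use not_H[OF x(2)] b_coh in \<open>auto simp: eventually_principal\<close>)
        then show ?thesis
          using G(2) x by (intro exI[of _ "\<lambda>v. v = x"]) (auto simp: eventually_principal)
      next
        fix h i assume h: "h \<in> H" "G = \<phi> (b h i)"
        then obtain k where k: "\<forall>x\<in>cs (b h i) k. P x"
          using G(2) ev[OF b_coh] by auto
        have "eventually (\<lambda>v. v \<in> cs (b h i) k) K \<or> eventually (\<lambda>v. v \<notin> cs (b h i) k) K" if "K \<in> \<Y>" for K
        proof (rule Y_cases[OF that])
          fix h' j assume h': "h' \<in> H" "K = \<phi> (b h' j)"
          have "(\<forall>x\<in>cs (b h' j) k. x \<in> cs (b h i) k) \<or> (\<forall>x\<in>cs (b h' j) k. x \<notin> cs (b h i) k)"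
            using cs_cases[OF b_coh[OF h(1)] b_coh[OF h'(1)], of i k j] by blast
          then show ?thesis
            unfolding h'(2) ev[OF b_coh[OF h'(1)]] by blast
        qed (auto simp: eventually_principal)
        moreover have "eventually (\<lambda>v. v \<in> cs (b h i) k) G"
          unfolding h(2) ev[OF b_coh[OF h(1)]] by blast
        ultimately show ?thesis
          using k by (intro exI[of _ "\<lambda>v. v \<in> cs (b h i) k"]) auto
      qed
      show "\<exists>M\<in>\<Y>. filterlim (\<lambda>(x, y). x \<cdot> y) M (G \<times>\<^sub>F K)" if GK: "G \<in> \<Y>" "K \<in> \<Y>" for G K
      proof -
        have mixed: "\<exists>M\<in>\<Y>. filterlim ((\<cdot>) x) M (\<phi> (b h i))" if "x \<in> X" "h \<in> H" for x h i
        proof -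
          have "(\<lambda>k. (e \<cdot> x) \<cdot> b h i k) = b (e \<cdot> x \<cdot> h) i"
            using \<phi>b_mult[of "e \<cdot> x" h 0 i] e_mult_in_H[OF that(1)] that(2) by (simp add: b_0)
          then show ?thesis
            using \<phi>_mult1[OF that(1) b_coh[OF that(2)], of i] Y2[of "e \<cdot> x \<cdot> h" i] that e_mult_in_H by auto
        qed
        show ?thesis
        proof (rule Y_cases[OF GK(1)]; rule Y_cases[OF GK(2)])
          fix x y assume *: "x \<in> X" "G = principal {x}" "y \<in> X" "K = principal {y}"
          show ?thesis
            using N_limit[OF *(1,3)] NY[OF closed[OF *(1,3)]] unfolding *(2,4) by (rule bexI)
        next
          fix x h i assume *: "x \<in> X" "G = principal {x}" "h \<in> H" "K = \<phi> (b h i)"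
          show ?thesis
            unfolding *(2,4) filterlim_prod_principal1 by (rule mixed[OF *(1,3)])
        next
          fix x h i assume *: "h \<in> H" "G = \<phi> (b h i)" "x \<in> X" "K = principal {x}"
          obtain M where M: "M \<in> \<Y>" "filterlim ((\<cdot>) x) M G"
            using mixed[OF *(3,1)] unfolding *(2) by blast
          show ?thesis
            using comm_limit[OF M(2) *(3) supX[OF GK(1)]] M(1)
            unfolding *(4) filterlim_prod_principal2 by (rule bexI)
        next
          fix h i h' j assume *: "h \<in> H" "G = \<phi> (b h i)" "h' \<in> H" "K = \<phi> (b h' j)"
          have "filterlim (\<lambda>(x, y). x \<cdot> y) (\<phi> (b (h \<cdot> h') (i + j))) (G \<times>\<^sub>F K)"
            using \<phi>_mult[OF b_coh[OF *(1)] b_coh[OF *(3)], of i j] unfolding *(2,4) \<phi>b_mult[OF *(1,3)] .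
          then show ?thesis
            using Y2[OF H_mult[OF *(1,3)]] by (rule bexI)
        qed
      qed
      show "N x \<in> \<Y>" if "x \<in> X" for x
        using NY[OF that] .
      show "inj_on N X"
      proof (rule inj_onI)
        fix x y assume xy: "x \<in> X" "y \<in> X" "N x = N y"
        have hp: "\<phi> (\<lambda>_. h) \<noteq> principal {z}" if "h \<in> H" "z \<notin> H" for h z
          using not_H[OF that(2) coh_const[OF that(1)]] by (auto simp: eventually_principal)
        \<comment> \<open>The linear topology is Hausdorff: the quotient \<open>t\<close> of
          \<open>h'\<close> by \<open>h\<close> lies in every \<open>L k\<close> and, being in
          \<open>L 0\<close>, in some \<open>F k\<close>, so it is \<open>e\<close>.\<close>
        have hh: "h = h'" if h: "h \<in> H" "h' \<in> H" "\<phi> (\<lambda>_. h) = \<phi> (\<lambda>_. h')" for h h'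
        proof -
          have hk: "h' \<in> cs (\<lambda>_. h) k" for k
            using \<phi>_eqD[OF coh_const[OF h(1)] coh_const[OF h(2)] h(3)] cs_self[OF coh_const[OF h(2)]] by blast
          then have "\<exists>t. t \<in> L k \<and> h' = h \<cdot> t" for k
            unfolding cs_def by blast
          then obtain t where t: "\<And>k. t k \<in> L k" "\<And>k. h' = h \<cdot> t k"
            by metis
          have t0: "t k = t 0" for k
            using H_cancel[OF per h(1), of "t k" "t 0"] t LH by metis
          obtain k where "t 0 \<in> F k"
            using L_ex_F t(1) by blast
          then have "t 0 = e"
            using L_disjoint[of "t 0" k] t(1)[of k] t0[of k] by simp
          then show ?thesis
            using t(2)[of 0] h(1) by simp
        qed
        consider "x \<notin> H" "y \<notin> H" | "x \<notin> H" "y \<in> H" | "x \<in> H" "y \<notin> H" | "x \<in> H" "y \<in> H" by blast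
        then show "x = y"
        proof cases
          case 1
          then have "principal {x} = principal {y}"
            using xy(3) by (simp add: N_def)
          then show ?thesis
            by simp
        next
          case 2
          then show ?thesis using xy(3) hp[OF 2(2,1)] by (simp add: N_def)
        next
          case 3
          then show ?thesis using xy(3) hp[OF 3] by (simp add: N_def)
        next
          case 4
          then show ?thesis using xy(3) hh[OF 4] by (simp add: N_def)
        qed
      qed
      show "filterlim (\<lambda>(x, y). x \<cdot> y) (N (x \<cdot> y)) (N x \<times>\<^sub>F N y)" if xy: "x \<in> X" "y \<in> X" for x y
      proof -
        have one: "filterlim ((\<cdot>) x) (\<phi> (\<lambda>_. x \<cdot> y)) (\<phi> (\<lambda>_. y))" if "x \<in> X" "y \<in> H" for x y
        proof -
          have "(e \<cdot> x) \<cdot> y = x \<cdot> y"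
            using that comm[of e x] by (simp add: assoc)
          then show ?thesis
            using \<phi>_mult1[OF that(1) coh_const[OF that(2)]] by simp
        qed
        consider "x \<notin> H" "y \<notin> H" | "x \<notin> H" "y \<in> H" | "x \<in> H" "y \<notin> H" | "x \<in> H" "y \<in> H" by blast
        then show ?thesis
        proof cases
          case 1
          then show ?thesis using N_limit[OF xy] by (simp add: N_def)
        next
          case 2
          then show ?thesis
            using one[OF xy(1) 2(2)] H_ideal[OF xy(1)] by (simp add: N_def filterlim_prod_principal1)
        next
          case 3
          then show ?thesis
            using comm_limit[OF one[OF xy(2) 3(1)] xy(2) evX[OF coh_const[OF 3(1)]]] H_ideal[OF xy(2) 3(1)] comm[OF xy]
            by (simp add: N_def filterlim_prod_principal2)
        next
          case 4
          then show ?thesis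
            using \<phi>_mult[OF coh_const coh_const] by (simp add: N_def)
        qed
      qed
      show "\<phi> s \<in> \<Y>"
        using Y2[OF e_in_H, of 1] b_s by simp
      show "\<exists>x\<in>X. eventually P (N x)" if P: "eventually P (\<phi> s)" for P
      proof -
        obtain k where k: "\<forall>x\<in>cs s k. P x"
          using P ev[OF coh_s] by auto
        \<comment> \<open>The element \<open>s k\<close> of \<open>H\<close> agrees with the limit
          up to level \<open>k\<close>, so the limit is in the closure of \<open>X\<close>.\<close>
        have "cs (\<lambda>_. s k) k = cs s k"
          by (simp add: cs_def)
        then have "eventually P (N (s k))"
          using k sH[of k] ev[OF coh_const[OF sH]] by (auto simp: N_def)
        then show ?thesis
          using sH by blast
      qed
    qed
    then obtain x where x: "x \<in> X" "\<phi> s = N x" by blast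
    show False
    proof (cases "x \<in> H")
      case True
      then show ?thesis using s_new[OF True] x(2) by (simp add: N_def)
    next
      case False
      then show ?thesis
        using not_H[OF False coh_s] x by (simp add: N_def eventually_principal)
    qed
  qed
qed

theorem finite_H_if_injectively_closed:
  fixes C :: "'b topsemigroup set"
  assumes "X \<lesssim> (UNIV :: 'b set)" "TzS \<subseteq> C" "injectively_closed C X mult"
  shows "finite H"
  using ex_root_set_infinite[OF per assms] root_set_finite[OF assms] by blast

end

end

section \<open>The characterization\<close>

text \<open>Its contrapositive carries nonsingularity to the image of \<open>X\<close>, where limits
  are taken. Injectivity makes the products of preimages constant.\<close>

lemma singular_semigroup_inj_image:
  assumes hom: "semigroup_hom X m m' h" and inj: "inj_on h X"
    and m: "\<And>x y. x \<in> X \<Longrightarrow> y \<in> X \<Longrightarrow> m x y \<in> X"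
    and sing: "singular_semigroup (h ` X) m'"
  shows "singular_semigroup X m"
proof -
  obtain A c where A: "A \<subseteq> h ` X" "infinite A" "{m' a b |a b. a \<in> A \<and> b \<in> A} = {c}"
    using sing unfolding singular_semigroup_def is_singleton_def by blast
  obtain B where B: "B \<subseteq> X" "A = h ` B"
    using A(1) by (auto simp: subset_image_iff)
  have "infinite B"
    using A(2) B(2) by auto
  then obtain b where b: "b \<in> B"
    by (metis finite.emptyI ex_in_conv)
  have h: "h (m x y) = c" if "x \<in> B" "y \<in> B" for x y
  proof -
    have "h (m x y) = m' (h x) (h y)"
      using hom B(1) that by (auto simp: semigroup_hom_def)
    also have "\<dots> \<in> {m' a b |a b. a \<in> A \<and> b \<in> A}"
      using B(2) that by blast
    finally show ?thesis
      using A(3) by simp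
  qed
  have "m x y = m b b" if "x \<in> B" "y \<in> B" for x y
    using inj_onD[OF inj] h[OF that] h[OF b b] that b B(1) m by (metis subsetD)
  then have "{m x y |x y. x \<in> B \<and> y \<in> B} = {m b b}"
    using b by blast
  then show ?thesis
    using B(1) \<open>infinite B\<close> unfolding singular_semigroup_def is_singleton_def by blast
qed

context unipotent_semigroup
begin

text \<open>The unit of any subgroup is an idempotent, hence \<open>e\<close>.\<close>

lemma subgroup_subset_H:
  assumes "G \<subseteq> X" and group: "group \<lparr>carrier = G, monoid.mult = mult, one = u\<rparr>"
  shows "G \<subseteq> H"
proof -
  interpret G: group "\<lparr>carrier = G, monoid.mult = mult, one = u\<rparr>"
    by (rule group)
  have "u \<in> X" "u \<cdot> u = u"
    using G.one_closed G.l_one[OF G.one_closed] assms(1) by auto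
  then have "u = e"
    by (rule e_unique)
  then have "e \<cdot> g = g" if "g \<in> G" for g
    using G.l_one[of g] that by simp
  then show ?thesis
    unfolding subset_iff H_iff using assms(1) by blast
qed

lemma group_H:
  assumes per: periodic
  shows "group \<lparr>carrier = H, monoid.mult = mult, one = e\<rparr>"
proof (rule groupI)
  fix x assume "x \<in> carrier \<lparr>carrier = H, monoid.mult = mult, one = e\<rparr>"
  then have x: "x \<in> H" by simp
  obtain y where "y \<in> H" "x \<cdot> y = e"
    using submonoid_H_inverse[OF per submonoid_H_H x] by blast
  then show "\<exists>y\<in>carrier \<lparr>carrier = H, monoid.mult = mult, one = e\<rparr>.
      y \<otimes>\<^bsub>\<lparr>carrier = H, monoid.mult = mult, one = e\<rparr>\<^esub> x = \<one>\<^bsub>\<lparr>carrier = H, monoid.mult = mult, one = e\<rparr>\<^esub>"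
    using x comm[of x y] by auto
qed (auto simp: assoc)

text \<open>The limit argument is applied to the image of \<open>X\<close> in the target, with the
  image of the finite group \<open>H\<close> as the finite set reached by \<open>n\<close>
  squarings.\<close>

theorem injectively_closed_if:
  fixes C :: "'b topsemigroup set"
  assumes C: "C \<subseteq> T1S" and bdd: "bounded_semigroup X mult"
    and ns: "nonsingular_semigroup X mult" and gf: "group_finite X mult"
  shows "injectively_closed C X mult"
proof -
  obtain n where n: "n \<ge> 1" "\<And>x. x \<in> X \<Longrightarrow> pow x n = e"
    using bdd e_unique unfolding bounded_semigroup_def idempotent_def by (metis pow_closed)
  then have per: periodic
    unfolding periodic_def by (intro ballI exI[of _ n]) auto
  have finH: "finite H"
    using gf exI[of "\<lambda>u. group \<lparr>carrier = H, monoid.mult = mult, one = u\<rparr>", OF group_H[OF per]] H_subset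
    unfolding group_finite_def by simp
  show ?thesis
    unfolding injectively_closed_def injectively_closed_top_def
  proof (clarsimp)
    fix T m' h
    assume Tm: "(T, m') \<in> C" and hT: "h \<in> X \<rightarrow> topspace T"
      and inj: "inj_on h X" and hom: "semigroup_hom X mult m' h"
    have top: "topological_semigroup (T, m')" and t1: "t1_space T"
      using Tm C by (auto simp: T1S_def)
    have h_mult: "m' (h x) (h y) = h (x \<cdot> y)" if "x \<in> X" "y \<in> X" for x y
      using hom that by (simp add: semigroup_hom_def)
    interpret Y: commutative_semigroup "h ` X" m'
    proof
      show "m' a b = m' b a" if "a \<in> h ` X" "b \<in> h ` X" for a b
        using that by (auto simp: h_mult intro: arg_cong[OF comm])
    qed (auto simp: h_mult assoc)
    have sq: "(Y.sq ^^ j) (h x) = h ((sq ^^ j) x)" if "x \<in> X" for x j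
    proof (induction j)
      case (Suc j)
      then show ?case
        using h_mult[of "(sq ^^ j) x" "(sq ^^ j) x"] that by (simp add: Y.sq_def[of "h _"] sq_def[of "(sq ^^ j) x"])
    qed simp
    show "closedin T (h ` X)"
    proof (rule Y.closedin_T1[OF top t1])
      show "h ` X \<subseteq> topspace T"
        using hT by auto
      show "nonsingular_semigroup (h ` X) m'"
        using singular_semigroup_inj_image[OF hom inj closed] ns by (auto simp: nonsingular_semigroup_def)
      show "finite (m' y ` h ` X)" if "y \<in> h ` X" for y
      proof -
        obtain x where x: "x \<in> X" "y = h x"
          using \<open>y \<in> h ` X\<close> by blast
        then have "m' y ` h ` X = h ` (\<cdot>) x ` X"
          using h_mult by (auto simp: image_image)
        then show ?thesis
          using finite_translates[OF ns finH x(1) n(2)[OF x(1)]] n(1) by simp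
      qed
      show "finite (h ` H)"
        using finH by simp
      show "h ` H \<subseteq> h ` X"
        using H_subset by blast
      show "(Y.sq ^^ n) y \<in> h ` H" if "y \<in> h ` X" for y
        using that sq sq_iter_in_H n by auto
    qed
  qed
qed

theorem injectively_closed_iff:
  fixes C :: "'b topsemigroup set"
  assumes "X \<lesssim> (UNIV :: 'b set)" and "TzS \<subseteq> C" and "C \<subseteq> T1S"
  shows "injectively_closed C X mult \<longleftrightarrow>
    bounded_semigroup X mult \<and> nonsingular_semigroup X mult \<and> group_finite X mult"
proof (intro iffI conjI)
  assume closed: "injectively_closed C X mult"
  have per: periodic
    using periodic_if_injectively_closed assms(1,2) closed .
  have finH: "finite H"
    using finite_H_if_injectively_closed[OF per] assms(1,2) closed .
  show ns: "nonsingular_semigroup X mult"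
    using nonsingular_if_injectively_closed assms(1,2) closed .
  show "bounded_semigroup X mult"
    using ns per finH by (rule bounded_if_periodic)
  show "group_finite X mult"
    using subgroup_subset_H finite_subset[OF _ finH] by (auto simp: group_finite_def)
qed (use injectively_closed_if[OF assms(3)] in blast)

end

theorem theorem1p5:
  fixes X :: "'a set" and m :: "'a \<Rightarrow> 'a \<Rightarrow> 'a" and C :: "'b topsemigroup set"
  assumes "X \<lesssim> (UNIV :: 'b set)"
    and "TzS \<subseteq> C" and "C \<subseteq> T1S"
    and "semigroup_on X m" and "commutative_on X m" and "unipotent X m"
  shows "injectively_closed C X m \<longleftrightarrow>
           bounded_semigroup X m \<and> nonsingular_semigroup X m \<and> group_finite X m"
proof -
  obtain e where e: "e \<in> X" "m e e = e" and unique: "\<And>x. x \<in> X \<Longrightarrow> m x x = x \<Longrightarrow> x = e"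
    using assms(6) unfolding unipotent_def idempotent_def by metis
  interpret unipotent_semigroup X m e
  proof
    show "m x y \<in> X" "m x y = m y x" if "x \<in> X" "y \<in> X" for x y
      using assms(4,5) that unfolding semigroup_on_def commutative_on_def by blast+
    show "m (m x y) z = m x (m y z)" if "x \<in> X" "y \<in> X" "z \<in> X" for x y z
      using assms(4) that unfolding semigroup_on_def by blast
  qed (use e unique in blast)+
  show ?thesis
    using assms(1-3) by (rule injectively_closed_iff)
qed

end
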